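(* The propositional epistemic planning problem is in $(k+1)$-EXPTIME for goal formulas of (knowledge-operator) nesting depth $k$. Moreover, in the same time one can build a finite word automaton $\mathcal{A}_{plans}$ whose language $L(\mathcal{A}_{plans})$ is exactly the set of all solution plans.
   Context: Fix a finite set $\mathcal{A}$ of agents and a finite set $AP$ of atomic propositions. The epistemic language $\mathcal{L}_{EL}$ is $\phi::=p\mid\neg\phi\mid\phi\vee\phi\mid K_i\phi$; the nesting depth of $\phi$ is the maximal nesting of knowledge operators $K_i$. An epistemic model is $\mathcal{M}=(W,\{R_i\}_{i\in\mathcal{A}},V)$ with finite $W$, $R_i\subseteq W\times W$, $V:AP\to2^W$, with the standard Kripke semantics ($\mathcal{M},w\models K_i\phi$ iff $\phi$ holds at every $R_i$-successor of $w$). An event model is $\mathcal{E}=(E,\{R^E_i\},\mathrm{pre},\mathrm{post})$ with finite $E$, $R^E_i\subseteq E\times E$, $\mathrm{pre}:E\to\mathcal{L}_{EL}$, $\mathrm{post}:E\to AP\to\mathcal{L}_{EL}$; it is propositional if all pre- and postconditions contain no knowledge operators. The update product $\mathcal{M}\otimes\mathcal{E}$ has worlds $\{(w,e)\mid\mathcal{M},w\models\mathrm{pre}(e)\}$, relations $(w,e)R^\otimes_i(w',e')$ iff $wR_iw'$ and $eR^E_ie'$, and valuation $(w,e)\in V^\otimes(p)$ iff $\mathcal{M},w\models\mathrm{post}(e)(p)$. For pointed models, $(\mathcal{M},w)\otimes(\mathcal{E},e)=(\mathcal{M}\otimes\mathcal{E},(w,e))$ if $\mathcal{M},w\models\mathrm{pre}(e)$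 and is undefined otherwise. The propositional epistemic planning problem: given a pointed epistemic model $(\mathcal{M},w_0)$, a propositional event model $\mathcal{E}$, a set of events $E'\subseteq E$ and a goal formula $\phi\in\mathcal{L}_{EL}$, decide whether there is a finite sequence $e_1\cdots e_n$ of events in $E'$ (a solution plan) such that $(\mathcal{M},w_0)\otimes(\mathcal{E},e_1)\otimes\cdots\otimes(\mathcal{E},e_n)$ is defined and satisfies $\phi$. Complexity is measured in the instance size $|\mathcal{M}|+|\mathcal{E}|+|E'|+|\phi|+|AP|$, where $|\mathcal{M}|=\sum_i|R_i|$ and $|\mathcal{E}|=\sum_i|R^E_i|+\sum_{e\in E}(|\mathrm{pre}(e)|+\sum_{p}|\mathrm{post}(e)(p)|)$.
   Formalization: The time bounds are in the length of the encoded instance and in the stated instance size plus the number of non-designated worlds incident to no edge, since |M| = sum of |R_i| does not count such worlds and so cannot bound the time to read the input. *)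

theory Defs
  imports Complex_Main "HOL-Computational_Algebra.Polynomial"
begin

section \<open>Epistemic language\<close>

text \<open>
  Propositions, agents and events are natural numbers; the sets of agents, of atomic propositions
  and of events are initial segments of the natural numbers.
\<close>

datatype form = Atom nat | Neg form | Or form form | Know nat form

text \<open>Formulas over the atomic propositions \<open>{..<n}\<close> and the agents \<open>{..<a}\<close>.\<close>

fun in_language :: "nat \<Rightarrow> nat \<Rightarrow> form \<Rightarrow> bool" where
  "in_language a n (Atom p) = (p < n)"
| "in_language a n (Neg \<phi>) = in_language a n \<phi>"
| "in_language a n (Or \<phi> \<psi>) = (in_language a n \<phi> \<and> in_language a n \<psi>)"
| "in_language a n (Know i \<phi>) = (i < a \<and> in_language a n \<phi>)"

fun nesting_depth :: "form \<Rightarrow> nat" where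
  "nesting_depth (Atom p) = 0"
| "nesting_depth (Neg \<phi>) = nesting_depth \<phi>"
| "nesting_depth (Or \<phi> \<psi>) = max (nesting_depth \<phi>) (nesting_depth \<psi>)"
| "nesting_depth (Know i \<phi>) = Suc (nesting_depth \<phi>)"

fun propositional :: "form \<Rightarrow> bool" where
  "propositional (Atom p) = True"
| "propositional (Neg \<phi>) = propositional \<phi>"
| "propositional (Or \<phi> \<psi>) = (propositional \<phi> \<and> propositional \<psi>)"
| "propositional (Know i \<phi>) = False"

fun form_size :: "form \<Rightarrow> nat" where
  "form_size (Atom p) = 1"
| "form_size (Neg \<phi>) = form_size \<phi> + 1"
| "form_size (Or \<phi> \<psi>) = form_size \<phi> + form_size \<psi> + 1"
| "form_size (Know i \<phi>) = form_size \<phi> + 1"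


section \<open>Epistemic models, event models and the update product\<close>

text \<open>
  \<open>Upd w e\<close> is the pair \<open>(w, e)\<close>. A recursive type of worlds gives all iterated products the same
  type.
\<close>

datatype world = Base nat | Upd world nat

record model =
  worlds :: "world set"
  rel :: "nat \<Rightarrow> (world \<times> world) set"
  val :: "nat \<Rightarrow> world set"

record event_model =
  events :: "nat set"
  erel :: "nat \<Rightarrow> (nat \<times> nat) set"
  pre :: "nat \<Rightarrow> form"
  post :: "nat \<Rightarrow> nat \<Rightarrow> form"

fun sat :: "model \<Rightarrow> world \<Rightarrow> form \<Rightarrow> bool" where
  "sat M w (Atom p) = (w \<in> val M p)"
| "sat M w (Neg \<phi>) = (\<not> sat M w \<phi>)"
| "sat M w (Or \<phi> \<psi>) = (sat M w \<phi> \<or> sat M w \<psi>)"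
| "sat M w (Know i \<phi>) = (\<forall>v. (w, v) \<in> rel M i \<longrightarrow> sat M v \<phi>)"

definition product_worlds :: "model \<Rightarrow> event_model \<Rightarrow> world set" where
  "product_worlds M E = {Upd w e | w e. w \<in> worlds M \<and> e \<in> events E \<and> sat M w (pre E e)}"

definition update_product :: "model \<Rightarrow> event_model \<Rightarrow> model" where
  "update_product M E =
     \<lparr> worlds = product_worlds M E,
       rel = (\<lambda>i. {(Upd w e, Upd w' e') | w e w' e'.
                Upd w e \<in> product_worlds M E \<and> Upd w' e' \<in> product_worlds M E \<and>
                (w, w') \<in> rel M i \<and> (e, e') \<in> erel E i}),
       val = (\<lambda>p. {Upd w e | w e. Upd w e \<in> product_worlds M E \<and> sat M w (post E e p)}) \<rparr>"

fun pointed_update :: "model \<times> world \<Rightarrow> event_model \<Rightarrow> nat \<Rightarrow> (model \<times> world) option" where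
  "pointed_update (M, w) E e =
     (if sat M w (pre E e) then Some (update_product M E, Upd w e) else None)"

fun pointed_updates :: "model \<times> world \<Rightarrow> event_model \<Rightarrow> nat list \<Rightarrow> (model \<times> world) option" where
  "pointed_updates s E [] = Some s"
| "pointed_updates s E (e # es) =
     Option.bind (pointed_update s E e) (\<lambda>s'. pointed_updates s' E es)"


section \<open>Propositional epistemic planning\<close>

text \<open>The atomic propositions of an instance \<open>I\<close> are \<open>{..<props I}\<close>, its initial world is
  \<open>Base (point I)\<close>.\<close>

record planning_instance =
  props :: nat
  init_model :: model
  point :: nat
  ev_model :: event_model
  allowed :: "nat set"
  goal_form :: form

definition wf_model :: "nat \<Rightarrow> nat \<Rightarrow> model \<Rightarrow> bool" where
  "wf_model a n M \<longleftrightarrow>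
     (\<exists>N. worlds M = Base ` {..<N}) \<and>
     (\<forall>i<a. rel M i \<subseteq> worlds M \<times> worlds M) \<and>
     (\<forall>p<n. val M p \<subseteq> worlds M)"

definition wf_prop_event_model :: "nat \<Rightarrow> nat \<Rightarrow> event_model \<Rightarrow> bool" where
  "wf_prop_event_model a n E \<longleftrightarrow>
     (\<exists>m. events E = {..<m}) \<and>
     (\<forall>i<a. erel E i \<subseteq> events E \<times> events E) \<and>
     (\<forall>e\<in>events E. in_language a n (pre E e) \<and> propositional (pre E e)) \<and>
     (\<forall>e\<in>events E. \<forall>p<n. in_language a n (post E e p) \<and> propositional (post E e p))"

definition wf_instance :: "nat \<Rightarrow> planning_instance \<Rightarrow> bool" where
  "wf_instance a I \<longleftrightarrow>
     wf_model a (props I) (init_model I) \<and>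
     Base (point I) \<in> worlds (init_model I) \<and>
     wf_prop_event_model a (props I) (ev_model I) \<and>
     allowed I \<subseteq> events (ev_model I) \<and>
     in_language a (props I) (goal_form I)"

definition solution_plans :: "planning_instance \<Rightarrow> nat list set" where
  "solution_plans I =
     {es. set es \<subseteq> allowed I \<and>
          (\<exists>M w. pointed_updates (init_model I, Base (point I)) (ev_model I) es = Some (M, w) \<and>
                 sat M w (goal_form I))}"

definition model_size :: "nat \<Rightarrow> model \<Rightarrow> nat" where
  "model_size a M = (\<Sum>i<a. card (rel M i))"

definition event_model_size :: "nat \<Rightarrow> nat \<Rightarrow> event_model \<Rightarrow> nat" where
  "event_model_size a n E =
     (\<Sum>i<a. card (erel E i)) +
     (\<Sum>e\<in>events E. form_size (pre E e) + (\<Sum>p<n. form_size (post E e p)))"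

definition instance_size :: "nat \<Rightarrow> planning_instance \<Rightarrow> nat" where
  "instance_size a I =
     model_size a (init_model I) + event_model_size a (props I) (ev_model I) +
     card (allowed I) + form_size (goal_form I) + props I"

text \<open>
  \<open>instance_size\<close> counts edges, so it does not see worlds that are incident to no edge. No encoding
  of an instance is bounded in terms of \<open>instance_size\<close> alone, and these worlds are therefore
  counted separately.
\<close>

definition idle_worlds :: "nat \<Rightarrow> planning_instance \<Rightarrow> world set" where
  "idle_worlds a I =
     {w \<in> worlds (init_model I). w \<noteq> Base (point I) \<and> (\<forall>i<a. w \<notin> Field (rel (init_model I) i))}"


section \<open>Finite word automata\<close>

record nfa =
  nfa_states :: nat
  nfa_init :: "nat list"
  nfa_final :: "nat list"
  nfa_trans :: "(nat \<times> nat \<times> nat) list"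

text \<open>A transition \<open>(q, e, q')\<close> goes from state \<open>q\<close> to state \<open>q'\<close> reading the letter \<open>e\<close>.\<close>

definition wf_nfa :: "nat set \<Rightarrow> nfa \<Rightarrow> bool" where
  "wf_nfa \<Sigma> A \<longleftrightarrow>
     set (nfa_init A) \<subseteq> {..<nfa_states A} \<and>
     set (nfa_final A) \<subseteq> {..<nfa_states A} \<and>
     set (nfa_trans A) \<subseteq> {..<nfa_states A} \<times> \<Sigma> \<times> {..<nfa_states A}"

inductive nfa_path :: "nfa \<Rightarrow> nat \<Rightarrow> nat list \<Rightarrow> nat \<Rightarrow> bool" for A where
  "nfa_path A q [] q"
| "(q, e, q') \<in> set (nfa_trans A) \<Longrightarrow> nfa_path A q' es q'' \<Longrightarrow> nfa_path A q (e # es) q''"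

definition nfa_language :: "nfa \<Rightarrow> nat list set" where
  "nfa_language A = {es. \<exists>q\<in>set (nfa_init A). \<exists>q'\<in>set (nfa_final A). nfa_path A q es q'}"


section \<open>Binary encodings\<close>

text \<open>
  Numbers are written in unary. In instances they are indices of worlds, events, propositions and
  agents, all of which are listed explicitly anyway. All codes are self-delimiting.
\<close>

definition enc_nat :: "nat \<Rightarrow> bool list" where
  "enc_nat n = replicate n True @ [False]"

definition enc_list :: "('a \<Rightarrow> bool list) \<Rightarrow> 'a list \<Rightarrow> bool list" where
  "enc_list f xs = enc_nat (length xs) @ concat (map f xs)"

fun enc_form :: "form \<Rightarrow> bool list" where
  "enc_form (Atom p) = enc_nat 0 @ enc_nat p"
| "enc_form (Neg \<phi>) = enc_nat 1 @ enc_form \<phi>"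
| "enc_form (Or \<phi> \<psi>) = enc_nat 2 @ enc_form \<phi> @ enc_form \<psi>"
| "enc_form (Know i \<phi>) = enc_nat 3 @ enc_nat i @ enc_form \<phi>"

definition enc_rel :: "nat \<Rightarrow> (nat \<Rightarrow> 'a) \<Rightarrow> ('a \<times> 'a) set \<Rightarrow> bool list" where
  "enc_rel N f R = map (\<lambda>(v, w). (f v, f w) \<in> R) (List.product [0..<N] [0..<N])"

definition enc_set :: "nat \<Rightarrow> (nat \<Rightarrow> 'a) \<Rightarrow> 'a set \<Rightarrow> bool list" where
  "enc_set N f S = map (\<lambda>v. f v \<in> S) [0..<N]"

definition enc_model :: "nat \<Rightarrow> nat \<Rightarrow> model \<Rightarrow> bool list" where
  "enc_model a n M =
     (let N = card (worlds M) in
        enc_nat N @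
        concat (map (\<lambda>i. enc_rel N Base (rel M i)) [0..<a]) @
        concat (map (\<lambda>p. enc_set N Base (val M p)) [0..<n]))"

definition enc_event_model :: "nat \<Rightarrow> nat \<Rightarrow> event_model \<Rightarrow> bool list" where
  "enc_event_model a n E =
     (let m = card (events E) in
        enc_nat m @
        concat (map (\<lambda>i. enc_rel m id (erel E i)) [0..<a]) @
        concat (map (\<lambda>e. enc_form (pre E e) @
                         concat (map (\<lambda>p. enc_form (post E e p)) [0..<n])) [0..<m]))"

definition enc_instance :: "nat \<Rightarrow> planning_instance \<Rightarrow> bool list" where
  "enc_instance a I =
     enc_nat (props I) @
     enc_model a (props I) (init_model I) @
     enc_nat (point I) @
     enc_event_model a (props I) (ev_model I) @
     enc_set (card (events (ev_model I))) id (allowed I) @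
     enc_form (goal_form I)"

definition enc_nfa :: "nfa \<Rightarrow> bool list" where
  "enc_nfa A =
     enc_nat (nfa_states A) @
     enc_list enc_nat (nfa_init A) @
     enc_list enc_nat (nfa_final A) @
     enc_list (\<lambda>(q, e, q'). enc_nat q @ enc_nat e @ enc_nat q') (nfa_trans A)"

definition planning_language :: "nat \<Rightarrow> nat \<Rightarrow> bool list set" where
  "planning_language a k =
     {enc_instance a I | I. wf_instance a I \<and> nesting_depth (goal_form I) = k \<and>
                            solution_plans I \<noteq> {}}"


section \<open>Deterministic multitape Turing machines\<close>

text \<open>
  States are \<open>{..<tm_states M}\<close>, tape symbols are \<open>{..<tm_symbols M}\<close> with blank symbol \<open>0\<close>. Tapes are
  infinite in both directions. Tape \<open>0\<close> holds the input, tape \<open>1\<close> receives the output.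
\<close>

datatype dir = MoveL | MoveN | MoveR

record tm =
  tm_tapes :: nat
  tm_symbols :: nat
  tm_states :: nat
  tm_start :: nat
  tm_accept :: nat
  tm_reject :: nat
  tm_delta :: "nat \<Rightarrow> nat list \<Rightarrow> nat \<times> (nat \<times> dir) list"

type_synonym tape = "(int \<Rightarrow> nat) \<times> int"
type_synonym config = "nat \<times> tape list"

definition wf_tm :: "tm \<Rightarrow> bool" where
  "wf_tm M \<longleftrightarrow>
     2 \<le> tm_tapes M \<and> 3 \<le> tm_symbols M \<and>
     tm_start M < tm_states M \<and> tm_accept M < tm_states M \<and> tm_reject M < tm_states M \<and>
     tm_accept M \<noteq> tm_reject M \<and>
     (\<forall>q ss. q < tm_states M \<longrightarrow> length ss = tm_tapes M \<longrightarrow> set ss \<subseteq> {..<tm_symbols M} \<longrightarrow>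
        fst (tm_delta M q ss) < tm_states M \<and>
        length (snd (tm_delta M q ss)) = tm_tapes M \<and>
        fst ` set (snd (tm_delta M q ss)) \<subseteq> {..<tm_symbols M})"

fun move :: "dir \<Rightarrow> int \<Rightarrow> int" where
  "move MoveL h = h - 1"
| "move MoveN h = h"
| "move MoveR h = h + 1"

fun tape_read :: "tape \<Rightarrow> nat" where
  "tape_read (f, h) = f h"

fun tape_act :: "nat \<times> dir \<Rightarrow> tape \<Rightarrow> tape" where
  "tape_act (s, d) (f, h) = (f(h := s), move d h)"

definition halted :: "tm \<Rightarrow> config \<Rightarrow> bool" where
  "halted M c \<longleftrightarrow> fst c = tm_accept M \<or> fst c = tm_reject M"

definition tm_step :: "tm \<Rightarrow> config \<Rightarrow> config" where
  "tm_step M c =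
     (if halted M c then c
      else let (q', as) = tm_delta M (fst c) (map tape_read (snd c))
           in (q', map2 tape_act as (snd c)))"

definition bit_symbol :: "bool \<Rightarrow> nat" where
  "bit_symbol b = (if b then 2 else 1)"

definition input_tape :: "bool list \<Rightarrow> tape" where
  "input_tape x =
     (\<lambda>j. if 0 \<le> j \<and> j < int (length x) then bit_symbol (x ! nat j) else 0, 0)"

definition blank_tape :: tape where
  "blank_tape = (\<lambda>j. 0, 0)"

definition initial_config :: "tm \<Rightarrow> bool list \<Rightarrow> config" where
  "initial_config M x = (tm_start M, input_tape x # replicate (tm_tapes M - 1) blank_tape)"

definition tm_run :: "tm \<Rightarrow> bool list \<Rightarrow> nat \<Rightarrow> config" where
  "tm_run M x t = (tm_step M ^^ t) (initial_config M x)"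

text \<open>The output is the word between cell \<open>0\<close> and the first blank to the right of it.\<close>

definition has_output :: "config \<Rightarrow> bool list \<Rightarrow> bool" where
  "has_output c y \<longleftrightarrow>
     (\<forall>j<length y. fst (snd c ! 1) (int j) = bit_symbol (y ! j)) \<and>
     fst (snd c ! 1) (int (length y)) = 0"

definition accepts_within :: "tm \<Rightarrow> bool list \<Rightarrow> nat \<Rightarrow> bool" where
  "accepts_within M x T \<longleftrightarrow> (\<exists>t\<le>T. fst (tm_run M x t) = tm_accept M)"

definition rejects_within :: "tm \<Rightarrow> bool list \<Rightarrow> nat \<Rightarrow> bool" where
  "rejects_within M x T \<longleftrightarrow> (\<exists>t\<le>T. fst (tm_run M x t) = tm_reject M)"

definition outputs_within :: "tm \<Rightarrow> bool list \<Rightarrow> bool list \<Rightarrow> nat \<Rightarrow> bool" where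
  "outputs_within M x y T \<longleftrightarrow>
     (\<exists>t\<le>T. fst (tm_run M x t) = tm_accept M \<and> has_output (tm_run M x t) y)"


section \<open>Iterated exponential time\<close>

fun iter_exp :: "nat \<Rightarrow> nat \<Rightarrow> nat" where
  "iter_exp 0 n = n"
| "iter_exp (Suc j) n = 2 ^ iter_exp j n"

definition k_EXPTIME :: "nat \<Rightarrow> bool list set set" where
  "k_EXPTIME j =
     {L. \<exists>(M :: tm) (P :: nat poly). wf_tm M \<and>
           (\<forall>x. (x \<in> L \<longrightarrow> accepts_within M x (iter_exp j (poly P (length x)))) \<and>
                (x \<notin> L \<longrightarrow> rejects_within M x (iter_exp j (poly P (length x)))))}"


section \<open>Length of encodings\<close>

text \<open>
  The encoding is polynomial in \<open>instance_size\<close> and the number of idle worlds. Time bounds that are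
  polynomial or iterated exponential in the length of the encoding are thus bounds of the same kind
  in these parameters.
\<close>

lemma length_enc_nat [simp]: "length (enc_nat n) = n + 1"
  by (simp add: enc_nat_def)

lemma length_enc_form:
  "in_language a n \<phi> \<Longrightarrow> length (enc_form \<phi>) \<le> (5 + a + n) * form_size \<phi>"
  by (induction \<phi>) (auto simp: algebra_simps)

lemma length_concat_map_upt:
  "length (concat (map f [0..<n])) = (\<Sum>i<n. length (f i))"
  by (simp add: length_concat comp_def interv_sum_list_conv_sum_set_nat atLeast0LessThan)

lemma card_Field_le:
  assumes "finite R"
  shows "finite (Field R)" "card (Field R) \<le> 2 * card R"
proof -
  have *: "Field R = fst ` R \<union> snd ` R"
    by (force simp: Field_def)
  show "finite (Field R)"
    using assms by (simp add: *)
  have "card (Field R) \<le> card (fst ` R) + card (snd ` R)"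
    unfolding * by (rule card_Un_le)
  also have "\<dots> \<le> card R + card R"
    by (intro add_mono card_image_le assms)
  finally show "card (Field R) \<le> 2 * card R"
    by simp
qed

lemma card_worlds_le:
  assumes "wf_instance a I"
  shows "card (worlds (init_model I)) \<le>
    2 * model_size a (init_model I) + card (idle_worlds a I) + 1"
proof -
  let ?M = "init_model I"
  have fin: "finite (worlds ?M)"
    using assms by (auto simp: wf_instance_def wf_model_def)
  have finR: "finite (rel ?M i)" if "i < a" for i
  proof (rule finite_subset)
    show "rel ?M i \<subseteq> worlds ?M \<times> worlds ?M"
      using assms that unfolding wf_instance_def wf_model_def by blast
  qed (use fin in simp)
  have fin_idle: "finite (idle_worlds a I)"
    using fin by (simp add: idle_worlds_def)
  have sub: "worlds ?M \<subseteq> insert (Base (point I)) (idle_worlds a I \<union> (\<Union>i<a. Field (rel ?M i)))"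
    by (auto simp: idle_worlds_def)
  have "card (worlds ?M) \<le>
      card (insert (Base (point I)) (idle_worlds a I \<union> (\<Union>i<a. Field (rel ?M i))))"
    using fin_idle finR by (intro card_mono sub) (auto intro: card_Field_le)
  also have "\<dots> \<le> Suc (card (idle_worlds a I \<union> (\<Union>i<a. Field (rel ?M i))))"
    by (rule card_insert_le_m1) auto
  also have "\<dots> \<le> Suc (card (idle_worlds a I) + card (\<Union>i<a. Field (rel ?M i)))"
    by (simp add: card_Un_le)
  also have "card (\<Union>i<a. Field (rel ?M i)) \<le> (\<Sum>i<a. card (Field (rel ?M i)))"
    by (rule card_UN_le) simp
  also have "\<dots> \<le> (\<Sum>i<a. 2 * card (rel ?M i))"
    using finR by (intro sum_mono card_Field_le) auto
  also have "\<dots> = 2 * model_size a ?M"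
    by (simp add: model_size_def sum_distrib_left)
  finally show ?thesis
    by simp
qed

lemma form_size_pos: "1 \<le> form_size \<phi>"
  by (induction \<phi>) auto

lemma length_enc_instance:
  assumes "wf_instance a I"
  shows "length (enc_instance a I) \<le>
    (6 * a + 20) * (instance_size a I + card (idle_worlds a I) + 1)\<^sup>2"
proof -
  define s where "s = instance_size a I + card (idle_worlds a I) + 1"
  define n where "n = props I"
  define N where "N = card (worlds (init_model I))"
  define E where "E = ev_model I"
  define m where "m = card (events E)"
  define F where "F = (\<Sum>e\<in>events E. form_size (pre E e) + (\<Sum>p<n. form_size (post E e p)))"
  define G where "G = form_size (goal_form I)"
  have N: "N \<le> 2 * s"
    using card_worlds_le[OF assms] by (simp add: N_def s_def instance_size_def)
  have ev: "events E = {..<m}"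
    using assms by (auto simp: m_def E_def wf_instance_def wf_prop_event_model_def)
  have FG: "F + G + n \<le> s"
    by (simp add: F_def G_def s_def instance_size_def event_model_size_def E_def n_def)
  have "m = (\<Sum>e\<in>events E. 1)"
    by (simp add: m_def)
  also have "\<dots> \<le> F"
    unfolding F_def by (intro sum_mono) (use form_size_pos in \<open>simp add: trans_le_add1\<close>)
  finally have m: "m \<le> F" .
  have "Base (point I) \<in> worlds (init_model I)" "\<exists>N. worlds (init_model I) = Base ` {..<N}"
    using assms by (auto simp: wf_instance_def wf_model_def)
  then have pt: "point I < N"
    by (auto simp: N_def card_image inj_on_def)
  have "length (concat (map (\<lambda>e. enc_form (pre E e) @
           concat (map (\<lambda>p. enc_form (post E e p)) [0..<n])) [0..<m])) =
        (\<Sum>e\<in>events E. length (enc_form (pre E e)) + (\<Sum>p<n. length (enc_form (post E e p))))"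
    by (simp add: length_concat_map_upt ev del: length_concat)
  also have "\<dots> \<le> (\<Sum>e\<in>events E. (5 + a + n) * form_size (pre E e) +
                                (\<Sum>p<n. (5 + a + n) * form_size (post E e p)))"
    using assms
    by (intro sum_mono add_mono length_enc_form)
       (auto simp: wf_instance_def wf_prop_event_model_def E_def n_def)
  also have "\<dots> = (5 + a + n) * F"
    by (simp add: F_def sum_distrib_left distrib_left)
  finally have forms: "length (concat (map (\<lambda>e. enc_form (pre E e) @
           concat (map (\<lambda>p. enc_form (post E e p)) [0..<n])) [0..<m])) \<le> (5 + a + n) * F" .
  have goal: "length (enc_form (goal_form I)) \<le> (5 + a + n) * G"
    using assms by (auto simp: wf_instance_def G_def n_def intro: length_enc_form)
  have em: "length (enc_model a n (init_model I)) = N + 1 + a * (N * N) + n * N"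
    by (simp add: enc_model_def Let_def length_concat_map_upt enc_rel_def enc_set_def
          flip: N_def del: length_concat)
  have ee: "length (enc_event_model a n E) \<le> m + 1 + a * (m * m) + (5 + a + n) * F"
    using forms
    by (simp add: enc_event_model_def Let_def length_concat_map_upt enc_rel_def
          flip: m_def del: length_concat)
  have "length (enc_instance a I) \<le> (n + 1) + (N + 1 + a * (N * N) + n * N) + (point I + 1) +
      (m + 1 + a * (m * m) + (5 + a + n) * F) + m + (5 + a + n) * G"
    using em ee goal
    by (simp add: enc_instance_def enc_set_def n_def[symmetric] E_def[symmetric] m_def[symmetric])
  also have "\<dots> = n + 4 + N + point I + 2 * m + a * (N * N) + a * (m * m) + n * N +
      (5 + a + n) * (F + G)"
    by (simp add: algebra_simps)
  also have "\<dots> \<le> s + 4 * s + 2 * s + 2 * s + 2 * s + a * (2 * s * (2 * s)) + a * (s * s) +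
      s * (2 * s) + (5 * s + a * s + s) * s"
  proof -
    have s1: "1 \<le> s" by (simp add: s_def)
    have "5 + a + n \<le> 5 * s + a * s + s"
      using s1 FG by (intro add_mono) (auto simp: Suc_le_eq)
    then have "(5 + a + n) * (F + G) \<le> (5 * s + a * s + s) * s"
      using FG by (intro mult_mono) auto
    moreover have "a * (N * N) \<le> a * (2 * s * (2 * s))"
      using N by (intro mult_mono) auto
    moreover have "a * (m * m) \<le> a * (s * s)"
      using m FG by (intro mult_mono) auto
    moreover have "n * N \<le> s * (2 * s)"
      using N FG by (intro mult_mono) auto
    ultimately show ?thesis
      using s1 N FG m pt by linarith
  qed
  also have "\<dots> = 11 * s + (6 * a + 8) * s\<^sup>2"
    by (simp add: power2_eq_square algebra_simps)
  also have "\<dots> \<le> (6 * a + 20) * s\<^sup>2"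
    by (simp add: s_def power2_eq_square algebra_simps)
  finally show ?thesis
    by (simp add: s_def)
qed

end

theory Submission
  imports Defs
begin

text \<open>
  Since pre- and postconditions are propositional, the \<open>k\<close>-type of a world \<open>(w, e)\<close> of a product, that
  is, its \<open>k\<close>-bisimulation class, is a function of \<open>e\<close> and of the \<open>k\<close>-type of \<open>w\<close>, and the \<open>k\<close>-type
  decides all formulas of nesting depth at most \<open>k\<close>. The \<open>k\<close>-types are therefore the states of an
  automaton for the solution plans. There are \<open>2 ^ n\<close> types of level \<open>0\<close> and \<open>2 ^ (n + a * t)\<close> types of
  level \<open>j + 1\<close> if there are \<open>t\<close> types of level \<open>j\<close>, so a type of level \<open>k\<close> is a number below a
  \<open>(k + 1)\<close>-fold exponential whose bits are the propositions and the sets of successor types.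

  With a time bound of this size all numbers can be kept in unary on the tapes of a Turing machine.
  Functions computable in time polynomial in the values of their arguments are closed under
  arithmetic, bounded recursion and bounded quantification, so it suffices to define parsing,
  evaluation of formulas and the automaton by formulas with bounded quantifiers. Reachability in the
  automaton is decided by a search whose set of visited types is kept on a separate tape.
\<close>

section \<open>A structured language compiled to Turing machines\<close>

text \<open>Three questions of size shape the proof. Powers are not polynomial in the values, so the
  towers of levels \<open>0\<close> to \<open>k\<close> and the table bound
  \<open>2 ^ ((L + 1) * (L + 1))\<close> are computed once, before the main program, and kept in
  registers; afterwards they only bound quantifiers and loops. Since \<open>k\<close> is fixed for
  each machine, recursion on the level is unrolled into a formula of fixed shape. Next, formulas are
  trees hidden in a bit word, whereas bounded recursion runs along a counter. Parsing and evaluation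
  are therefore expressed by the existence of a table over all pairs of positions that obeys local
  rules. Such a table has polynomially many bits, so its number is a single exponential and can be
  quantified over already for \<open>k = 0\<close>. Finally, a set of types written as a number
  would cost one exponential more than the types themselves. The visited types are therefore marked
  on a tape, and no value ever stands for the whole set.\<close>

datatype com =
    Put nat nat
  | Mov nat dir
  | Seq com com
  | If nat nat com com
  | While nat nat com

type_synonym store = "nat \<Rightarrow> tape"

text \<open>The times equal machine steps exactly: \<open>Seq\<close>, \<open>If\<close> and
  \<open>While\<close> pay one step for rewriting the continuation.\<close>

inductive exec :: "com \<Rightarrow> store \<Rightarrow> nat \<Rightarrow> store \<Rightarrow> bool" where
  exec_Put: "exec (Put j s) \<sigma> 1 (\<sigma>(j := tape_act (s, MoveN) (\<sigma> j)))"
| exec_Mov: "exec (Mov j d) \<sigma> 1 (\<sigma>(j := tape_act (tape_read (\<sigma> j), d) (\<sigma> j)))"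
| exec_Seq: "exec c \<sigma> t \<sigma>' \<Longrightarrow> exec c' \<sigma>' t' \<sigma>'' \<Longrightarrow> exec (Seq c c') \<sigma> (1 + t + t') \<sigma>''"
| exec_If: "exec (if tape_read (\<sigma> j) = s then c else c') \<sigma> t \<sigma>' \<Longrightarrow> exec (If j s c c') \<sigma> (1 + t) \<sigma>'"
| exec_While_stop: "tape_read (\<sigma> j) = s \<Longrightarrow> exec (While j s c) \<sigma> 1 \<sigma>"
| exec_While_loop: "tape_read (\<sigma> j) \<noteq> s \<Longrightarrow> exec c \<sigma> t \<sigma>' \<Longrightarrow> exec (While j s c) \<sigma>' t' \<sigma>'' \<Longrightarrow>
    exec (While j s c) \<sigma> (1 + t + t') \<sigma>''"

fun com_within :: "nat \<Rightarrow> nat \<Rightarrow> com \<Rightarrow> bool" where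
  "com_within K N (Put j s) = (j < K \<and> s < N)"
| "com_within K N (Mov j d) = (j < K)"
| "com_within K N (Seq c c') = (com_within K N c \<and> com_within K N c')"
| "com_within K N (If j s c c') = (j < K \<and> com_within K N c \<and> com_within K N c')"
| "com_within K N (While j s c) = (j < K \<and> com_within K N c)"

lemma com_within_mono: "com_within K N c \<Longrightarrow> K \<le> K' \<Longrightarrow> N \<le> N' \<Longrightarrow> com_within K' N' c"
  by (induction c) auto

lemma ex_com_within: "\<exists>K. com_within K K c"
proof (induction c)
  case (Put j s)
  have "com_within (Suc (j + s)) (Suc (j + s)) (Put j s)" by simp
  then show ?case by blast
next
  case (Mov j d)
  have "com_within (Suc j) (Suc j) (Mov j d)" by simp
  then show ?case by blast
next
  case (Seq c1 c2)
  then obtain K1 K2 where "com_within K1 K1 c1" "com_within K2 K2 c2" by blast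
  then have "com_within (K1 + K2) (K1 + K2) (Seq c1 c2)"
    by (auto elim: com_within_mono)
  then show ?case by blast
next
  case (If j s c1 c2)
  then obtain K1 K2 where "com_within K1 K1 c1" "com_within K2 K2 c2" by blast
  then have "com_within (Suc j + K1 + K2) (Suc j + K1 + K2) (If j s c1 c2)"
    by (auto elim: com_within_mono)
  then show ?case by blast
next
  case (While j s c)
  then obtain K1 where "com_within K1 K1 c" by blast
  then have "com_within (Suc j + K1) (Suc j + K1) (While j s c)"
    by (auto elim: com_within_mono)
  then show ?case by blast
qed

text \<open>The continuations that can arise while \<open>c\<close> runs in front of the continuation \<open>ks\<close>. There are
  finitely many of them, and they serve as the states of the Turing machine.\<close>

fun conts :: "com \<Rightarrow> com list \<Rightarrow> com list set" where
  "conts (Put j s) ks = {Put j s # ks}"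
| "conts (Mov j d) ks = {Mov j d # ks}"
| "conts (Seq c c') ks = insert (Seq c c' # ks) (conts c (c' # ks) \<union> conts c' ks)"
| "conts (If j s c c') ks = insert (If j s c c' # ks) (conts c ks \<union> conts c' ks)"
| "conts (While j s c) ks = insert (While j s c # ks) (conts c (While j s c # ks))"

lemma finite_conts: "finite (conts c ks)"
  by (induction c arbitrary: ks) auto

lemma Cons_in_conts: "c # ks \<in> conts c ks"
  by (cases c) auto

fun next_cont :: "com list \<Rightarrow> nat list \<Rightarrow> com list" where
  "next_cont (Put j s # ks) ss = ks"
| "next_cont (Mov j d # ks) ss = ks"
| "next_cont (Seq c c' # ks) ss = c # c' # ks"
| "next_cont (If j s c c' # ks) ss = (if ss ! j = s then c else c') # ks"
| "next_cont (While j s c # ks) ss = (if ss ! j = s then ks else c # While j s c # ks)"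
| "next_cont [] ss = []"

lemma next_cont_in_conts:
  "ls \<in> conts c ks \<Longrightarrow> next_cont ls ss \<in> insert ks (conts c ks)"
proof (induction c arbitrary: ks)
  case (Seq c1 c2)
  show ?case
    using Seq.prems Seq.IH(1)[of "c2 # ks"] Seq.IH(2)[of ks] Cons_in_conts[of c1 "c2 # ks"] Cons_in_conts[of c2 ks]
    by auto
next
  case (If j s c1 c2)
  show ?case
    using If.prems If.IH(1)[of ks] If.IH(2)[of ks] Cons_in_conts[of c1 ks] Cons_in_conts[of c2 ks] by auto
next
  case (While j s c)
  show ?case
    using While.prems While.IH[of "While j s c # ks"] Cons_in_conts[of c "While j s c # ks"]
    by (cases "ls = While j s c # ks") auto
qed auto

text \<open>A machine writes on all tapes in each step, so tapes that the command does not touch get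
  their own symbol back.\<close>

fun cont_actions :: "com list \<Rightarrow> nat list \<Rightarrow> (nat \<times> dir) list" where
  "cont_actions (Put j s # ks) ss = (map (\<lambda>s. (s, MoveN)) ss)[j := (s, MoveN)]"
| "cont_actions (Mov j d # ks) ss = (map (\<lambda>s. (s, MoveN)) ss)[j := (ss ! j, d)]"
| "cont_actions ks ss = map (\<lambda>s. (s, MoveN)) ss"

lemma length_cont_actions [simp]: "length (cont_actions ks ss) = length ss"
  by (cases "(ks, ss)" rule: cont_actions.cases) auto

lemma cont_actions_symbols:
  assumes "list_all (com_within (length ss) N) ks" "set ss \<subseteq> {..<N}"
  shows "fst ` set (cont_actions ks ss) \<subseteq> {..<N}"
proof -
  have stay: "fst ` set (map (\<lambda>s. (s, MoveN)) ss) \<subseteq> {..<N}"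
    using assms(2) by (simp add: image_image)
  have upd: "fst ` set ((map (\<lambda>s. (s, MoveN)) ss)[j := (b, d)]) \<subseteq> {..<N}" if "b < N" for j b d
    using image_mono[OF set_update_subset_insert[of "map (\<lambda>s. (s, MoveN)) ss" j "(b, d)"], of fst]
      stay that by auto
  have sym: "ss ! j < N" if "j < length ss" for j
    using assms(2) that by (meson lessThan_iff nth_mem subset_iff)
  show ?thesis
  proof (cases ks)
    case Nil
    then show ?thesis using stay by simp
  next
    case (Cons c ks')
    then show ?thesis
      using assms(1) stay upd sym by (cases c) simp_all
  qed
qed

lemma conts_within:
  "com_within K N c \<Longrightarrow> list_all (com_within K N) ks \<Longrightarrow> ls \<in> conts c ks \<Longrightarrow> list_all (com_within K N) ls"
proof (induction c arbitrary: ks)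
  case (Seq c1 c2)
  show ?case using Seq.prems Seq.IH(1)[of "c2 # ks"] Seq.IH(2)[of ks] by auto
next
  case (If j s c1 c2)
  show ?case using If.prems If.IH(1)[of ks] If.IH(2)[of ks] by auto
next
  case (While j s c)
  show ?case using While.prems While.IH[of "While j s c # ks"] by auto
qed auto

section \<open>Turing machines whose states are continuations\<close>

definition com_states :: "com \<Rightarrow> com list set" where
  "com_states c = insert [] (conts c [])"

definition state_index :: "com \<Rightarrow> com list \<Rightarrow> nat" where
  "state_index c = (SOME h. bij_betw h (com_states c) {..<card (com_states c)})"

lemma finite_com_states: "finite (com_states c)"
  by (simp add: com_states_def finite_conts)

lemma state_index_bij: "bij_betw (state_index c) (com_states c) {..<card (com_states c)}"
  unfolding state_index_def
  by (rule someI_ex[OF ex_bij_betw_finite_nat[OF finite_com_states, unfolded atLeast0LessThan]])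

text \<open>The two additional states are the halting ones. At the empty continuation the verdict is
  read from tape 2, where symbol \<open>3\<close> will mean that the head position belongs to the
  stored set.\<close>

definition tm_of_com :: "nat \<Rightarrow> nat \<Rightarrow> com \<Rightarrow> tm" where
  "tm_of_com K N c = (let S = com_states c; h = state_index c in
     \<lparr> tm_tapes = K, tm_symbols = N, tm_states = card S + 2,
       tm_start = h [c], tm_accept = card S, tm_reject = card S + 1,
       tm_delta = (\<lambda>q ss. if q < card S then
           (let ks = inv_into S h q in
             ((if ks = [] then (if ss ! 2 = 3 then card S else card S + 1) else h (next_cont ks ss)),
              cont_actions ks ss))
         else (q, map (\<lambda>s. (s, MoveN)) ss)) \<rparr>)"

lemma com_states_closed:
  "ks \<in> com_states c \<Longrightarrow> next_cont ks ss \<in> com_states c"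
  using next_cont_in_conts[of ks c "[]" ss] by (auto simp: com_states_def)

lemma state_index_less: "ks \<in> com_states c \<Longrightarrow> state_index c ks < card (com_states c)"
  using state_index_bij[of c] by (auto simp: bij_betw_def)

lemma inv_state_index:
  "ks \<in> com_states c \<Longrightarrow> inv_into (com_states c) (state_index c) (state_index c ks) = ks"
  using state_index_bij[of c] by (simp add: bij_betw_def)

lemma inv_state_index_in:
  "q < card (com_states c) \<Longrightarrow> inv_into (com_states c) (state_index c) q \<in> com_states c"
  using state_index_bij[of c] by (intro inv_into_into) (simp add: bij_betw_def)

lemma wf_tm_of_com:
  assumes "com_within K N c" "3 \<le> K" "4 \<le> N"
  shows "wf_tm (tm_of_com K N c)"
proof -
  let ?S = "com_states c"
  have start: "[c] \<in> ?S"
    by (simp add: com_states_def Cons_in_conts)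
  have ok: "list_all (com_within K N) ks" if "ks \<in> ?S" for ks
    using that conts_within[OF assms(1), of "[]"] by (auto simp: com_states_def)
  have "fst ` set (cont_actions (inv_into ?S (state_index c) q) ss) \<subseteq> {..<N}"
    if "q < card ?S" "length ss = K" "set ss \<subseteq> {..<N}" for q ss
    using that by (intro cont_actions_symbols) (simp_all add: ok inv_state_index_in)
  moreover have "state_index c (next_cont (inv_into ?S (state_index c) q) ss) < card ?S"
    if "q < card ?S" for q ss
    using that by (intro state_index_less com_states_closed inv_state_index_in)
  ultimately show ?thesis
    using assms state_index_less[OF start]
    by (auto simp: wf_tm_def tm_of_com_def Let_def image_image less_SucI)
qed

definition store_tapes :: "nat \<Rightarrow> store \<Rightarrow> tape list" where
  "store_tapes K \<sigma> = map \<sigma> [0..<K]"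

lemma tape_act_read [simp]: "tape_act (tape_read u, MoveN) u = u"
  by (cases u) simp

lemma map2_stay [simp]:
  "map2 tape_act (map ((\<lambda>s. (s, MoveN)) \<circ> tape_read) us) us = us"
  by (induction us) auto

lemma map2_stay_update:
  "j < length us \<Longrightarrow>
    map2 tape_act ((map ((\<lambda>s. (s, MoveN)) \<circ> tape_read) us)[j := x]) us = us[j := tape_act x (us ! j)]"
  by (rule nth_equalityI) (auto simp: nth_list_update)

lemma store_tapes_update:
  "j < K \<Longrightarrow> store_tapes K (\<sigma>(j := u)) = (store_tapes K \<sigma>)[j := u]"
  by (rule nth_equalityI) (auto simp: store_tapes_def nth_list_update)

lemma length_store_tapes [simp]: "length (store_tapes K \<sigma>) = K"
  by (simp add: store_tapes_def)

lemma nth_store_tapes [simp]: "j < K \<Longrightarrow> store_tapes K \<sigma> ! j = \<sigma> j"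
  by (simp add: store_tapes_def)

lemma tm_step_cont:
  assumes "c' # ks \<in> com_states c"
  shows "tm_step (tm_of_com K N c) (state_index c (c' # ks), store_tapes K \<sigma>) =
    (state_index c (next_cont (c' # ks) (map tape_read (store_tapes K \<sigma>))),
     map2 tape_act (cont_actions (c' # ks) (map tape_read (store_tapes K \<sigma>))) (store_tapes K \<sigma>))"
  using state_index_less[OF assms] inv_state_index[OF assms]
  by (simp add: tm_step_def halted_def tm_of_com_def Let_def)

lemma funpow_one_add: "(f ^^ (1 + t)) s = (f ^^ t) (f s)"
  by (simp add: funpow_swap1)

lemma funpow_one_add_add: "(f ^^ (1 + t + t')) s = (f ^^ t') ((f ^^ t) (f s))"
proof -
  have "(f ^^ (t' + (t + 1))) s = (f ^^ t') ((f ^^ t) (f s))"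
    unfolding funpow_add by simp
  then show ?thesis
    by (simp only: add.commute)
qed

text \<open>The rest \<open>ks\<close> is arbitrary because a command inside \<open>Seq\<close> or
  \<open>While\<close> runs in front of further code.\<close>

lemma tm_steps_exec:
  assumes "exec c' \<sigma> t \<sigma>'" "com_within K N c'" "conts c' ks \<subseteq> com_states c"
  shows "(tm_step (tm_of_com K N c) ^^ t) (state_index c (c' # ks), store_tapes K \<sigma>) =
    (state_index c ks, store_tapes K \<sigma>')"
  using assms
proof (induction arbitrary: ks rule: exec.induct)
  case (exec_Put j s \<sigma>)
  then show ?case
    by (simp add: tm_step_cont map2_stay_update fun_upd_def flip: store_tapes_update)
next
  case (exec_Mov j d \<sigma>)
  then show ?case
    by (simp add: tm_step_cont map2_stay_update fun_upd_def flip: store_tapes_update)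
next
  case (exec_Seq c1 \<sigma> t \<sigma>' c2 t' \<sigma>'')
  have "tm_step (tm_of_com K N c) (state_index c (Seq c1 c2 # ks), store_tapes K \<sigma>) =
      (state_index c (c1 # c2 # ks), store_tapes K \<sigma>)"
    using exec_Seq.prems by (simp add: tm_step_cont)
  then show ?case
    using exec_Seq.IH(1)[of "c2 # ks"] exec_Seq.IH(2)[of ks] exec_Seq.prems
    unfolding funpow_one_add_add by simp
next
  case (exec_If \<sigma> j s c1 c2 t \<sigma>')
  have "tm_step (tm_of_com K N c) (state_index c (If j s c1 c2 # ks), store_tapes K \<sigma>) =
      (state_index c ((if tape_read (\<sigma> j) = s then c1 else c2) # ks), store_tapes K \<sigma>)"
    using exec_If.prems by (simp add: tm_step_cont)
  then show ?case
    using exec_If.IH[of ks] exec_If.prems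
    unfolding funpow_one_add by (simp split: if_splits)
next
  case (exec_While_stop \<sigma> j s c1)
  then show ?case
    by (simp add: tm_step_cont)
next
  case (exec_While_loop \<sigma> j s c1 t \<sigma>' t' \<sigma>'')
  have "tm_step (tm_of_com K N c) (state_index c (While j s c1 # ks), store_tapes K \<sigma>) =
      (state_index c (c1 # While j s c1 # ks), store_tapes K \<sigma>)"
    using exec_While_loop.prems exec_While_loop.hyps(1) by (simp add: tm_step_cont)
  then show ?case
    using exec_While_loop.IH(1)[of "While j s c1 # ks"] exec_While_loop.IH(2)[of ks] exec_While_loop.prems
    unfolding funpow_one_add_add by simp
qed

text \<open>The extra step is the one at the empty continuation, which gives the verdict.\<close>

lemma tm_of_com_run:
  assumes "exec c \<sigma> t \<sigma>'" "com_within K N c" "3 \<le> K"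
    and init: "store_tapes K \<sigma> = input_tape x # replicate (K - 1) blank_tape"
  shows "tm_run (tm_of_com K N c) x (Suc t) =
    ((if tape_read (\<sigma>' 2) = 3 then tm_accept (tm_of_com K N c) else tm_reject (tm_of_com K N c)),
     store_tapes K \<sigma>')"
proof -
  let ?M = "tm_of_com K N c"
  have "[] \<in> com_states c"
    by (simp add: com_states_def)
  note nil = state_index_less[OF this] inv_state_index[OF this]
  have "(tm_step ?M ^^ t) (initial_config ?M x) = (state_index c [], store_tapes K \<sigma>')"
    using tm_steps_exec[OF assms(1,2), of "[]" c] init
    by (simp add: initial_config_def tm_of_com_def Let_def com_states_def subset_insertI)
  moreover have "tm_step ?M (state_index c [], store_tapes K \<sigma>') =
      ((if tape_read (\<sigma>' 2) = 3 then tm_accept ?M else tm_reject ?M), store_tapes K \<sigma>')"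
    using nil \<open>3 \<le> K\<close> by (simp add: tm_step_def halted_def tm_of_com_def Let_def)
  ultimately show ?thesis
    by (simp add: tm_run_def)
qed

section \<open>Unary counters\<close>

text \<open>Only an upper bound on the time is kept from here on, so rounds of a loop with different
  costs can share one estimate.\<close>

definition runs :: "com \<Rightarrow> nat \<Rightarrow> store \<Rightarrow> store \<Rightarrow> bool" where
  "runs c T \<sigma> \<sigma>' \<longleftrightarrow> (\<exists>t\<le>T. exec c \<sigma> t \<sigma>')"

lemma runs_mono: "runs c T \<sigma> \<sigma>' \<Longrightarrow> T \<le> T' \<Longrightarrow> runs c T' \<sigma> \<sigma>'"
  unfolding runs_def using order_trans by blast

lemma runs_Put: "\<sigma>' = \<sigma>(j := tape_act (s, MoveN) (\<sigma> j)) \<Longrightarrow> runs (Put j s) 1 \<sigma> \<sigma>'"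
  unfolding runs_def using exec_Put by blast

lemma runs_Mov: "\<sigma>' = \<sigma>(j := tape_act (tape_read (\<sigma> j), d) (\<sigma> j)) \<Longrightarrow> runs (Mov j d) 1 \<sigma> \<sigma>'"
  unfolding runs_def using exec_Mov by blast

lemma runs_Seq: "runs c T \<sigma> \<sigma>' \<Longrightarrow> runs c' T' \<sigma>' \<sigma>'' \<Longrightarrow> runs (Seq c c') (1 + T + T') \<sigma> \<sigma>''"
  unfolding runs_def using exec_Seq by (metis add_le_mono le_refl)

lemma runs_If_eq: "tape_read (\<sigma> j) = s \<Longrightarrow> runs c T \<sigma> \<sigma>' \<Longrightarrow> runs (If j s c c') (1 + T) \<sigma> \<sigma>'"
  unfolding runs_def using exec_If[of \<sigma> j s c c'] by (metis add_le_mono le_refl)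

lemma runs_If_neq: "tape_read (\<sigma> j) \<noteq> s \<Longrightarrow> runs c' T \<sigma> \<sigma>' \<Longrightarrow> runs (If j s c c') (1 + T) \<sigma> \<sigma>'"
  unfolding runs_def using exec_If[of \<sigma> j s c c'] by (metis add_le_mono le_refl)

text \<open>\<open>f i\<close> is the store at the loop head after \<open>i\<close> rounds. The
  \<open>1\<close> in \<open>T + 1\<close> pays for the test of a round, the last \<open>1\<close>
  for the test that ends the loop.\<close>

lemma runs_While:
  assumes "\<And>i. i < n \<Longrightarrow> runs c T (f i) (f (Suc i))"
    and "\<And>i. i < n \<Longrightarrow> tape_read (f i j) \<noteq> s" and "tape_read (f n j) = s"
  shows "runs (While j s c) (n * (T + 1) + 1) (f 0) (f n)"
  using assms
proof (induction n arbitrary: f)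
  case 0
  then show ?case
    unfolding runs_def using exec_While_stop[of "f 0" j s c] by auto
next
  case (Suc n)
  have "runs (While j s c) (n * (T + 1) + 1) (f (Suc 0)) (f (Suc n))"
    using Suc.prems by (intro Suc.IH[of "\<lambda>i. f (Suc i)"]) auto
  then obtain t' where t': "t' \<le> n * (T + 1) + 1" "exec (While j s c) (f (Suc 0)) t' (f (Suc n))"
    unfolding runs_def by blast
  obtain t where t: "t \<le> T" "exec c (f 0) t (f (Suc 0))"
    using Suc.prems(1)[of 0] unfolding runs_def by blast
  have "exec (While j s c) (f 0) (1 + t + t') (f (Suc n))"
    using Suc.prems(2)[of 0] t(2) t'(2) by (intro exec_While_loop) auto
  moreover have "1 + t + t' \<le> Suc n * (T + 1) + 1"
    using t(1) t'(1) by simp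
  ultimately show ?case
    unfolding runs_def by blast
qed

text \<open>Tape \<open>0\<close> is \<open>I\<close>, tape \<open>1\<close> holds the output \<open>out\<close>, tape \<open>2\<close> holds the characteristic function of
  the set \<open>A\<close> and has its head on cell \<open>h\<close>. Every other tape is a unary counter: its only nonblank
  cell is the marked cell \<open>0\<close>, and the value of register \<open>r\<close> is the head position on tape \<open>r + 3\<close>.\<close>

type_synonym devices = "tape \<times> nat \<times> nat set \<times> bool list"

definition machine :: "devices \<Rightarrow> (nat \<Rightarrow> nat) \<Rightarrow> store" where
  "machine y \<rho> j = (case y of (I, h, A, out) \<Rightarrow>
     if j = 0 then I
     else if j = 1 then (fst (input_tape out), int (length out))
     else if j = 2 then (\<lambda>i. if 0 \<le> i \<and> nat i \<in> A then 3 else 0, int h)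
     else (\<lambda>i. if i = 0 then 3 else 0, int (\<rho> (j - 3))))"

abbreviation "skip \<equiv> Mov 0 MoveN"
abbreviation "inc r \<equiv> Mov (r + 3) MoveR"
abbreviation "dec r \<equiv> Mov (r + 3) MoveL"
abbreviation "loop r c \<equiv> While (r + 3) 3 c"

text \<open>Since cell \<open>0\<close> alone carries the mark, one read tests a counter for
  zero.\<close>

lemma read_register: "tape_read (machine y \<rho> (r + 3)) = 3 \<longleftrightarrow> \<rho> r = 0"
  by (simp add: machine_def split: prod.splits)

lemma runs_skip: "runs skip 1 \<sigma> \<sigma>"
  by (rule runs_Mov) simp

lemma runs_inc: "runs (inc r) 1 (machine y \<rho>) (machine y (\<rho>(r := Suc (\<rho> r))))"
  by (rule runs_Mov) (auto simp: machine_def fun_eq_iff split: prod.splits)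

lemma runs_dec: "\<rho> r \<noteq> 0 \<Longrightarrow> runs (dec r) 1 (machine y \<rho>) (machine y (\<rho>(r := \<rho> r - 1)))"
  by (rule runs_Mov) (auto simp: machine_def fun_eq_iff split: prod.splits)

lemma runs_loop:
  assumes "\<And>i. i < n \<Longrightarrow> runs c T (machine (Y i) (R i)) (machine (Y (Suc i)) (R (Suc i)))"
    and "\<And>i. i < n \<Longrightarrow> R i r \<noteq> 0" and "R n r = 0"
  shows "runs (loop r c) (n * (T + 1) + 1) (machine (Y 0) (R 0)) (machine (Y n) (R n))"
  using runs_While[of n c T "\<lambda>i. machine (Y i) (R i)" "r + 3" 3] assms
  by (simp add: read_register)

definition clear :: "nat \<Rightarrow> com" where
  "clear r = loop r (dec r)"

lemma runs_clear: "runs (clear r) (2 * \<rho> r + 1) (machine y \<rho>) (machine y (\<rho>(r := 0)))"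
proof -
  define R where "R i = \<rho>(r := \<rho> r - i)" for i
  have "runs (dec r) 1 (machine y (R i)) (machine y (R (Suc i)))" if "i < \<rho> r" for i
    using runs_dec[of "R i" r y] that by (simp add: R_def)
  from runs_loop[where Y = "\<lambda>_. y" and R = R and r = r, OF this]
  have "runs (clear r) (\<rho> r * (1 + 1) + 1) (machine y (R 0)) (machine y (R (\<rho> r)))"
    unfolding clear_def by (simp add: R_def)
  then show ?thesis
    by (auto simp: R_def elim!: runs_mono)
qed

definition transfer :: "nat \<Rightarrow> nat \<Rightarrow> com" where
  "transfer r d = loop r (Seq (dec r) (inc d))"

lemma runs_transfer:
  assumes "r \<noteq> d"
  shows "runs (transfer r d) (4 * \<rho> r + 1) (machine y \<rho>) (machine y (\<rho>(r := 0, d := \<rho> d + \<rho> r)))"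
proof -
  define R where "R i = \<rho>(r := \<rho> r - i, d := \<rho> d + i)" for i
  have "runs (Seq (dec r) (inc d)) (1 + 1 + 1) (machine y (R i)) (machine y (R (Suc i)))"
    if "i < \<rho> r" for i
  proof (rule runs_Seq)
    show "runs (dec r) 1 (machine y (R i)) (machine y ((R i)(r := R i r - 1)))"
      using that assms by (intro runs_dec) (simp add: R_def)
    have "((R i)(r := R i r - 1))(d := Suc (((R i)(r := R i r - 1)) d)) = R (Suc i)"
      using assms by (auto simp: R_def fun_eq_iff)
    then show "runs (inc d) 1 (machine y ((R i)(r := R i r - 1))) (machine y (R (Suc i)))"
      using runs_inc[of d y "(R i)(r := R i r - 1)"] by simp
  qed
  from runs_loop[where Y = "\<lambda>_. y" and R = R and r = r, OF this]
  have "runs (transfer r d) (\<rho> r * (1 + 1 + 1 + 1) + 1) (machine y (R 0)) (machine y (R (\<rho> r)))"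
    unfolding transfer_def using assms by (simp add: R_def)
  then show ?thesis
    by (auto simp: R_def elim!: runs_mono)
qed

text \<open>Reading a counter destroys it, so \<open>t\<close> takes a second copy from which
  \<open>r\<close> is restored.\<close>

definition copy :: "nat \<Rightarrow> nat \<Rightarrow> nat \<Rightarrow> com" where
  "copy r d t = Seq (loop r (Seq (dec r) (Seq (inc d) (inc t)))) (transfer t r)"

lemma runs_copy:
  assumes "r \<noteq> d" "r \<noteq> t" "d \<noteq> t" "\<rho> t = 0"
  shows "runs (copy r d t) (10 * \<rho> r + 3) (machine y \<rho>) (machine y (\<rho>(d := \<rho> d + \<rho> r)))"
proof -
  define R where "R i = \<rho>(r := \<rho> r - i, d := \<rho> d + i, t := i)" for i
  have step: "runs (Seq (dec r) (Seq (inc d) (inc t))) (1 + 1 + (1 + 1 + 1)) (machine y (R i)) (machine y (R (Suc i)))"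
    if "i < \<rho> r" for i
  proof (intro runs_Seq)
    show "runs (dec r) 1 (machine y (R i)) (machine y ((R i)(r := R i r - 1)))"
      using that assms by (intro runs_dec) (simp add: R_def)
    show "runs (inc d) 1 (machine y ((R i)(r := R i r - 1)))
       (machine y ((R i)(r := R i r - 1, d := Suc (((R i)(r := R i r - 1)) d))))"
      by (rule runs_inc)
    have "((R i)(r := R i r - 1, d := Suc (((R i)(r := R i r - 1)) d)))(t := 
       Suc (((R i)(r := R i r - 1, d := Suc (((R i)(r := R i r - 1)) d))) t)) = R (Suc i)"
      using assms by (auto simp: R_def fun_eq_iff)
    then show "runs (inc t) 1 (machine y ((R i)(r := R i r - 1, d := Suc (((R i)(r := R i r - 1)) d))))
       (machine y (R (Suc i)))"
      by (metis runs_inc)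
  qed
  from runs_loop[where Y = "\<lambda>_. y" and R = R and r = r and n = "\<rho> r", OF step]
  have "runs (loop r (Seq (dec r) (Seq (inc d) (inc t)))) (\<rho> r * (5 + 1) + 1)
      (machine y (R 0)) (machine y (R (\<rho> r)))"
    using assms by (auto simp: R_def elim!: runs_mono)
  moreover have "R 0 = \<rho>"
    using assms by (auto simp: R_def)
  moreover have "(R (\<rho> r))(t := 0, r := R (\<rho> r) r + R (\<rho> r) t) = \<rho>(d := \<rho> d + \<rho> r)"
    using assms by (auto simp: R_def fun_eq_iff)
  then have "runs (transfer t r) (4 * R (\<rho> r) t + 1) (machine y (R (\<rho> r))) (machine y (\<rho>(d := \<rho> d + \<rho> r)))"
    using runs_transfer[of t r "R (\<rho> r)" y] assms by simp
  moreover have "R (\<rho> r) t = \<rho> r"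
    by (simp add: R_def)
  ultimately have "runs (copy r d t) (1 + (\<rho> r * (5 + 1) + 1) + (4 * \<rho> r + 1)) (machine y \<rho>) (machine y (\<rho>(d := \<rho> d + \<rho> r)))"
    unfolding copy_def by (intro runs_Seq) simp_all
  then show ?thesis
    by (rule runs_mono) simp
qed

section \<open>Functions computable in time polynomial in the values of their arguments\<close>

text \<open>For a base of at least \<open>2\<close> a single power absorbs constants and sums:
  \<open>c\<close> is at most \<open>B ^ c\<close>, and \<open>2 * B ^ d\<close> is at most
  \<open>B ^ (d + 1)\<close>. The summand \<open>2\<close> in \<open>magnitude\<close> provides such
  a base.\<close>

definition poly_bounded :: "(nat \<Rightarrow> nat) \<Rightarrow> bool" where
  "poly_bounded T \<longleftrightarrow> (\<exists>e. \<forall>B\<ge>2. T B \<le> B ^ e)"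

lemma poly_bounded_id [intro!]: "poly_bounded (\<lambda>B. B)"
  unfolding poly_bounded_def by (rule exI[of _ 1]) simp

lemma poly_bounded_const [intro!]: "poly_bounded (\<lambda>B. c)"
proof -
  have "c \<le> B ^ c" if "2 \<le> B" for B :: nat
    using power_mono[OF that, of c] less_exp[of c] by linarith
  then show ?thesis
    unfolding poly_bounded_def by blast
qed

lemma poly_bounded_mult [intro!]:
  assumes "poly_bounded S" "poly_bounded T"
  shows "poly_bounded (\<lambda>B. S B * T B)"
proof -
  from assms obtain d e where "\<forall>B\<ge>2. S B \<le> B ^ d" "\<forall>B\<ge>2. T B \<le> B ^ e"
    unfolding poly_bounded_def by blast
  then have "\<forall>B\<ge>2. S B * T B \<le> B ^ (d + e)"
    by (simp add: power_add mult_mono)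
  then show ?thesis
    unfolding poly_bounded_def by blast
qed

lemma poly_bounded_add [intro!]:
  assumes "poly_bounded S" "poly_bounded T"
  shows "poly_bounded (\<lambda>B. S B + T B)"
proof -
  from assms obtain d e where de: "\<forall>B\<ge>2. S B \<le> B ^ d" "\<forall>B\<ge>2. T B \<le> B ^ e"
    unfolding poly_bounded_def by blast
  have "S B + T B \<le> B ^ Suc (d + e)" if "2 \<le> B" for B
  proof -
    have "S B \<le> B ^ (d + e)" "T B \<le> B ^ (d + e)"
      using de that power_increasing[of d "d + e" B] power_increasing[of e "d + e" B]
      by (auto intro: order_trans)
    then have "S B + T B \<le> 2 * B ^ (d + e)"
      by simp
    also have "\<dots> \<le> B * B ^ (d + e)"
      using that by (intro mult_right_mono) auto
    finally show ?thesis
      by simp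
  qed
  then show ?thesis
    unfolding poly_bounded_def by blast
qed

lemma poly_bounded_power [intro!]: "poly_bounded T \<Longrightarrow> poly_bounded (\<lambda>B. T B ^ n)"
  by (induction n) auto

lemmas poly_bounded_intros =
  poly_bounded_add poly_bounded_mult poly_bounded_power poly_bounded_const poly_bounded_id

text \<open>Environments are lists, and \<open>vs\<close> lists the values of the environment that are kept in
  registers. A variable that is bound by a quantifier is pushed to the front of the environment.\<close>

type_synonym valuation = "nat list \<Rightarrow> nat"

definition magnitude :: "valuation list \<Rightarrow> nat list \<Rightarrow> nat" where
  "magnitude vs s = 2 + (\<Sum>v\<leftarrow>vs. v s)"

lemma magnitude_ge: "2 \<le> magnitude vs s"
  by (simp add: magnitude_def)

text \<open>The values \<open>vs\<close> sit in the registers \<open>ls\<close>, the result goes to register \<open>d\<close>, and all registers from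
  \<open>d\<close> on are zero before the computation and serve as scratch space.\<close>

definition computes :: "valuation list \<Rightarrow> valuation \<Rightarrow> nat list \<Rightarrow> nat \<Rightarrow> com \<Rightarrow> (nat \<Rightarrow> nat) \<Rightarrow> bool" where
  "computes vs f ls d c T \<longleftrightarrow> (\<forall>s \<rho> y. map \<rho> ls = map (\<lambda>v. v s) vs \<longrightarrow> (\<forall>i\<ge>d. \<rho> i = 0) \<longrightarrow>
     f s \<le> T (magnitude vs s) \<and>
     runs c (T (magnitude vs s)) (machine y \<rho>) (machine y (\<rho>(d := f s))))"

lemma computes_le:
  "computes vs f ls d c T \<Longrightarrow> map \<rho> ls = map (\<lambda>v. v s) vs \<Longrightarrow> \<forall>i\<ge>d. \<rho> i = 0 \<Longrightarrow>
    f s \<le> T (magnitude vs s)"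
  unfolding computes_def by blast

lemma computes_runs:
  "computes vs f ls d c T \<Longrightarrow> map \<rho> ls = map (\<lambda>v. v s) vs \<Longrightarrow> \<forall>i\<ge>d. \<rho> i = 0 \<Longrightarrow>
    runs c (T (magnitude vs s)) (machine y \<rho>) (machine y (\<rho>(d := f s)))"
  unfolding computes_def by blast

text \<open>The register layout is quantified before the program, so a function can be compiled
  again wherever a larger program has free registers; program and time bound are uniform in the
  environment.\<close>

definition poly_fun :: "valuation list \<Rightarrow> valuation \<Rightarrow> bool" where
  "poly_fun vs f \<longleftrightarrow>
     (\<forall>ls d. (\<forall>l\<in>set ls. l < d) \<longrightarrow> (\<exists>c T. poly_bounded T \<and> computes vs f ls d c T))"

lemma poly_funI:
  assumes "\<And>ls d. \<forall>l\<in>set ls. l < d \<Longrightarrow> \<exists>c T. poly_bounded T \<and> computes vs f ls d c T"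
  shows "poly_fun vs f"
  using assms unfolding poly_fun_def by blast

lemma poly_funE:
  assumes "poly_fun vs f" "\<forall>l\<in>set ls. l < d"
  obtains c e where "computes vs f ls d c (\<lambda>B. B ^ e)"
proof -
  obtain c T where T: "poly_bounded T" "computes vs f ls d c T"
    using assms unfolding poly_fun_def by blast
  then obtain e where "\<forall>B\<ge>2. T B \<le> B ^ e"
    unfolding poly_bounded_def by blast
  then have "T (magnitude vs s) \<le> magnitude vs s ^ e" for s
    by (simp add: magnitude_ge)
  then have "computes vs f ls d c (\<lambda>B. B ^ e)"
    using T(2) runs_mono order_trans unfolding computes_def by blast
  then show thesis
    by (rule that)
qed

text \<open>Growth alone, without computability: this is all that \<open>poly_rec\<close> asks of
  the bound on its intermediate values.\<close>

definition poly_valued :: "valuation list \<Rightarrow> valuation \<Rightarrow> bool" where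
  "poly_valued vs f \<longleftrightarrow> (\<exists>T. poly_bounded T \<and> (\<forall>s. f s \<le> T (magnitude vs s)))"

lemma poly_fun_valued:
  assumes "poly_fun vs f"
  shows "poly_valued vs f"
proof -
  let ?ls = "[0..<length vs]"
  have "\<forall>l\<in>set ?ls. l < length vs"
    by simp
  with assms obtain c e where c: "computes vs f ?ls (length vs) c (\<lambda>B. B ^ e)"
    by (rule poly_funE)
  \<comment> \<open>\<open>computes\<close> bounds \<open>f s\<close> only relative to a store that
    holds the environment; any such store will do.\<close>
  have "f s \<le> magnitude vs s ^ e" for s
    by (rule computes_le[OF c, of "\<lambda>i. if i < length vs then (vs ! i) s else 0"]) (auto intro!: nth_equalityI)
  moreover have "poly_bounded (\<lambda>B. B ^ e)"
    by (intro poly_bounded_power poly_bounded_id)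
  ultimately show ?thesis
    unfolding poly_valued_def by blast
qed

lemma poly_valued_add: "poly_valued vs f \<Longrightarrow> poly_valued vs g \<Longrightarrow> poly_valued vs (\<lambda>s. f s + g s)"
proof -
  assume "poly_valued vs f" "poly_valued vs g"
  then obtain S T where "poly_bounded S" "poly_bounded T"
    and "\<And>s. f s \<le> S (magnitude vs s)" "\<And>s. g s \<le> T (magnitude vs s)"
    unfolding poly_valued_def by blast
  then show ?thesis
    unfolding poly_valued_def
    by (intro exI[of _ "\<lambda>B. S B + T B"] conjI poly_bounded_add allI add_mono)
qed

lemma poly_valued_mult: "poly_valued vs f \<Longrightarrow> poly_valued vs g \<Longrightarrow> poly_valued vs (\<lambda>s. f s * g s)"
proof -
  assume "poly_valued vs f" "poly_valued vs g"
  then obtain S T where "poly_bounded S" "poly_bounded T"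
    and "\<And>s. f s \<le> S (magnitude vs s)" "\<And>s. g s \<le> T (magnitude vs s)"
    unfolding poly_valued_def by blast
  then show ?thesis
    unfolding poly_valued_def
    by (intro exI[of _ "\<lambda>B. S B * T B"] conjI poly_bounded_mult allI mult_le_mono)
qed

lemma map_upd_out [simp]: "\<forall>l\<in>set ls. l < (d :: nat) \<Longrightarrow> d \<le> i \<Longrightarrow> map (\<rho>(i := x)) ls = map \<rho> ls"
  by (meson leD map_fun_upd)

lemma poly_var:
  assumes "f \<in> set vs"
  shows "poly_fun vs f"
proof (rule poly_funI)
  fix ls d
  assume ls: "\<forall>l\<in>set ls. l < (d :: nat)"
  obtain k where k: "k < length vs" "vs ! k = f"
    using assms by (auto simp: in_set_conv_nth)
  show "\<exists>c T. poly_bounded T \<and> computes vs f ls d c T"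
    unfolding computes_def
  proof (intro exI conjI allI impI)
    show "poly_bounded (\<lambda>B. 10 * B + 3)"
      by auto
    fix s \<rho> y
    assume map: "map \<rho> ls = map (\<lambda>v. v s) vs" and z: "\<forall>i\<ge>d. \<rho> i = (0 :: nat)"
    have len: "length ls = length vs"
      using map by (metis length_map)
    then have lk: "ls ! k < d" and \<rho>k: "\<rho> (ls ! k) = f s"
      using ls k arg_cong[OF map, of "\<lambda>u. u ! k"] by auto
    have "f s \<in> set (map (\<lambda>v. v s) vs)"
      using assms by auto
    then have le: "f s \<le> magnitude vs s"
      using member_le_sum_list[of "f s" "map (\<lambda>v. v s) vs"] by (simp add: magnitude_def)
    then show "f s \<le> 10 * magnitude vs s + 3"
      by simp
    have "runs (copy (ls ! k) d (d + 1)) (10 * \<rho> (ls ! k) + 3) (machine y \<rho>)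
        (machine y (\<rho>(d := \<rho> d + \<rho> (ls ! k))))"
      using lk z by (intro runs_copy) auto
    then show "runs (copy (ls ! k) d (d + 1)) (10 * magnitude vs s + 3) (machine y \<rho>) (machine y (\<rho>(d := f s)))"
      using z le by (auto simp: \<rho>k elim: runs_mono)
  qed
qed

definition under :: "valuation list \<Rightarrow> valuation list" where
  "under vs = hd # map (\<lambda>v p. v (tl p)) vs"

lemma magnitude_under [simp]: "magnitude (under vs) (i # s) = magnitude vs s + i"
  by (simp add: under_def magnitude_def comp_def)

lemma map_under [simp]: "map (\<lambda>v. v (i # s)) (under vs) = i # map (\<lambda>v. v s) vs"
  by (simp add: under_def)

lemma poly_bound_var: "poly_fun (under vs) hd"
  by (rule poly_var) (simp add: under_def)

text \<open>The program for \<open>vs\<close> is compiled for the layout without its first register,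
  the one of the bound variable.\<close>

lemma poly_weaken:
  assumes "poly_fun vs f"
  shows "poly_fun (under vs) (\<lambda>p. f (tl p))"
proof (rule poly_funI)
  fix ls d
  assume ls: "\<forall>l\<in>set ls. l < (d :: nat)"
  then have "\<forall>l\<in>set (tl ls). l < d"
    by (metis list.sel(2) list.set_sel(2))
  with assms obtain c e where c: "computes vs f (tl ls) d c (\<lambda>B. B ^ e)"
    by (rule poly_funE)
  show "\<exists>c T. poly_bounded T \<and> computes (under vs) (\<lambda>s. f (tl s)) ls d c T"
    unfolding computes_def
  proof (intro exI conjI allI impI)
    show "poly_bounded (\<lambda>B. B ^ e)"
      by auto
    fix s \<rho> y
    assume map: "map \<rho> ls = map (\<lambda>v. v s) (under vs)" and z: "\<forall>i\<ge>d. \<rho> i = (0 :: nat)"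
    have map': "map \<rho> (tl ls) = map (\<lambda>v. v (tl s)) vs"
      using arg_cong[OF map, of tl] by (simp add: under_def map_tl comp_def)
    have "magnitude vs (tl s) \<le> magnitude (under vs) s"
      by (simp add: under_def magnitude_def comp_def)
    then have le: "magnitude vs (tl s) ^ e \<le> magnitude (under vs) s ^ e"
      by (rule power_mono) simp
    show "f (tl s) \<le> magnitude (under vs) s ^ e"
      using computes_le[OF c map' z] le by linarith
    show "runs c (magnitude (under vs) s ^ e) (machine y \<rho>) (machine y (\<rho>(d := f (tl s))))"
      using computes_runs[OF c map' z] le by (rule runs_mono)
  qed
qed

lemma poly_zero: "poly_fun vs (\<lambda>s. 0)"
proof (rule poly_funI)
  fix ls and d :: nat
  have "poly_bounded (\<lambda>B. 1)"
    by auto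
  moreover have "runs skip 1 (machine y \<rho>) (machine y (\<rho>(d := 0)))" if "\<forall>i\<ge>d. \<rho> i = 0" for y \<rho>
    using runs_skip that by (metis fun_upd_triv le_refl)
  ultimately show "\<exists>c T. poly_bounded T \<and> computes vs (\<lambda>s. 0) ls d c T"
    unfolding computes_def by (intro exI[of _ skip] exI[of _ "\<lambda>_. 1"]) simp
qed

lemma poly_Suc:
  assumes "poly_fun vs f"
  shows "poly_fun vs (\<lambda>s. Suc (f s))"
proof (rule poly_funI)
  fix ls d
  assume ls: "\<forall>l\<in>set ls. l < (d :: nat)"
  with assms obtain c e where c: "computes vs f ls d c (\<lambda>B. B ^ e)"
    by (rule poly_funE)
  show "\<exists>c T. poly_bounded T \<and> computes vs (\<lambda>s. Suc (f s)) ls d c T"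
    unfolding computes_def
  proof (intro exI conjI allI impI)
    show "poly_bounded (\<lambda>B. 1 + B ^ e + 1)"
      by (intro poly_bounded_intros)
    fix s \<rho> y
    assume map: "map \<rho> ls = map (\<lambda>v. v s) vs" and z: "\<forall>i\<ge>d. \<rho> i = (0 :: nat)"
    show "Suc (f s) \<le> 1 + magnitude vs s ^ e + 1"
      using computes_le[OF c map z] by linarith
    show "runs (Seq c (inc d)) (1 + magnitude vs s ^ e + 1) (machine y \<rho>) (machine y (\<rho>(d := Suc (f s))))"
      using runs_Seq[OF computes_runs[OF c map z] runs_inc[of d y "\<rho>(d := f s)"]] by simp
  qed
qed

text \<open>Iterating a polynomial function can square its value in every round, so a polynomial
  bound on all intermediate values has to be supplied. Register \<open>d\<close> counts the rounds
  left, \<open>d + 1\<close> the rounds done, \<open>d + 2\<close> is the accumulator, and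
  \<open>d + 3\<close> receives its new value.\<close>

lemma poly_rec:
  fixes g n :: valuation and h :: "nat list \<Rightarrow> nat \<Rightarrow> nat \<Rightarrow> nat"
  assumes n: "poly_fun vs n" and g: "poly_fun vs g"
    and h: "poly_fun (under (under vs)) (\<lambda>p. h (tl (tl p)) (hd (tl p)) (hd p))"
    and b: "poly_valued vs b" "\<And>s i. i \<le> n s \<Longrightarrow> rec_nat (g s) (h s) i \<le> b s"
  shows "poly_fun vs (\<lambda>s. rec_nat (g s) (h s) (n s))"
proof (rule poly_funI)
  fix ls d
  assume ls: "\<forall>l\<in>set ls. l < (d :: nat)"
  then have ls2: "\<forall>l\<in>set ls. l < d + 2" and ls3: "\<forall>l\<in>set ((d + 2) # (d + 1) # ls). l < d + 3"
    by auto
  obtain cn en where cn: "computes vs n ls d cn (\<lambda>B. B ^ en)"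
    using n ls by (rule poly_funE)
  obtain cg eg where cg: "computes vs g ls (d + 2) cg (\<lambda>B. B ^ eg)"
    using g ls2 by (rule poly_funE)
  obtain ch eh where ch: "computes (under (under vs)) (\<lambda>p. h (tl (tl p)) (hd (tl p)) (hd p))
      ((d + 2) # (d + 1) # ls) (d + 3) ch (\<lambda>B. B ^ eh)"
    using h ls3 by (rule poly_funE)
  obtain Tb where Tb: "poly_bounded Tb" "\<And>s. b s \<le> Tb (magnitude vs s)"
    using b(1) unfolding poly_valued_def by blast
  define body where "body = Seq (dec d) (Seq ch (Seq (clear (d + 2)) (Seq (transfer (d + 3) (d + 2)) (inc (d + 1)))))"
  define prog where "prog = Seq cn (Seq cg (Seq (loop d body) (Seq (clear (d + 1)) (transfer (d + 2) d))))"
  \<comment> \<open>The step function sees two more variables: the round number, at most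
    \<open>B ^ en\<close>, and the accumulator, at most \<open>Tb B\<close>.\<close>
  define C where "C B = (B + B ^ en + Tb B) ^ eh" for B
  define Ti where "Ti B = 1 + 1 + (1 + C B + (1 + (2 * Tb B + 1) + (1 + (4 * Tb B + 1) + 1)))" for B
  define T where "T B = 1 + B ^ en + (1 + B ^ eg + (1 + (B ^ en * (Ti B + 1) + 1) + (1 + (2 * B ^ en + 1) + (4 * Tb B + 1))))" for B
  have "poly_bounded C"
    unfolding C_def using Tb(1) by auto
  then have "poly_bounded Ti"
    unfolding Ti_def using Tb(1) by (intro poly_bounded_intros)
  then have T: "poly_bounded T"
    unfolding T_def using Tb(1) by (intro poly_bounded_intros)
  have "rec_nat (g s) (h s) (n s) \<le> T (magnitude vs s) \<and>
      runs prog (T (magnitude vs s)) (machine y \<rho>) (machine y (\<rho>(d := rec_nat (g s) (h s) (n s))))"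
    if map: "map \<rho> ls = map (\<lambda>v. v s) vs" and z: "\<forall>i\<ge>d. \<rho> i = 0" for s \<rho> y
  proof
    define B where "B = magnitude vs s"
    define A where "A i = rec_nat (g s) (h s) i" for i
    have nB: "n s \<le> B ^ en"
      unfolding B_def using computes_le[OF cn map z] .
    have AB: "A i \<le> Tb B" if "i \<le> n s" for i
      using b(2)[OF that] Tb(2)[of s] unfolding A_def B_def by linarith
    show "rec_nat (g s) (h s) (n s) \<le> T (magnitude vs s)"
      using AB[of "n s"] by (simp add: A_def B_def T_def)
    have z0: "\<rho> d = 0" "\<rho> (d + 1) = 0" "\<rho> (d + 2) = 0" "\<rho> (d + 3) = 0"
      using z by auto
    define R where "R i = \<rho>(d := n s - i, d + 1 := i, d + 2 := A i)" for i
    have "runs body (Ti B) (machine y (R i)) (machine y (R (Suc i)))" if i: "i < n s" for i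
    proof -
      define R1 where "R1 = (R i)(d := n s - Suc i)"
      define R2 where "R2 = R1(d + 3 := A (Suc i))"
      define R3 where "R3 = R2(d + 2 := 0)"
      define R4 where "R4 = R3(d + 3 := 0, d + 2 := A (Suc i))"
      have "runs (dec d) 1 (machine y (R i)) (machine y R1)"
        using runs_dec[of "R i" d y] i by (simp add: R1_def R_def)
      moreover have "runs ch (C B) (machine y R1) (machine y R2)"
      proof -
        have "map R1 ((d + 2) # (d + 1) # ls) = map (\<lambda>v. v (A i # i # s)) (under (under vs))"
          using ls map by (simp add: R1_def R_def)
        moreover have "\<forall>j\<ge>d + 3. R1 j = 0"
          using z by (simp add: R1_def R_def)
        ultimately have "runs ch (magnitude (under (under vs)) (A i # i # s) ^ eh) (machine y R1) (machine y R2)"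
          using computes_runs[OF ch, of R1 "A i # i # s" y] by (simp add: R2_def A_def)
        moreover have "magnitude (under (under vs)) (A i # i # s) ^ eh \<le> C B"
          unfolding C_def using AB[of i] i nB by (intro power_mono) (auto simp: B_def[symmetric])
        ultimately show ?thesis
          by (rule runs_mono)
      qed
      moreover have "runs (clear (d + 2)) (2 * Tb B + 1) (machine y R2) (machine y R3)"
      proof -
        have "R2 (d + 2) \<le> Tb B"
          using AB[of i] i by (simp add: R2_def R1_def R_def)
        then show ?thesis
          unfolding R3_def by (intro runs_mono[OF runs_clear]) simp
      qed
      moreover have "runs (transfer (d + 3) (d + 2)) (4 * Tb B + 1) (machine y R3) (machine y R4)"
      proof -
        have "R3 (d + 3) = A (Suc i)" "R3 (d + 2) = 0"
          by (auto simp: R3_def R2_def)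
        then show ?thesis
          using runs_transfer[of "d + 3" "d + 2" R3 y] AB[of "Suc i"] i
          by (auto simp: R4_def elim!: runs_mono)
      qed
      moreover have "runs (inc (d + 1)) 1 (machine y R4) (machine y (R (Suc i)))"
      proof -
        have "R4(d + 1 := Suc (R4 (d + 1))) = R (Suc i)"
          using z0 by (auto simp: R4_def R3_def R2_def R1_def R_def fun_eq_iff)
        then show ?thesis
          using runs_inc[of "d + 1" y R4] by (simp only:)
      qed
      ultimately show ?thesis
        unfolding body_def Ti_def by (intro runs_Seq)
    qed
    then have loop: "runs (loop d body) (n s * (Ti B + 1) + 1) (machine y (R 0)) (machine y (R (n s)))"
      by (rule runs_loop[where Y = "\<lambda>_. y" and R = R]) (simp_all add: R_def)
    have "runs cn (B ^ en) (machine y \<rho>) (machine y (\<rho>(d := n s)))"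
      unfolding B_def by (rule computes_runs[OF cn map z])
    moreover have "runs cg (B ^ eg) (machine y (\<rho>(d := n s))) (machine y (R 0))"
    proof -
      have "(\<rho>(d := n s))(d + 2 := g s) = R 0"
        using z0 by (auto simp: R_def A_def)
      moreover have "map (\<rho>(d := n s)) ls = map (\<lambda>v. v s) vs"
        using ls map by simp
      ultimately show ?thesis
        using computes_runs[OF cg, of "\<rho>(d := n s)" s y] z unfolding B_def by simp
    qed
    moreover have "runs (loop d body) (B ^ en * (Ti B + 1) + 1) (machine y (R 0)) (machine y (R (n s)))"
      using loop nB by (elim runs_mono) (intro add_mono mult_le_mono, auto)
    moreover have "runs (clear (d + 1)) (2 * B ^ en + 1) (machine y (R (n s))) (machine y ((R (n s))(d + 1 := 0)))"
      using nB by (intro runs_mono[OF runs_clear]) (simp add: R_def)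
    moreover have "runs (transfer (d + 2) d) (4 * Tb B + 1) (machine y ((R (n s))(d + 1 := 0)))
        (machine y (\<rho>(d := A (n s))))"
    proof -
      let ?R = "(R (n s))(d + 1 := 0)"
      have "?R(d + 2 := 0, d := ?R d + ?R (d + 2)) = \<rho>(d := A (n s))"
        using z0 by (auto simp: R_def fun_eq_iff)
      moreover have "?R (d + 2) \<le> Tb B"
        using AB[of "n s"] by (simp add: R_def)
      ultimately show ?thesis
        using runs_transfer[of "d + 2" d ?R y] by (auto elim!: runs_mono)
    qed
    ultimately show "runs prog (T (magnitude vs s)) (machine y \<rho>) (machine y (\<rho>(d := rec_nat (g s) (h s) (n s))))"
      unfolding prog_def T_def B_def[symmetric] A_def[symmetric] by (intro runs_Seq)
  qed
  then have "computes vs (\<lambda>s. rec_nat (g s) (h s) (n s)) ls d prog T"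
    unfolding computes_def by blast
  then show "\<exists>c T. poly_bounded T \<and> computes vs (\<lambda>s. rec_nat (g s) (h s) (n s)) ls d c T"
    using T by blast
qed

section \<open>Closure under arithmetic, logic and bounded search\<close>

lemma poly_cong: "poly_fun vs f \<Longrightarrow> (\<And>s. f s = g s) \<Longrightarrow> poly_fun vs g"
  using ext[of f g] by simp

lemma poly_const: "poly_fun vs (\<lambda>s. c)"
  by (induction c) (auto intro: poly_zero poly_Suc)

lemma poly_add:
  assumes "poly_fun vs f" "poly_fun vs g"
  shows "poly_fun vs (\<lambda>s. f s + g s)"
proof -
  have eq: "rec_nat x (\<lambda>_. Suc) y = x + y" for x y :: nat
    by (induction y) auto
  have "poly_fun vs (\<lambda>s. rec_nat (f s) ((\<lambda>s i acc. Suc acc) s) (g s))"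
    by (rule poly_rec[OF assms(2,1) poly_Suc[OF poly_bound_var]
          poly_valued_add[OF poly_fun_valued[OF assms(1)] poly_fun_valued[OF assms(2)]]])
      (simp add: eq)
  then show ?thesis
    by (simp add: eq)
qed

text \<open>The step function forgets the accumulator and returns the number of the round; the last
  of \<open>x\<close> rounds has number \<open>x - 1\<close>.\<close>

lemma poly_decr:
  assumes "poly_fun vs f"
  shows "poly_fun vs (\<lambda>s. f s - 1)"
proof -
  have eq: "rec_nat 0 (\<lambda>i _. i) x = x - 1" for x :: nat
    by (cases x) auto
  have "poly_fun vs (\<lambda>s. rec_nat 0 ((\<lambda>s i acc. i) s) (f s))"
    by (rule poly_rec[where b = f])
      (auto intro!: assms poly_zero poly_weaken poly_bound_var poly_fun_valued simp: eq)
  then show ?thesis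
    by (simp add: eq)
qed

lemma poly_diff:
  assumes "poly_fun vs f" "poly_fun vs g"
  shows "poly_fun vs (\<lambda>s. f s - g s)"
proof -
  have eq: "rec_nat x (\<lambda>_ acc. acc - 1) y = x - y" for x y :: nat
    by (induction y) auto
  have "poly_fun vs (\<lambda>s. rec_nat (f s) ((\<lambda>s i acc. acc - 1) s) (g s))"
    by (rule poly_rec[where b = f])
      (auto intro!: assms poly_decr[unfolded One_nat_def] poly_bound_var poly_fun_valued simp: eq[simplified])
  then show ?thesis
    by (simp add: eq[simplified])
qed

lemma poly_mult:
  assumes "poly_fun vs f" "poly_fun vs g"
  shows "poly_fun vs (\<lambda>s. f s * g s)"
proof -
  have eq: "rec_nat 0 (\<lambda>_ acc. acc + y) x = x * y" for x y :: nat
    by (induction x) auto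
  have "poly_fun vs (\<lambda>s. rec_nat 0 ((\<lambda>s i acc. acc + g s) s) (f s))"
    by (rule poly_rec[OF assms(1) poly_zero
          poly_add[OF poly_bound_var poly_weaken[OF poly_weaken[OF assms(2)]]]
          poly_valued_mult[OF poly_fun_valued[OF assms(1)] poly_fun_valued[OF assms(2)]]])
      (simp add: eq mult_right_mono)
  then show ?thesis
    by (simp add: eq)
qed

abbreviation poly_pred :: "valuation list \<Rightarrow> (nat list \<Rightarrow> bool) \<Rightarrow> bool" where
  "poly_pred vs P \<equiv> poly_fun vs (\<lambda>s. of_bool (P s))"

lemma poly_not:
  assumes "poly_pred vs P"
  shows "poly_pred vs (\<lambda>s. \<not> P s)"
proof -
  have "poly_fun vs (\<lambda>s. 1 - of_bool (P s))"
    by (intro poly_diff poly_const assms)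
  then show ?thesis
    by (rule poly_cong) auto
qed

lemma poly_conj: "poly_pred vs P \<Longrightarrow> poly_pred vs Q \<Longrightarrow> poly_pred vs (\<lambda>s. P s \<and> Q s)"
  using poly_mult[of vs "\<lambda>s. of_bool (P s)" "\<lambda>s. of_bool (Q s)"] by (simp add: of_bool_conj)

lemma poly_disj:
  assumes "poly_pred vs P" "poly_pred vs Q"
  shows "poly_pred vs (\<lambda>s. P s \<or> Q s)"
  using poly_not[OF poly_conj[OF poly_not[OF assms(1)] poly_not[OF assms(2)]]] by simp

lemma poly_imp:
  assumes "poly_pred vs P" "poly_pred vs Q"
  shows "poly_pred vs (\<lambda>s. P s \<longrightarrow> Q s)"
  by (rule poly_cong[OF poly_disj[OF poly_not[OF assms(1)] assms(2)]]) auto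

lemma poly_iff:
  assumes "poly_pred vs P" "poly_pred vs Q"
  shows "poly_pred vs (\<lambda>s. P s \<longleftrightarrow> Q s)"
  by (rule poly_cong[OF poly_conj[OF poly_imp[OF assms] poly_imp[OF assms(2,1)]]]) auto

lemma poly_le:
  assumes "poly_fun vs f" "poly_fun vs g"
  shows "poly_pred vs (\<lambda>s. f s \<le> g s)"
proof -
  have "poly_fun vs (\<lambda>s. 1 - (f s - g s))"
    by (intro poly_diff poly_const assms)
  moreover have "of_bool (x \<le> y) = 1 - (x - y)" for x y :: nat
    by (auto simp: of_bool_def)
  ultimately show ?thesis
    by simp
qed

lemma poly_less: "poly_fun vs f \<Longrightarrow> poly_fun vs g \<Longrightarrow> poly_pred vs (\<lambda>s. f s < g s)"
  using poly_le[OF poly_Suc[of vs f], of g] by (simp add: Suc_le_eq)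

lemma poly_eq:
  assumes "poly_fun vs f" "poly_fun vs g"
  shows "poly_pred vs (\<lambda>s. f s = g s)"
  by (rule poly_cong[OF poly_conj[OF poly_le[OF assms] poly_le[OF assms(2,1)]]]) auto

lemma poly_if:
  assumes "poly_pred vs P" "poly_fun vs f" "poly_fun vs g"
  shows "poly_fun vs (\<lambda>s. if P s then f s else g s)"
proof -
  have "poly_fun vs (\<lambda>s. of_bool (P s) * f s + of_bool (\<not> P s) * g s)"
    by (intro poly_add poly_mult poly_not assms)
  then show ?thesis
    by (rule poly_cong) auto
qed

text \<open>The accumulator advances as long as no witness was met: after \<open>i\<close> rounds it
  equals \<open>i\<close> exactly if \<open>P\<close> fails below \<open>i\<close>. The value
  \<open>n\<close> signals that there is no witness.\<close>

definition bleast :: "nat \<Rightarrow> (nat \<Rightarrow> bool) \<Rightarrow> nat" where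
  "bleast n P = rec_nat 0 (\<lambda>i acc. if acc = i \<and> \<not> P i then Suc acc else acc) n"

lemma bleast_le: "bleast n P \<le> n"
  by (induction n) (auto simp: bleast_def)

lemma bleast_min: "j < bleast n P \<Longrightarrow> \<not> P j"
  by (induction n) (auto simp: bleast_def less_Suc_eq split: if_splits)

lemma bleast_holds: "bleast n P < n \<Longrightarrow> P (bleast n P)"
proof (induction n)
  case (Suc n)
  then show ?case
    using bleast_le[of n P] by (auto simp: bleast_def less_Suc_eq split: if_splits)
qed simp

lemma bleast_eqI:
  assumes "m < n" "P m" "\<And>j. j < m \<Longrightarrow> \<not> P j"
  shows "bleast n P = m"
proof -
  have "\<not> m < bleast n P"
    using bleast_min assms(2) by blast
  then show ?thesis
    using bleast_holds[of n P] assms(1,3) by (meson linorder_neqE_nat order_less_trans)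
qed

lemma poly_bleast:
  assumes n: "poly_fun vs n" and P: "poly_pred (under vs) (\<lambda>p. P (tl p) (hd p))"
  shows "poly_fun vs (\<lambda>s. bleast (n s) (P s))"
proof -
  let ?h = "\<lambda>s i acc. if acc = i \<and> \<not> P s i then Suc acc else acc"
  have "poly_fun (under (under vs)) (\<lambda>p. ?h (tl (tl p)) (hd (tl p)) (hd p))"
    using poly_weaken[OF P]
    by (intro poly_if poly_conj poly_eq poly_not poly_Suc poly_bound_var poly_weaken[OF poly_bound_var])
  then have "poly_fun vs (\<lambda>s. rec_nat 0 (?h s) (n s))"
    using bleast_le[unfolded bleast_def]
    by (intro poly_rec[OF n poly_zero _ poly_fun_valued[OF n]]) (auto intro: order_trans)
  then show ?thesis
    by (simp add: bleast_def)
qed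

lemma poly_ex:
  assumes "poly_fun vs n" "poly_pred (under vs) (\<lambda>p. P (tl p) (hd p))"
  shows "poly_pred vs (\<lambda>s. \<exists>i<n s. P s i)"
proof -
  have "poly_pred vs (\<lambda>s. bleast (n s) (P s) < n s)"
    by (intro poly_less poly_bleast assms)
  moreover have "bleast m Q < m \<longleftrightarrow> (\<exists>i<m. Q i)" for Q and m :: nat
    using bleast_holds bleast_min bleast_le by (metis le_neq_implies_less)
  ultimately show ?thesis
    by simp
qed

lemma poly_all:
  assumes "poly_fun vs n" "poly_pred (under vs) (\<lambda>p. P (tl p) (hd p))"
  shows "poly_pred vs (\<lambda>s. \<forall>i<n s. P s i)"
  using poly_not[OF poly_ex[OF assms(1), of "\<lambda>s i. \<not> P s i", OF poly_not[OF assms(2)]]] by simp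

lemma poly_half:
  assumes "poly_fun vs f"
  shows "poly_fun vs (\<lambda>s. f s div 2)"
proof -
  have "poly_fun vs (\<lambda>s. bleast (Suc (f s)) (\<lambda>i. f s \<le> i + i + 1))"
    by (intro poly_bleast poly_Suc poly_le poly_add poly_const poly_bound_var poly_weaken assms)
  moreover have "bleast (Suc m) (\<lambda>i. m \<le> i + i + 1) = m div 2" for m
    by (rule bleast_eqI) auto
  ultimately show ?thesis
    by simp
qed

text \<open>Shifting is done by repeated halving, since the power of two to divide by may exceed
  every polynomial in the values; the bit is then the parity of what is left.\<close>

lemma poly_bit:
  assumes "poly_fun vs f" "poly_fun vs g"
  shows "poly_pred vs (\<lambda>s. bit (f s) (g s))"
proof -
  have eq: "rec_nat x (\<lambda>_ acc. acc div 2) y = x div 2 ^ y" for x y :: nat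
    by (induction y) (auto simp: div_mult2_eq power_Suc2 simp del: power_Suc)
  have shift: "poly_fun vs (\<lambda>s. rec_nat (f s) ((\<lambda>s i acc. acc div 2) s) (g s))"
    by (rule poly_rec[OF assms(2,1) poly_half[OF poly_bound_var] poly_fun_valued[OF assms(1)]])
      (simp add: eq)
  have odd: "poly_pred vs (\<lambda>s. u s = u s div 2 + u s div 2 + 1)" if "poly_fun vs u" for u
    by (intro poly_eq poly_add poly_half poly_const that)
  have "odd m \<longleftrightarrow> m = m div 2 + m div 2 + 1" for m :: nat
    by presburger
  then show ?thesis
    using odd[OF shift] by (simp add: bit_iff_odd eq)
qed

lemma poly_rec_bounded:
  assumes "poly_fun vs n" "poly_fun vs g" "poly_fun vs b"
    and "poly_fun (under (under vs)) (\<lambda>p. h (tl (tl p)) (hd (tl p)) (hd p))"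
    and "\<And>s i. i \<le> n s \<Longrightarrow> rec_nat (g s) (h s) i \<le> b s"
  shows "poly_fun vs (\<lambda>s. rec_nat (g s) (h s) (n s))"
  using assms by (intro poly_rec[OF _ _ _ poly_fun_valued])

section \<open>Programs that write output and update a set\<close>

type_synonym effect = "nat list \<Rightarrow> nat set \<times> bool list \<Rightarrow> nat set \<times> bool list"

text \<open>An action restores all registers and ends with the head of tape 2 back on cell
  \<open>0\<close>, so actions compose freely.\<close>

definition performs :: "valuation list \<Rightarrow> effect \<Rightarrow> nat list \<Rightarrow> nat \<Rightarrow> com \<Rightarrow> (nat \<Rightarrow> nat) \<Rightarrow> bool" where
  "performs vs F ls d c T \<longleftrightarrow> (\<forall>s \<rho> I z. map \<rho> ls = map (\<lambda>v. v s) vs \<longrightarrow> (\<forall>i\<ge>d. \<rho> i = 0) \<longrightarrow>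
     runs c (T (magnitude vs s)) (machine (I, 0, z) \<rho>) (machine (I, 0, F s z) \<rho>))"

lemma performsD:
  "performs vs F ls d c T \<Longrightarrow> map \<rho> ls = map (\<lambda>v. v s) vs \<Longrightarrow> \<forall>i\<ge>d. \<rho> i = 0 \<Longrightarrow>
    runs c (T (magnitude vs s)) (machine (I, 0, z) \<rho>) (machine (I, 0, F s z) \<rho>)"
  unfolding performs_def by blast

definition poly_act :: "valuation list \<Rightarrow> effect \<Rightarrow> bool" where
  "poly_act vs F \<longleftrightarrow>
     (\<forall>ls d. (\<forall>l\<in>set ls. l < d) \<longrightarrow> (\<exists>c T. poly_bounded T \<and> performs vs F ls d c T))"

lemma poly_actE:
  assumes "poly_act vs F" "\<forall>l\<in>set ls. l < d"
  obtains c e where "performs vs F ls d c (\<lambda>B. B ^ e)"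
proof -
  obtain c T where T: "poly_bounded T" "performs vs F ls d c T"
    using assms unfolding poly_act_def by blast
  then obtain e where "\<forall>B\<ge>2. T B \<le> B ^ e"
    unfolding poly_bounded_def by blast
  then have "T (magnitude vs s) \<le> magnitude vs s ^ e" for s
    by (simp add: magnitude_ge)
  then have "performs vs F ls d c (\<lambda>B. B ^ e)"
    using T(2) runs_mono unfolding performs_def by blast
  then show thesis
    by (rule that)
qed

lemma poly_actI:
  assumes "\<And>ls d. \<forall>l\<in>set ls. l < d \<Longrightarrow> \<exists>c T. poly_bounded T \<and> performs vs F ls d c T"
  shows "poly_act vs F"
  using assms unfolding poly_act_def by blast

lemma act_skip: "poly_act vs (\<lambda>s z. z)"
  by (rule poly_actI, rule exI[of _ skip], rule exI[of _ "\<lambda>_. 1"]) (auto simp: performs_def intro!: runs_skip[simplified])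

lemma act_seq:
  assumes F: "poly_act vs F" and G: "poly_act vs G"
  shows "poly_act vs (\<lambda>s z. G s (F s z))"
proof (rule poly_actI)
  fix ls d
  assume ls: "\<forall>l\<in>set ls. l < (d :: nat)"
  obtain c e where c: "performs vs F ls d c (\<lambda>B. B ^ e)"
    using F ls by (rule poly_actE)
  obtain c' e' where c': "performs vs G ls d c' (\<lambda>B. B ^ e')"
    using G ls by (rule poly_actE)
  have "performs vs (\<lambda>s z. G s (F s z)) ls d (Seq c c') (\<lambda>B. 1 + B ^ e + B ^ e')"
    using c c' unfolding performs_def by (blast intro: runs_Seq)
  moreover have "poly_bounded (\<lambda>B. 1 + B ^ e + B ^ e')"
    by (intro poly_bounded_intros)
  ultimately show "\<exists>c T. poly_bounded T \<and> performs vs (\<lambda>s z. G s (F s z)) ls d c T"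
    by blast
qed

lemma input_tape_snoc:
  "(fst (input_tape xs))(int (length xs) := bit_symbol b) = fst (input_tape (xs @ [b]))"
  by (auto simp: input_tape_def fun_eq_iff nth_append)

lemma act_emit: "poly_act vs (\<lambda>s z. (fst z, snd z @ [b]))"
proof (rule poly_actI)
  fix ls and d :: nat
  let ?c = "Seq (Put 1 (bit_symbol b)) (Mov 1 MoveR)"
  have "runs ?c (1 + 1 + 1) (machine (I, h, A, out) \<rho>) (machine (I, h, A, out @ [b]) \<rho>)" for I h A out \<rho>
  proof (rule runs_Seq)
    let ?\<sigma> = "machine (I, h, A, out) \<rho>"
    show "runs (Put 1 (bit_symbol b)) 1 ?\<sigma> (?\<sigma>(1 := tape_act (bit_symbol b, MoveN) (?\<sigma> 1)))"
      by (rule runs_Put) simp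
    show "runs (Mov 1 MoveR) 1 (?\<sigma>(1 := tape_act (bit_symbol b, MoveN) (?\<sigma> 1))) (machine (I, h, A, out @ [b]) \<rho>)"
      by (rule runs_Mov) (auto simp: machine_def fun_eq_iff input_tape_snoc[symmetric])
  qed
  then have "performs vs (\<lambda>s z. (fst z, snd z @ [b])) ls d ?c (\<lambda>_. 1 + 1 + 1)"
    unfolding performs_def by (metis prod.collapse)
  then show "\<exists>c T. poly_bounded T \<and> performs vs (\<lambda>s z. (fst z, snd z @ [b])) ls d c T"
    by blast
qed

lemma act_if:
  assumes P: "poly_pred vs P" and F: "poly_act vs F" and G: "poly_act vs G"
  shows "poly_act vs (\<lambda>s z. if P s then F s z else G s z)"
proof (rule poly_actI)
  fix ls d
  assume ls: "\<forall>l\<in>set ls. l < (d :: nat)"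
  obtain cp ep where cp: "computes vs (\<lambda>s. of_bool (P s)) ls d cp (\<lambda>B. B ^ ep)"
    using P ls by (rule poly_funE)
  obtain c e where c: "performs vs F ls d c (\<lambda>B. B ^ e)"
    using F ls by (rule poly_actE)
  obtain c' e' where c': "performs vs G ls d c' (\<lambda>B. B ^ e')"
    using G ls by (rule poly_actE)
  \<comment> \<open>Register \<open>d\<close> holds \<open>1\<close> only in the true branch, which
    has to clear it before its action runs.\<close>
  let ?c = "Seq cp (If (d + 3) 3 c' (Seq (dec d) c))"
  let ?T = "\<lambda>B. 1 + B ^ ep + (1 + (1 + 1 + (B ^ e + B ^ e')))"
  have "poly_bounded ?T"
    by (intro poly_bounded_intros)
  moreover have "performs vs (\<lambda>s z. if P s then F s z else G s z) ls d ?c ?T"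
    unfolding performs_def
  proof (intro allI impI)
    fix s \<rho> and I :: tape and z :: "nat set \<times> bool list"
    assume map: "map \<rho> ls = map (\<lambda>v. v s) vs" and z: "\<forall>i\<ge>d. \<rho> i = (0 :: nat)"
    let ?B = "magnitude vs s" and ?\<rho> = "\<rho>(d := of_bool (P s))" and ?y = "(I, 0, z)"
    show "runs ?c (?T ?B) (machine ?y \<rho>) (machine (I, 0, if P s then F s z else G s z) \<rho>)"
    proof (rule runs_Seq)
      show "runs cp (?B ^ ep) (machine ?y \<rho>) (machine ?y ?\<rho>)"
        using computes_runs[OF cp map z] .
      have \<rho>: "\<rho>(d := 0) = \<rho>"
        using z by (metis fun_upd_triv le_refl)
      show "runs (If (d + 3) 3 c' (Seq (dec d) c)) (1 + (1 + 1 + (?B ^ e + ?B ^ e'))) (machine ?y ?\<rho>)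
         (machine (I, 0, if P s then F s z else G s z) \<rho>)"
      proof (cases "P s")
        case True
        have "runs (dec d) 1 (machine ?y ?\<rho>) (machine ?y \<rho>)"
          using runs_dec[of ?\<rho> d ?y] True \<rho> by simp
        moreover have "runs c (?B ^ e + ?B ^ e') (machine ?y \<rho>) (machine (I, 0, F s z) \<rho>)"
          by (rule runs_mono[OF performsD[OF c map z]]) simp
        ultimately have "runs (Seq (dec d) c) (1 + 1 + (?B ^ e + ?B ^ e')) (machine ?y ?\<rho>) (machine (I, 0, F s z) \<rho>)"
          by (rule runs_Seq)
        moreover have "tape_read (machine ?y ?\<rho> (d + 3)) \<noteq> 3"
          using True by (simp only: read_register) simp
        ultimately show ?thesis
          using True by (simp only: runs_If_neq if_True simp_thms)
      next
        case False
        have "runs c' (1 + 1 + (?B ^ e + ?B ^ e')) (machine ?y \<rho>) (machine (I, 0, G s z) \<rho>)"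
          by (rule runs_mono[OF performsD[OF c' map z]]) simp
        moreover have "tape_read (machine ?y \<rho> (d + 3)) = 3"
          using z by (simp add: read_register del: add_2_eq_Suc' add_Suc_right)
        ultimately show ?thesis
          using False by (simp only: runs_If_eq if_False of_bool_eq simp_thms \<rho>)
      qed
    qed
  qed
  ultimately show "\<exists>c T. poly_bounded T \<and> performs vs (\<lambda>s z. if P s then F s z else G s z) ls d c T"
    by blast
qed

text \<open>The loop number in \<open>d + 1\<close> is the variable bound by \<open>under\<close>:
  the body finds it at the head of its environment and works from \<open>d + 2\<close> on.\<close>

lemma act_for:
  assumes n: "poly_fun vs n" and F: "poly_act (under vs) (\<lambda>p. F (tl p) (hd p))"
  shows "poly_act vs (\<lambda>s. fold (F s) [0..<n s])"
proof (rule poly_actI)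
  fix ls d
  assume ls: "\<forall>l\<in>set ls. l < (d :: nat)"
  then have ls2: "\<forall>l\<in>set ((d + 1) # ls). l < d + 2"
    by auto
  obtain cn en where cn: "computes vs n ls d cn (\<lambda>B. B ^ en)"
    using n ls by (rule poly_funE)
  obtain c e where c: "performs (under vs) (\<lambda>p. F (tl p) (hd p)) ((d + 1) # ls) (d + 2) c (\<lambda>B. B ^ e)"
    using F ls2 by (rule poly_actE)
  define body where "body = Seq (dec d) (Seq c (inc (d + 1)))"
  let ?c = "Seq cn (Seq (loop d body) (clear (d + 1)))"
  let ?Ti = "\<lambda>B. 1 + 1 + (1 + (B + B ^ en) ^ e + 1)"
  let ?T = "\<lambda>B. 1 + B ^ en + (1 + (B ^ en * (?Ti B + 1) + 1) + (2 * B ^ en + 1))"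
  have "poly_bounded ?T"
    by (intro poly_bounded_intros)
  moreover have "performs vs (\<lambda>s. fold (F s) [0..<n s]) ls d ?c ?T"
    unfolding performs_def
  proof (intro allI impI)
    fix s \<rho> and I :: tape and z :: "nat set \<times> bool list"
    assume map: "map \<rho> ls = map (\<lambda>v. v s) vs" and z: "\<forall>i\<ge>d. \<rho> i = (0 :: nat)"
    define B where "B = magnitude vs s"
    have nB: "n s \<le> B ^ en"
      unfolding B_def using computes_le[OF cn map z] .
    have z0: "\<rho> d = 0" "\<rho> (d + 1) = 0"
      using z by auto
    define R where "R i = \<rho>(d := n s - i, d + 1 := i)" for i
    define Y where "Y i = (I, 0 :: nat, fold (F s) [0..<i] z)" for i
    have step: "runs body (?Ti B) (machine (Y i) (R i)) (machine (Y (Suc i)) (R (Suc i)))" if i: "i < n s" for i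
    proof -
      define R1 where "R1 = (R i)(d := n s - Suc i)"
      have "runs (dec d) 1 (machine (Y i) (R i)) (machine (Y i) R1)"
        using runs_dec[of "R i" d "Y i"] i by (simp add: R1_def R_def)
      moreover have "runs c ((B + B ^ en) ^ e) (machine (Y i) R1) (machine (Y (Suc i)) R1)"
      proof -
        have "map R1 ((d + 1) # ls) = map (\<lambda>v. v (i # s)) (under vs)"
          using ls map by (simp add: R1_def R_def)
        moreover have "\<forall>j\<ge>d + 2. R1 j = 0"
          using z by (simp add: R1_def R_def)
        ultimately have "runs c (magnitude (under vs) (i # s) ^ e) (machine (Y i) R1) (machine (Y (Suc i)) R1)"
          using performsD[OF c, of R1 "i # s" I "fold (F s) [0..<i] z"] by (simp add: Y_def)
        moreover have "magnitude (under vs) (i # s) ^ e \<le> (B + B ^ en) ^ e"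
          using i nB by (intro power_mono) (auto simp: B_def[symmetric])
        ultimately show ?thesis
          by (rule runs_mono)
      qed
      moreover have "runs (inc (d + 1)) 1 (machine (Y (Suc i)) R1) (machine (Y (Suc i)) (R (Suc i)))"
      proof -
        have "R1(d + 1 := Suc (R1 (d + 1))) = R (Suc i)"
          by (auto simp: R1_def R_def fun_eq_iff)
        then show ?thesis
          using runs_inc[of "d + 1" "Y (Suc i)" R1] by (simp only:)
      qed
      ultimately show ?thesis
        unfolding body_def by (intro runs_Seq)
    qed
    have loop: "runs (loop d body) (n s * (?Ti B + 1) + 1) (machine (Y 0) (R 0)) (machine (Y (n s)) (R (n s)))"
      by (rule runs_loop[where Y = Y and R = R, OF step]) (simp_all add: R_def)
    have "runs cn (B ^ en) (machine (Y 0) \<rho>) (machine (Y 0) (R 0))"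
    proof -
      have "\<rho>(d := n s) = R 0"
        using z0 by (auto simp: R_def)
      then show ?thesis
        unfolding B_def using computes_runs[OF cn map z, of "Y 0"] by simp
    qed
    moreover have "runs (loop d body) (B ^ en * (?Ti B + 1) + 1) (machine (Y 0) (R 0)) (machine (Y (n s)) (R (n s)))"
      by (rule runs_mono[OF loop], intro add_mono mult_le_mono nB) auto
    moreover have "runs (clear (d + 1)) (2 * B ^ en + 1) (machine (Y (n s)) (R (n s))) (machine (Y (n s)) \<rho>)"
    proof -
      have "(R (n s))(d + 1 := 0) = \<rho>"
        using z0 by (auto simp: R_def)
      moreover have "R (n s) (d + 1) \<le> B ^ en"
        using nB by (simp add: R_def)
      ultimately show ?thesis
        using runs_clear[of "d + 1" "R (n s)" "Y (n s)"] by (auto elim!: runs_mono)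
    qed
    ultimately have "runs ?c (?T B) (machine (Y 0) \<rho>) (machine (Y (n s)) \<rho>)"
      by (intro runs_Seq)
    then show "runs ?c (?T (magnitude vs s)) (machine (I, 0, z) \<rho>) (machine (I, 0, fold (F s) [0..<n s] z) \<rho>)"
      by (simp add: Y_def B_def)
  qed
  ultimately show "\<exists>c T. poly_bounded T \<and> performs vs (\<lambda>s. fold (F s) [0..<n s]) ls d c T"
    by blast
qed

text \<open>Draining \<open>d\<close> into \<open>d + 1\<close> while the head moves keeps the
  distance, which \<open>retreat\<close> uses to come back.\<close>

definition advance :: "nat \<Rightarrow> com" where
  "advance d = loop d (Seq (dec d) (Seq (inc (d + 1)) (Mov 2 MoveR)))"

definition retreat :: "nat \<Rightarrow> com" where
  "retreat d = loop (d + 1) (Seq (dec (d + 1)) (Mov 2 MoveL))"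

lemma runs_head_right: "runs (Mov 2 MoveR) 1 (machine (I, h, z) \<rho>) (machine (I, Suc h, z) \<rho>)"
  by (rule runs_Mov) (cases z, auto simp: machine_def fun_eq_iff)

lemma runs_head_left: "runs (Mov 2 MoveL) 1 (machine (I, Suc h, z) \<rho>) (machine (I, h, z) \<rho>)"
  by (rule runs_Mov) (cases z, auto simp: machine_def fun_eq_iff)

lemma runs_advance:
  assumes "\<rho> d = 0" "\<rho> (d + 1) = 0"
  shows "runs (advance d) (6 * n + 1) (machine (I, 0, z) (\<rho>(d := n))) (machine (I, n, z) (\<rho>(d + 1 := n)))"
proof -
  define R where "R i = \<rho>(d := n - i, d + 1 := i)" for i
  define Y where "Y i = (I, i, z)" for i :: nat
  have step: "runs (Seq (dec d) (Seq (inc (d + 1)) (Mov 2 MoveR))) (1 + 1 + (1 + 1 + 1))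
      (machine (Y i) (R i)) (machine (Y (Suc i)) (R (Suc i)))" if "i < n" for i
  proof (intro runs_Seq)
    let ?R = "(R i)(d := R i d - 1)"
    show "runs (dec d) 1 (machine (Y i) (R i)) (machine (Y i) ?R)"
      using that by (intro runs_dec) (simp add: R_def)
    have "?R(d + 1 := Suc (?R (d + 1))) = R (Suc i)"
      by (auto simp: R_def fun_eq_iff)
    then show "runs (inc (d + 1)) 1 (machine (Y i) ?R) (machine (Y i) (R (Suc i)))"
      by (metis runs_inc)
    show "runs (Mov 2 MoveR) 1 (machine (Y i) (R (Suc i))) (machine (Y (Suc i)) (R (Suc i)))"
      unfolding Y_def by (rule runs_head_right)
  qed
  have "runs (advance d) (n * (1 + 1 + (1 + 1 + 1) + 1) + 1) (machine (Y 0) (R 0)) (machine (Y n) (R n))"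
    unfolding advance_def by (rule runs_loop[where Y = Y and R = R, OF step]) (simp_all add: R_def)
  moreover have "R 0 = \<rho>(d := n)" "R n = \<rho>(d + 1 := n)"
    using assms by (auto simp: R_def)
  ultimately show ?thesis
    by (auto simp: Y_def elim!: runs_mono)
qed

lemma runs_retreat:
  assumes "\<rho> (d + 1) = 0"
  shows "runs (retreat d) (4 * n + 1) (machine (I, n, z) (\<rho>(d + 1 := n))) (machine (I, 0, z) \<rho>)"
proof -
  define R where "R i = \<rho>(d + 1 := n - i)" for i
  define Y where "Y i = (I, n - i, z)" for i :: nat
  have step: "runs (Seq (dec (d + 1)) (Mov 2 MoveL)) (1 + 1 + 1)
      (machine (Y i) (R i)) (machine (Y (Suc i)) (R (Suc i)))" if "i < n" for i
  proof (intro runs_Seq)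
    show "runs (dec (d + 1)) 1 (machine (Y i) (R i)) (machine (Y i) (R (Suc i)))"
      using runs_dec[of "R i" "d + 1" "Y i"] that by (simp add: R_def)
    show "runs (Mov 2 MoveL) 1 (machine (Y i) (R (Suc i))) (machine (Y (Suc i)) (R (Suc i)))"
      unfolding Y_def using runs_head_left[of I "n - Suc i"] that by (simp add: Suc_diff_Suc)
  qed
  have "runs (retreat d) (n * (1 + 1 + 1 + 1) + 1) (machine (Y 0) (R 0)) (machine (Y n) (R n))"
    unfolding retreat_def by (rule runs_loop[where Y = Y and R = R, OF step]) (simp_all add: R_def)
  moreover have "R 0 = \<rho>(d + 1 := n)" "R n = \<rho>"
    using assms by (auto simp: R_def)
  ultimately show ?thesis
    by (auto simp: Y_def elim!: runs_mono)
qed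

lemma act_insert:
  assumes f: "poly_fun vs f"
  shows "poly_act vs (\<lambda>s z. (insert (f s) (fst z), snd z))"
proof (rule poly_actI)
  fix ls d
  assume ls: "\<forall>l\<in>set ls. l < (d :: nat)"
  obtain c e where c: "computes vs f ls d c (\<lambda>B. B ^ e)"
    using f ls by (rule poly_funE)
  let ?c = "Seq c (Seq (advance d) (Seq (Put 2 3) (retreat d)))"
  let ?T = "\<lambda>B. 1 + B ^ e + (1 + (6 * B ^ e + 1) + (1 + 1 + (4 * B ^ e + 1)))"
  have "poly_bounded ?T"
    by (intro poly_bounded_intros)
  moreover have "performs vs (\<lambda>s z. (insert (f s) (fst z), snd z)) ls d ?c ?T"
    unfolding performs_def
  proof (intro allI impI)
    fix s \<rho> and I :: tape and z :: "nat set \<times> bool list"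
    assume map: "map \<rho> ls = map (\<lambda>v. v s) vs" and z: "\<forall>i\<ge>d. \<rho> i = (0 :: nat)"
    let ?B = "magnitude vs s" and ?z = "(insert (f s) (fst z), snd z)"
    have fB: "f s \<le> ?B ^ e"
      using computes_le[OF c map z] .
    have "runs c (?B ^ e) (machine (I, 0, z) \<rho>) (machine (I, 0, z) (\<rho>(d := f s)))"
      using computes_runs[OF c map z] .
    moreover have "runs (advance d) (6 * ?B ^ e + 1) (machine (I, 0, z) (\<rho>(d := f s))) (machine (I, f s, z) (\<rho>(d + 1 := f s)))"
      by (rule runs_mono[OF runs_advance]) (use z fB in auto)
    moreover have "runs (Put 2 3) 1 (machine (I, f s, z) (\<rho>(d + 1 := f s))) (machine (I, f s, ?z) (\<rho>(d + 1 := f s)))"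
      by (rule runs_Put) (cases z, auto simp: machine_def fun_eq_iff)
    moreover have "runs (retreat d) (4 * ?B ^ e + 1) (machine (I, f s, ?z) (\<rho>(d + 1 := f s))) (machine (I, 0, ?z) \<rho>)"
      by (rule runs_mono[OF runs_retreat]) (use z fB in auto)
    ultimately show "runs ?c (?T ?B) (machine (I, 0, z) \<rho>) (machine (I, 0, ?z) \<rho>)"
      by (intro runs_Seq)
  qed
  ultimately show "\<exists>c T. poly_bounded T \<and> performs vs (\<lambda>s z. (insert (f s) (fst z), snd z)) ls d c T"
    by blast
qed

lemma read_set: "tape_read (machine (I, h, z) \<rho> 2) = 3 \<longleftrightarrow> h \<in> fst z"
  by (cases z) (simp add: machine_def)

text \<open>Both branches bring the head back before their actions run, as \<open>performs\<close>
  presupposes head position \<open>0\<close>.\<close>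

lemma act_if_mem:
  assumes f: "poly_fun vs f" and F: "poly_act vs F" and G: "poly_act vs G"
  shows "poly_act vs (\<lambda>s z. if f s \<in> fst z then F s z else G s z)"
proof (rule poly_actI)
  fix ls d
  assume ls: "\<forall>l\<in>set ls. l < (d :: nat)"
  obtain cf ef where cf: "computes vs f ls d cf (\<lambda>B. B ^ ef)"
    using f ls by (rule poly_funE)
  obtain c e where c: "performs vs F ls d c (\<lambda>B. B ^ e)"
    using F ls by (rule poly_actE)
  obtain c' e' where c': "performs vs G ls d c' (\<lambda>B. B ^ e')"
    using G ls by (rule poly_actE)
  let ?c = "Seq cf (Seq (advance d) (If 2 3 (Seq (retreat d) c) (Seq (retreat d) c')))"
  let ?T = "\<lambda>B. 1 + B ^ ef + (1 + (6 * B ^ ef + 1) + (1 + (1 + (4 * B ^ ef + 1) + (B ^ e + B ^ e'))))"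
  have "poly_bounded ?T"
    by (intro poly_bounded_intros)
  moreover have "performs vs (\<lambda>s z. if f s \<in> fst z then F s z else G s z) ls d ?c ?T"
    unfolding performs_def
  proof (intro allI impI)
    fix s \<rho> and I :: tape and z :: "nat set \<times> bool list"
    assume map: "map \<rho> ls = map (\<lambda>v. v s) vs" and z: "\<forall>i\<ge>d. \<rho> i = (0 :: nat)"
    let ?B = "magnitude vs s" and ?z = "if f s \<in> fst z then F s z else G s z"
    have fB: "f s \<le> ?B ^ ef"
      using computes_le[OF cf map z] .
    have "runs cf (?B ^ ef) (machine (I, 0, z) \<rho>) (machine (I, 0, z) (\<rho>(d := f s)))"
      using computes_runs[OF cf map z] .
    moreover have "runs (advance d) (6 * ?B ^ ef + 1) (machine (I, 0, z) (\<rho>(d := f s))) (machine (I, f s, z) (\<rho>(d + 1 := f s)))"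
      by (rule runs_mono[OF runs_advance]) (use z fB in auto)
    moreover have "runs (If 2 3 (Seq (retreat d) c) (Seq (retreat d) c'))
      (1 + (1 + (4 * ?B ^ ef + 1) + (?B ^ e + ?B ^ e'))) (machine (I, f s, z) (\<rho>(d + 1 := f s))) (machine (I, 0, ?z) \<rho>)"
    proof -
      have rewind: "runs (retreat d) (4 * ?B ^ ef + 1) (machine (I, f s, z) (\<rho>(d + 1 := f s))) (machine (I, 0, z) \<rho>)"
        by (rule runs_mono[OF runs_retreat]) (use z fB in auto)
      show ?thesis
      proof (cases "f s \<in> fst z")
        case True
        have "runs c (?B ^ e + ?B ^ e') (machine (I, 0, z) \<rho>) (machine (I, 0, F s z) \<rho>)"
          by (rule runs_mono[OF performsD[OF c map z]]) simp
        from runs_Seq[OF rewind this] show ?thesis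
          using True by (intro runs_If_eq) (simp_all only: read_set if_True)
      next
        case False
        have "runs c' (?B ^ e + ?B ^ e') (machine (I, 0, z) \<rho>) (machine (I, 0, G s z) \<rho>)"
          by (rule runs_mono[OF performsD[OF c' map z]]) simp
        from runs_Seq[OF rewind this] show ?thesis
          using False by (intro runs_If_neq) (simp_all only: read_set if_False simp_thms)
      qed
    qed
    ultimately show "runs ?c (?T ?B) (machine (I, 0, z) \<rho>) (machine (I, 0, ?z) \<rho>)"
      by (intro runs_Seq)
  qed
  ultimately show "\<exists>c T. poly_bounded T \<and> performs vs (\<lambda>s z. if f s \<in> fst z then F s z else G s z) ls d c T"
    by blast
qed

section \<open>Loading the parameters\<close>

lemma pow2_program:
  assumes f: "poly_fun vs f" and ls: "\<forall>l\<in>set ls. l < d"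
  shows "\<exists>c e. \<forall>s \<rho> y. map \<rho> ls = map (\<lambda>v. v s) vs \<longrightarrow> (\<forall>i\<ge>d. \<rho> i = 0) \<longrightarrow>
    runs c ((magnitude vs s + 2 ^ f s) ^ e) (machine y \<rho>) (machine y (\<rho>(d := 2 ^ f s)))"
proof -
  have "\<forall>l\<in>set ls. l < d + 1"
    using ls by auto
  with f obtain c e where c: "computes vs f ls (d + 1) c (\<lambda>B. B ^ e)"
    by (rule poly_funE)
  define body where "body = Seq (dec (d + 1)) (Seq (copy d (d + 2) (d + 3)) (transfer (d + 2) d))"
  define prog where "prog = Seq c (Seq (inc d) (loop (d + 1) body))"
  define Ti where "Ti B = 1 + 1 + (1 + (10 * B + 3) + (4 * B + 1))" for B :: nat
  define T where "T B = 1 + B ^ e + (1 + 1 + (B ^ e * (Ti B + 1) + 1))" for B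
  have "poly_bounded Ti"
    unfolding Ti_def by (intro poly_bounded_intros)
  then have "poly_bounded T"
    unfolding T_def by (intro poly_bounded_intros)
  then obtain e' where e': "\<forall>B\<ge>2. T B \<le> B ^ e'"
    unfolding poly_bounded_def by blast
  have "runs prog ((magnitude vs s + 2 ^ f s) ^ e') (machine y \<rho>) (machine y (\<rho>(d := 2 ^ f s)))"
    if map: "map \<rho> ls = map (\<lambda>v. v s) vs" and z: "\<forall>i\<ge>d. \<rho> i = 0" for s \<rho> y
  proof -
    define B where "B = magnitude vs s + 2 ^ f s"
    have le: "magnitude vs s ^ e \<le> B ^ e"
      unfolding B_def by (intro power_mono) auto
    have z1: "\<forall>i\<ge>d + 1. \<rho> i = 0"
      using z by auto
    have z0: "\<rho> d = 0" "\<rho> (d + 1) = 0" "\<rho> (d + 2) = 0" "\<rho> (d + 3) = 0"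
      using z by auto
    have fB: "f s \<le> B ^ e"
      using computes_le[OF c map z1] le by linarith
    define R where "R i = \<rho>(d + 1 := f s - i, d := 2 ^ i)" for i
    have step: "runs body (Ti B) (machine y (R i)) (machine y (R (Suc i)))" if i: "i < f s" for i
    proof -
      have pow: "2 ^ i \<le> B"
        unfolding B_def using i by (intro trans_le_add2 power_increasing) auto
      define R1 where "R1 = (R i)(d + 1 := f s - Suc i)"
      define R2 where "R2 = R1(d + 2 := 2 ^ i)"
      have "runs (dec (d + 1)) 1 (machine y (R i)) (machine y R1)"
        using runs_dec[of "R i" "d + 1" y] i by (simp add: R1_def R_def)
      moreover have "runs (copy d (d + 2) (d + 3)) (10 * B + 3) (machine y R1) (machine y R2)"
      proof -
        have "R1 (d + 3) = 0" "R1(d + 2 := R1 (d + 2) + R1 d) = R2" "R1 d \<le> B"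
          using z0 pow by (auto simp: R2_def R1_def R_def)
        then show ?thesis
          using runs_copy[of d "d + 2" "d + 3" R1 y] by (auto elim!: runs_mono)
      qed
      moreover have "runs (transfer (d + 2) d) (4 * B + 1) (machine y R2) (machine y (R (Suc i)))"
      proof -
        have "R2(d + 2 := 0, d := R2 d + R2 (d + 2)) = R (Suc i)" "R2 (d + 2) \<le> B"
          using z0 pow by (auto simp: R2_def R1_def R_def fun_eq_iff)
        then show ?thesis
          using runs_transfer[of "d + 2" d R2 y] by (auto elim!: runs_mono)
      qed
      ultimately show ?thesis
        unfolding body_def Ti_def by (intro runs_Seq)
    qed
    have loop: "runs (loop (d + 1) body) (f s * (Ti B + 1) + 1) (machine y (R 0)) (machine y (R (f s)))"
      by (rule runs_loop[where Y = "\<lambda>_. y" and R = R, OF step]) (simp_all add: R_def)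
    have "runs c (B ^ e) (machine y \<rho>) (machine y (\<rho>(d + 1 := f s)))"
      by (rule runs_mono[OF computes_runs[OF c map z1] le])
    moreover have "runs (inc d) 1 (machine y (\<rho>(d + 1 := f s))) (machine y (R 0))"
      using runs_inc[of d y "\<rho>(d + 1 := f s)"] z0 by (simp add: R_def)
    moreover have "runs (loop (d + 1) body) (B ^ e * (Ti B + 1) + 1) (machine y (R 0)) (machine y (R (f s)))"
      by (rule runs_mono[OF loop], intro add_mono mult_le_mono fB) auto
    ultimately have "runs prog (T B) (machine y \<rho>) (machine y (R (f s)))"
      unfolding prog_def T_def by (intro runs_Seq)
    moreover have "R (f s) = \<rho>(d := 2 ^ f s)"
      using z0 by (auto simp: R_def)
    moreover have "T B \<le> B ^ e'"
      using e' magnitude_ge[of vs s] by (simp add: B_def)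
    ultimately show ?thesis
      unfolding B_def by (auto elim: runs_mono)
  qed
  then show ?thesis
    by blast
qed

definition regs :: "nat list \<Rightarrow> nat \<Rightarrow> nat" where
  "regs us i = (if i < length us then us ! i else 0)"

lemma map_regs: "map (regs us) [0..<length us] = us"
  by (rule nth_equalityI) (auto simp: regs_def)

lemma regs_snoc: "(regs us)(length us := u) = regs (us @ [u])"
  by (auto simp: regs_def nth_append fun_eq_iff)

text \<open>The first letter is the lowest bit, so a letter of the word is a bit of the number.
  Trailing \<open>False\<close> letters leave no trace, which is why \<open>input_env\<close> also
  records the length.\<close>

definition num :: "bool list \<Rightarrow> nat" where
  "num x = horner_sum of_bool 2 x"

lemma bit_num: "bit (num x) j \<longleftrightarrow> j < length x \<and> x ! j"
  by (simp add: num_def bit_horner_sum_bit_iff)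

lemma num_less: "num x < 2 ^ length x"
  unfolding num_def by (rule horner_sum_of_bool_2_less)

lemma num_snoc: "num (xs @ [b]) = num xs + (if b then 2 ^ length xs else 0)"
  by (simp add: num_def horner_sum_append)

definition input_env :: "bool list \<Rightarrow> nat list" where
  "input_env x = [num x, length x]"

text \<open>The time is measured in the parameters that are loaded, exponentials included.\<close>

definition loadable :: "valuation list \<Rightarrow> bool" where
  "loadable vs \<longleftrightarrow> (\<exists>c e. \<forall>x z. runs c (magnitude vs (input_env x) ^ e)
     (machine (input_tape x, 0, z) (regs []))
     (machine ((fst (input_tape x), int (length x)), 0, z) (regs (map (\<lambda>v. v (input_env x)) vs))))"

text \<open>The third register carries the weight \<open>2 ^ i\<close> of the next letter, which is
  added to the first register if the letter is \<open>True\<close>. Its final value is the tower of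
  level \<open>0\<close>, so it stays among the parameters.\<close>

lemma loadable_input: "loadable [\<lambda>s. s ! 0, \<lambda>s. s ! 1, \<lambda>s. 2 ^ (s ! 1)]"
proof -
  define body where "body = Seq (If 0 2 (copy 2 0 3) skip) (Seq (copy 2 3 4) (Seq (transfer 3 2) (Seq (inc 1) (Mov 0 MoveR))))"
  define prog where "prog = Seq (inc 2) (While 0 0 body)"
  define Ti where "Ti B = 1 + (1 + (10 * B + 3)) + (1 + (10 * B + 3) + (1 + (4 * B + 1) + (1 + 1 + 1)))" for B :: nat
  define T where "T B = 1 + 1 + (B * (Ti B + 1) + 1)" for B
  have "poly_bounded Ti"
    unfolding Ti_def by (intro poly_bounded_intros)
  then have "poly_bounded T"
    unfolding T_def by (intro poly_bounded_intros)
  then obtain e where e: "\<forall>B\<ge>2. T B \<le> B ^ e"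
    unfolding poly_bounded_def by blast
  let ?vs = "[\<lambda>s. s ! 0, \<lambda>s. s ! 1, \<lambda>s. 2 ^ (s ! 1)] :: valuation list"
  have "runs prog (magnitude ?vs (input_env x) ^ e) (machine (input_tape x, 0, z) (regs []))
     (machine ((fst (input_tape x), int (length x)), 0, z) (regs (map (\<lambda>v. v (input_env x)) ?vs)))" for x z
  proof -
    define L where "L = length x"
    define B where "B = magnitude ?vs (input_env x)"
    have B: "L \<le> B" "2 ^ L \<le> B" "2 \<le> B"
      by (auto simp: B_def L_def input_env_def magnitude_def)
    define R :: "nat \<Rightarrow> nat \<Rightarrow> nat" where "R i = (\<lambda>_. 0)(0 := num (take i x), 1 := i, 2 := 2 ^ i)" for i
    define Y where "Y i = ((fst (input_tape x), int i), 0 :: nat, z)" for i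
    have read: "tape_read (machine (Y i) \<rho> 0) = (if i < L then bit_symbol (x ! i) else 0)" for i \<rho>
      by (cases z) (auto simp: machine_def Y_def input_tape_def L_def)
    have step: "runs body (Ti B) (machine (Y i) (R i)) (machine (Y (Suc i)) (R (Suc i)))" if i: "i < L" for i
    proof -
      have pow: "2 ^ i \<le> B"
        by (rule order_trans[OF power_increasing B(2)]) (use i in auto)
      define R1 where "R1 = (R i)(0 := num (take (Suc i) x))"
      define R2 where "R2 = R1(3 := 2 ^ i)"
      define R3 where "R3 = R1(2 := 2 ^ Suc i)"
      have num: "num (take (Suc i) x) = num (take i x) + (if x ! i then 2 ^ i else 0)"
        using i num_snoc[of "take i x" "x ! i"] by (simp add: take_Suc_conv_app_nth L_def)
      have "runs (If 0 2 (copy 2 0 3) skip) (1 + (10 * B + 3)) (machine (Y i) (R i)) (machine (Y i) R1)"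
      proof (cases "x ! i")
        case True
        have "R i 3 = 0" "(R i)(0 := R i 0 + R i 2) = R1" "R i 2 \<le> B"
          using pow num True by (auto simp: R1_def R_def)
        then have "runs (copy 2 0 3) (10 * B + 3) (machine (Y i) (R i)) (machine (Y i) R1)"
          using runs_copy[of 2 0 3 "R i" "Y i"] by (auto elim!: runs_mono)
        then show ?thesis
          using read True i by (intro runs_If_eq) (auto simp: bit_symbol_def)
      next
        case False
        then have "R1 = R i"
          using num by (auto simp: R1_def R_def)
        then have "runs skip (10 * B + 3) (machine (Y i) (R i)) (machine (Y i) R1)"
          by (auto intro!: runs_mono[OF runs_skip])
        then show ?thesis
          using read False i by (intro runs_If_neq) (auto simp: bit_symbol_def)
      qed
      moreover have "runs (copy 2 3 4) (10 * B + 3) (machine (Y i) R1) (machine (Y i) R2)"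
      proof -
        have "R1 4 = 0" "R1(3 := R1 3 + R1 2) = R2" "R1 2 \<le> B"
          using pow by (auto simp: R2_def R1_def R_def)
        then show ?thesis
          using runs_copy[of 2 3 4 R1 "Y i"] by (auto elim!: runs_mono)
      qed
      moreover have "runs (transfer 3 2) (4 * B + 1) (machine (Y i) R2) (machine (Y i) R3)"
      proof -
        have "R2(3 := 0, 2 := R2 2 + R2 3) = R3" "R2 3 \<le> B"
          using pow by (auto simp: R3_def R2_def R1_def R_def fun_eq_iff)
        then show ?thesis
          using runs_transfer[of 3 2 R2 "Y i"] by (auto elim!: runs_mono)
      qed
      moreover have "runs (inc 1) 1 (machine (Y i) R3) (machine (Y i) (R (Suc i)))"
      proof -
        have "R3(1 := Suc (R3 1)) = R (Suc i)"
          by (auto simp: R3_def R1_def R_def fun_eq_iff)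
        then show ?thesis
          using runs_inc[of 1 "Y i" R3] by (simp only:)
      qed
      moreover have "runs (Mov 0 MoveR) 1 (machine (Y i) (R (Suc i))) (machine (Y (Suc i)) (R (Suc i)))"
        by (rule runs_Mov) (cases z, auto simp: machine_def Y_def fun_eq_iff)
      ultimately show ?thesis
        unfolding body_def Ti_def by (intro runs_Seq)
    qed
    have loop: "runs (While 0 0 body) (L * (Ti B + 1) + 1) (machine (Y 0) (R 0)) (machine (Y L) (R L))"
      by (rule runs_While[where f = "\<lambda>i. machine (Y i) (R i)", OF step]) (simp_all add: read bit_symbol_def)
    have "runs (inc 2) 1 (machine (Y 0) (regs [])) (machine (Y 0) (R 0))"
    proof -
      have "(regs [])(2 := Suc (regs [] 2)) = R 0"
        by (auto simp: R_def regs_def num_def fun_eq_iff)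
      then show ?thesis
        using runs_inc[of 2 "Y 0" "regs []"] by (simp only:)
    qed
    moreover have "runs (While 0 0 body) (B * (Ti B + 1) + 1) (machine (Y 0) (R 0)) (machine (Y L) (R L))"
      by (rule runs_mono[OF loop], intro add_mono mult_le_mono B) auto
    ultimately have "runs prog (T B) (machine (Y 0) (regs [])) (machine (Y L) (R L))"
      unfolding prog_def T_def by (rule runs_Seq)
    moreover have "R L = regs (map (\<lambda>v. v (input_env x)) ?vs)"
      by (auto simp: R_def regs_def L_def input_env_def fun_eq_iff less_Suc_eq nth_Cons')
    moreover have "T B \<le> B ^ e"
      using e B(3) by simp
    moreover have "Y 0 = (input_tape x, 0, z)"
      by (simp add: Y_def input_tape_def)
    ultimately show ?thesis
      unfolding B_def by (auto simp: Y_def L_def elim: runs_mono)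
  qed
  then show ?thesis
    unfolding loadable_def by blast
qed

text \<open>The first free register is \<open>length vs\<close>, so the new value becomes the last
  parameter. The exponent may use everything loaded before, which yields the towers one after the
  other.\<close>

lemma loadable_pow2:
  assumes vs: "loadable vs" and f: "poly_fun vs f"
  shows "loadable (vs @ [\<lambda>s. 2 ^ f s])"
proof -
  obtain c e where c: "\<And>x z. runs c (magnitude vs (input_env x) ^ e)
     (machine (input_tape x, 0, z) (regs []))
     (machine ((fst (input_tape x), int (length x)), 0, z) (regs (map (\<lambda>v. v (input_env x)) vs)))"
    using vs unfolding loadable_def by blast
  have "\<forall>l\<in>set [0..<length vs]. l < length vs"
    by simp
  from pow2_program[OF f this] obtain c' e' where
    c': "\<And>s \<rho> y. map \<rho> [0..<length vs] = map (\<lambda>v. v s) vs \<Longrightarrow> \<forall>i\<ge>length vs. \<rho> i = 0 \<Longrightarrow>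
    runs c' ((magnitude vs s + 2 ^ f s) ^ e') (machine y \<rho>) (machine y (\<rho>(length vs := 2 ^ f s)))"
    by blast
  have "poly_bounded (\<lambda>B. 1 + B ^ e + B ^ e')"
    by (intro poly_bounded_intros)
  then obtain e'' where e'': "\<And>B :: nat. 2 \<le> B \<Longrightarrow> 1 + B ^ e + B ^ e' \<le> B ^ e''"
    unfolding poly_bounded_def by blast
  have "runs (Seq c c') (magnitude (vs @ [\<lambda>s. 2 ^ f s]) (input_env x) ^ e'')
     (machine (input_tape x, 0, z) (regs []))
     (machine ((fst (input_tape x), int (length x)), 0, z) (regs (map (\<lambda>v. v (input_env x)) (vs @ [\<lambda>s. 2 ^ f s]))))" for x z
  proof -
    let ?s = "input_env x"
    let ?us = "map (\<lambda>v. v ?s) vs" and ?y = "((fst (input_tape x), int (length x)), 0, z)"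
    define B where "B = magnitude vs ?s + 2 ^ f ?s"
    have B: "magnitude (vs @ [\<lambda>s. 2 ^ f s]) ?s = B"
      by (simp add: B_def magnitude_def)
    have "runs c (B ^ e) (machine (input_tape x, 0, z) (regs [])) (machine ?y (regs ?us))"
      by (rule runs_mono[OF c]) (auto simp: B_def intro: power_mono)
    moreover have "runs c' (B ^ e') (machine ?y (regs ?us)) (machine ?y ((regs ?us)(length vs := 2 ^ f ?s)))"
      unfolding B_def using map_regs[of ?us] by (intro c') (auto simp: regs_def)
    ultimately have "runs (Seq c c') (1 + B ^ e + B ^ e') (machine (input_tape x, 0, z) (regs []))
        (machine ?y ((regs ?us)(length vs := 2 ^ f ?s)))"
      by (rule runs_Seq)
    moreover have "(regs ?us)(length vs := 2 ^ f ?s) = regs (map (\<lambda>v. v ?s) (vs @ [\<lambda>s. 2 ^ f s]))"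
      using regs_snoc[of ?us "2 ^ f ?s"] by simp
    moreover have "1 + B ^ e + B ^ e' \<le> B ^ e''"
      using e''[of B] magnitude_ge[of vs ?s] by (simp add: B_def)
    ultimately show ?thesis
      unfolding B by (simp only: runs_mono)
  qed
  then show ?thesis
    unfolding loadable_def by blast
qed

text \<open>The exponent has the word length \<open>L\<close> where the number of propositions is
  expected: \<open>L\<close> is known without parsing and is large enough by
  \<open>n_le\<close>.\<close>

fun tower :: "nat \<Rightarrow> nat \<Rightarrow> nat \<Rightarrow> nat" where
  "tower a L 0 = 2 ^ L"
| "tower a L (Suc j) = 2 ^ (L + a * tower a L j)"

definition tower_params :: "nat \<Rightarrow> nat \<Rightarrow> valuation list" where
  "tower_params a k = [\<lambda>s. s ! 0, \<lambda>s. s ! 1] @ map (\<lambda>j s. tower a (s ! 1) j) [0..<Suc k]"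

text \<open>The last parameter is \<open>table_bound\<close> of the word length.\<close>

definition params :: "nat \<Rightarrow> nat \<Rightarrow> valuation list" where
  "params a k = tower_params a k @ [\<lambda>s. 2 ^ ((s ! 1 + 1) * (s ! 1 + 1))]"

lemma loadable_tower: "loadable (tower_params a k)"
proof (induction k)
  case 0
  show ?case
    using loadable_input by (simp add: tower_params_def)
next
  case (Suc k)
  have "poly_fun (tower_params a k) (\<lambda>s. s ! 1 + a * tower a (s ! 1) k)"
    by (intro poly_add poly_mult poly_const poly_var) (auto simp: tower_params_def)
  from loadable_pow2[OF Suc this] show ?case
    by (simp add: tower_params_def)
qed

lemma loadable_params: "loadable (params a k)"
  unfolding params_def
  by (intro loadable_pow2 loadable_tower poly_mult poly_add poly_const poly_var) (auto simp: tower_params_def)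

section \<open>From actions to Turing machines\<close>

fun mark_registers :: "nat \<Rightarrow> com" where
  "mark_registers 0 = skip"
| "mark_registers (Suc n) = Seq (mark_registers n) (Put (n + 3) 3)"

lemma runs_mark_registers:
  "runs (mark_registers n) (2 * n + 1) \<sigma>
    (\<lambda>j. if 3 \<le> j \<and> j < n + 3 then tape_act (3, MoveN) (\<sigma> j) else \<sigma> j)"
proof (induction n)
  case 0
  have "(\<lambda>j. if 3 \<le> j \<and> j < 0 + 3 then tape_act (3, MoveN) (\<sigma> j) else \<sigma> j) = \<sigma>"
    by (rule ext) auto
  then show ?case
    using runs_skip[of \<sigma>] by (simp only: mark_registers.simps mult_0_right add_0)
next
  case (Suc n)
  have "runs (Put (n + 3) 3) 1 (\<lambda>j. if 3 \<le> j \<and> j < n + 3 then tape_act (3, MoveN) (\<sigma> j) else \<sigma> j)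
     (\<lambda>j. if 3 \<le> j \<and> j < Suc n + 3 then tape_act (3, MoveN) (\<sigma> j) else \<sigma> j)"
    by (rule runs_Put) (auto simp: fun_eq_iff)
  from runs_Seq[OF Suc this] show ?case
    by (auto elim!: runs_mono)
qed

lemma com_within_mark_registers: "4 \<le> N \<Longrightarrow> com_within (n + 3) N (mark_registers n)"
  by (induction n) (auto elim: com_within_mono)

text \<open>The verdict is membership of \<open>0\<close> because the head of tape 2 ends on cell
  \<open>0\<close>.\<close>

theorem turing_machine_of_act:
  assumes "poly_act (params a k) F"
  shows "\<exists>M e. wf_tm M \<and> (\<forall>x. \<exists>t \<le> magnitude (params a k) (input_env x) ^ e.
     fst (tm_run M x t) = (if 0 \<in> fst (F (input_env x) ({}, [])) then tm_accept M else tm_reject M) \<and>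
     has_output (tm_run M x t) (snd (F (input_env x) ({}, []))))"
proof -
  let ?vs = "params a k"
  obtain c e where c: "\<And>x z. runs c (magnitude ?vs (input_env x) ^ e)
     (machine (input_tape x, 0, z) (regs []))
     (machine ((fst (input_tape x), int (length x)), 0, z) (regs (map (\<lambda>v. v (input_env x)) ?vs)))"
    using loadable_params unfolding loadable_def by blast
  have "\<forall>l\<in>set [0..<length ?vs]. l < length ?vs"
    by simp
  with assms obtain c' e' where c': "performs ?vs F [0..<length ?vs] (length ?vs) c' (\<lambda>B. B ^ e')"
    by (rule poly_actE)
  obtain K where K: "com_within K K (Seq c c')"
    using ex_com_within by blast
  \<comment> \<open>A fresh machine has blank work tapes, so the counters in use have to be marked
    before the program runs.\<close>
  define prog where "prog = Seq (mark_registers K) (Seq c c')"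
  define M where "M = tm_of_com (K + 3) (K + 4) prog"
  have within: "com_within (K + 3) (K + 4) prog"
    unfolding prog_def using K com_within_mark_registers[of "K + 4" K]
    by (auto elim: com_within_mono)
  have "poly_bounded (\<lambda>B. 1 + (1 + (2 * K + 1) + (1 + B ^ e + B ^ e')))"
    by (intro poly_bounded_intros)
  then obtain e'' where e'': "\<And>B :: nat. 2 \<le> B \<Longrightarrow> 1 + (1 + (2 * K + 1) + (1 + B ^ e + B ^ e')) \<le> B ^ e''"
    unfolding poly_bounded_def by blast
  have "\<exists>t \<le> magnitude ?vs (input_env x) ^ e''.
     fst (tm_run M x t) = (if 0 \<in> fst (F (input_env x) ({}, [])) then tm_accept M else tm_reject M) \<and>
     has_output (tm_run M x t) (snd (F (input_env x) ({}, [])))" for x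
  proof -
    let ?s = "input_env x" and ?z = "({}, []) :: nat set \<times> bool list"
    define B where "B = magnitude ?vs ?s"
    \<comment> \<open>Tapes from \<open>K + 3\<close> on do not exist in the machine. They are taken
      as marked already, so that marking the first \<open>K\<close> counters yields
      \<open>machine\<close> on all tapes.\<close>
    define \<sigma> where "\<sigma> j = (if j = 0 then input_tape x else if j < K + 3 then blank_tape
      else machine (input_tape x, 0, ?z) (regs []) j)" for j
    define \<sigma>' where "\<sigma>' = machine ((fst (input_tape x), int (length x)), 0, F ?s ?z) (regs (map (\<lambda>v. v ?s) ?vs))"
    have marked: "(\<lambda>j. if 3 \<le> j \<and> j < K + 3 then tape_act (3, MoveN) (\<sigma> j) else \<sigma> j) =
        machine (input_tape x, 0, ?z) (regs [])"
      by (auto simp: fun_eq_iff \<sigma>_def machine_def blank_tape_def regs_def input_tape_def)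
    have "runs c' (B ^ e') (machine ((fst (input_tape x), int (length x)), 0, ?z) (regs (map (\<lambda>v. v ?s) ?vs))) \<sigma>'"
      unfolding B_def \<sigma>'_def using map_regs[of "map (\<lambda>v. v ?s) ?vs"]
      by (intro performsD[OF c']) (auto simp: regs_def)
    from runs_Seq[OF c[of x ?z] this]
    have "runs prog (1 + (2 * K + 1) + (1 + B ^ e + B ^ e')) \<sigma> \<sigma>'"
      unfolding prog_def B_def by (rule runs_Seq[OF runs_mark_registers[of K \<sigma>, unfolded marked]])
    then obtain t where t: "t \<le> 1 + (2 * K + 1) + (1 + B ^ e + B ^ e')" "exec prog \<sigma> t \<sigma>'"
      unfolding runs_def by blast
    have "store_tapes (K + 3) \<sigma> = input_tape x # replicate (K + 3 - 1) blank_tape"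
      by (rule nth_equalityI) (auto simp: \<sigma>_def nth_Cons')
    from tm_of_com_run[OF t(2) within _ this]
    have run: "tm_run M x (Suc t) = ((if tape_read (\<sigma>' 2) = 3 then tm_accept M else tm_reject M), store_tapes (K + 3) \<sigma>')"
      by (simp add: M_def)
    have "tape_read (\<sigma>' 2) = 3 \<longleftrightarrow> 0 \<in> fst (F ?s ?z)"
      unfolding \<sigma>'_def by (rule read_set)
    moreover have "fst (\<sigma>' 1) = fst (input_tape (snd (F ?s ?z)))"
      by (cases "F ?s ?z") (simp add: \<sigma>'_def machine_def)
    then have "has_output (tm_run M x (Suc t)) (snd (F ?s ?z))"
      by (simp add: run has_output_def input_tape_def)
    moreover have "Suc t \<le> B ^ e''"
      using t(1) e''[of B] magnitude_ge[of ?vs ?s] by (simp add: B_def)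
    ultimately show ?thesis
      using run unfolding B_def by (intro exI[of _ "Suc t"]) simp
  qed
  moreover have "wf_tm M"
    unfolding M_def using within by (intro wf_tm_of_com) auto
  ultimately show ?thesis
    by blast
qed

section \<open>Recognising and evaluating encoded formulas\<close>

definition spells :: "bool list \<Rightarrow> nat \<Rightarrow> nat \<Rightarrow> bool list \<Rightarrow> bool" where
  "spells x p q w \<longleftrightarrow> q = p + length w \<and> q \<le> length x \<and> (\<forall>i<length w. x ! (p + i) = w ! i)"

lemma spells_Nil [simp]: "spells x p q [] \<longleftrightarrow> q = p \<and> p \<le> length x"
  by (auto simp: spells_def)

lemma spells_Cons [simp]:
  "spells x p q (b # w) \<longleftrightarrow> p < length x \<and> x ! p = b \<and> spells x (Suc p) q w"
  by (auto simp: spells_def nth_Cons' less_Suc_eq_0_disj all_conj_distrib imp_conjL split: if_splits)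

lemma spells_append: "spells x p q (u @ v) \<longleftrightarrow> (\<exists>r. spells x p r u \<and> spells x r q v)"
proof (induction u arbitrary: p)
  case Nil
  then show ?case by (auto simp: spells_def)
qed auto

lemma spells_map:
  "spells x p q (map g [0..<c]) \<longleftrightarrow> q = p + c \<and> q \<le> length x \<and> (\<forall>r<c. x ! (p + r) = g r)"
  by (auto simp: spells_def)

lemma spells_enc_nat:
  "spells x p q (enc_nat c) \<longleftrightarrow>
    q = p + c + 1 \<and> q \<le> length x \<and> (\<forall>r<c. x ! (p + r)) \<and> \<not> x ! (p + c)"
  by (auto simp: spells_def enc_nat_def nth_append less_Suc_eq)

lemma spells_all: "spells x 0 (length x) w \<longleftrightarrow> w = x"
  by (auto simp: spells_def list_eq_iff_nth_eq)

lemma spells_le: "spells x p q w \<Longrightarrow> p \<le> q \<and> q \<le> length x"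
  by (simp add: spells_def)

lemma spells_drop: "spells x p q w \<Longrightarrow> drop p x = w @ drop q x"
  by (rule nth_equalityI) (auto simp: spells_def nth_append)

lemma enc_nat_append_inject: "enc_nat m @ u = enc_nat n @ v \<longleftrightarrow> m = n \<and> u = v"
proof (induction m arbitrary: n)
  case 0
  then show ?case by (cases n) (auto simp: enc_nat_def)
next
  case (Suc m)
  then show ?case by (cases n) (auto simp: enc_nat_def)
qed

text \<open>The code is prefix-free. Allowing arbitrary remainders lets the induction pass the first
  argument of \<open>Or\<close> to reach the second.\<close>

lemma enc_form_append_inject: "enc_form \<phi> @ u = enc_form \<psi> @ v \<Longrightarrow> \<phi> = \<psi> \<and> u = v"
proof (induction \<phi> arbitrary: \<psi> u v)
  case (Atom p)
  then show ?case by (cases \<psi>) (simp_all add: enc_nat_append_inject)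
next
  case (Neg \<phi>)
  show ?case
  proof (cases \<psi>)
    case (Neg \<psi>')
    then show ?thesis
      using Neg.IH[of u \<psi>' v] Neg.prems by (simp add: enc_nat_append_inject)
  qed (use Neg.prems in \<open>simp_all add: enc_nat_append_inject\<close>)
next
  case (Or \<phi>1 \<phi>2)
  show ?case
  proof (cases \<psi>)
    case (Or \<psi>1 \<psi>2)
    then have "enc_form \<phi>1 @ enc_form \<phi>2 @ u = enc_form \<psi>1 @ enc_form \<psi>2 @ v"
      using Or.prems by (simp add: enc_nat_append_inject)
    from Or.IH(1)[OF this] Or.IH(2)[of u \<psi>2 v] show ?thesis
      using Or by simp
  qed (use Or.prems in \<open>simp_all add: enc_nat_append_inject\<close>)
next
  case (Know i \<phi>)
  show ?case
  proof (cases \<psi>)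
    case (Know i' \<psi>')
    then show ?thesis
      using Know.IH[of u \<psi>' v] Know.prems by (simp add: enc_nat_append_inject)
  qed (use Know.prems in \<open>simp_all add: enc_nat_append_inject\<close>)
qed

lemma spells_form_unique:
  assumes "spells x p q (enc_form \<phi>)" "spells x p q' (enc_form \<psi>)"
  shows "\<phi> = \<psi>" "q = q'"
proof -
  show "\<phi> = \<psi>"
    using assms[THEN spells_drop] enc_form_append_inject by metis
  then show "q = q'"
    using assms by (simp add: spells_def)
qed

lemma enc_form_nonempty: "2 \<le> length (enc_form \<phi>)"
  by (cases \<phi>) auto

definition form_ok :: "nat \<Rightarrow> nat \<Rightarrow> nat \<Rightarrow> form \<Rightarrow> bool" where
  "form_ok a n j \<phi> \<longleftrightarrow> in_language a n \<phi> \<and> nesting_depth \<phi> \<le> j"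

text \<open>With \<open>S\<close> constantly true this is parsing, with \<open>S\<close> the
  satisfaction by a type it is evaluation; one analysis of the leading letters serves both.\<close>

definition form_at :: "nat \<Rightarrow> nat \<Rightarrow> bool list \<Rightarrow> nat \<Rightarrow> (form \<Rightarrow> bool) \<Rightarrow> nat \<Rightarrow> nat \<Rightarrow> bool" where
  "form_at a n x j S p q \<longleftrightarrow> (\<exists>\<phi>. form_ok a n j \<phi> \<and> spells x p q (enc_form \<phi>) \<and> S \<phi>)"

text \<open>The unary tags \<open>0\<close> to \<open>3\<close> are the words F, TF, TTF and TTTF.
  An atom \<open>c\<close> takes \<open>c + 2\<close> letters, so \<open>c\<close> is
  \<open>q - (p + 2)\<close>; the agent \<open>i\<close> of a knowledge formula ends before
  \<open>p + 5 + i\<close>. Split points of a disjunction lie strictly inside because no code is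
  empty.\<close>

definition form_rule ::
  "nat \<Rightarrow> nat \<Rightarrow> (nat \<Rightarrow> bool) \<Rightarrow> (nat \<Rightarrow> nat \<Rightarrow> bool) \<Rightarrow> (nat \<Rightarrow> nat \<Rightarrow> nat \<Rightarrow> bool) \<Rightarrow>
    (nat \<Rightarrow> nat \<Rightarrow> nat \<Rightarrow> bool) \<Rightarrow> nat \<Rightarrow> nat \<Rightarrow> bool" where
  "form_rule a X atom neg dj know p q \<longleftrightarrow>
     p + 2 \<le> q \<and> \<not> bit X p \<and> (\<forall>r<q - (p + 2). bit X (p + 1 + r)) \<and> \<not> bit X (q - 1) \<and>
       atom (q - (p + 2)) \<or>
     p + 2 \<le> q \<and> bit X p \<and> \<not> bit X (p + 1) \<and> neg (p + 2) q \<or>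
     bit X p \<and> bit X (p + 1) \<and> \<not> bit X (p + 2) \<and> (\<exists>r<q. p + 3 < r \<and> dj (p + 3) r q) \<or>
     bit X p \<and> bit X (p + 1) \<and> bit X (p + 2) \<and> \<not> bit X (p + 3) \<and>
       (\<exists>i<a. p + 5 + i \<le> q \<and> (\<forall>r<i. bit X (p + 4 + r)) \<and> \<not> bit X (p + 4 + i) \<and>
          know i (p + 5 + i) q)"

lemma ex_form:
  "(\<exists>\<phi>. P \<phi>) \<longleftrightarrow> (\<exists>c. P (Atom c)) \<or> (\<exists>\<phi>. P (Neg \<phi>)) \<or> (\<exists>\<phi> \<psi>. P (Or \<phi> \<psi>)) \<or> (\<exists>i \<phi>. P (Know i \<phi>))"
  by (metis form.exhaust)

lemma form_at_iff_rule:
  assumes le: "p \<le> length x" "q \<le> length x"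
    and atom: "\<And>c. atom c \<longleftrightarrow> c < n \<and> S (Atom c)"
    and neg: "\<And>p q. neg p q \<longleftrightarrow> (\<exists>\<phi>. form_ok a n j \<phi> \<and> spells x p q (enc_form \<phi>) \<and> S (Neg \<phi>))"
    and dj: "\<And>p r q. dj p r q \<longleftrightarrow> (\<exists>\<phi> \<psi>. form_ok a n j \<phi> \<and> form_ok a n j \<psi> \<and>
      spells x p r (enc_form \<phi>) \<and> spells x r q (enc_form \<psi>) \<and> S (Or \<phi> \<psi>))"
    and know: "\<And>i p q. know i p q \<longleftrightarrow> (\<exists>\<phi>. in_language a n \<phi> \<and> Suc (nesting_depth \<phi>) \<le> j \<and>
      spells x p q (enc_form \<phi>) \<and> S (Know i \<phi>))"
  shows "form_at a n x j S p q \<longleftrightarrow> form_rule a (num x) atom neg dj know p q"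
proof -
  let ?F = "\<lambda>\<phi>. form_ok a n j \<phi> \<and> spells x p q (enc_form \<phi>) \<and> S \<phi>"
  have e: "enc_form (Atom c) = False # enc_nat c" "enc_form (Neg \<phi>) = True # False # enc_form \<phi>"
    "enc_form (Or \<phi> \<psi>) = True # True # False # enc_form \<phi> @ enc_form \<psi>"
    "enc_form (Know i \<phi>) = True # True # True # False # enc_nat i @ enc_form \<phi>" for c \<phi> \<psi> i
    by (simp_all add: enc_nat_def eval_nat_numeral)
  have 1: "(\<exists>c. ?F (Atom c)) \<longleftrightarrow> p + 2 \<le> q \<and> \<not> bit (num x) p \<and>
      (\<forall>r<q - (p + 2). bit (num x) (p + 1 + r)) \<and> \<not> bit (num x) (q - 1) \<and> atom (q - (p + 2))"
    (is "?l \<longleftrightarrow> ?r")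
  proof
    assume ?l
    then show ?r
      by (auto simp: e spells_enc_nat bit_num form_ok_def atom simp del: enc_form.simps)
  next
    assume ?r
    moreover from this obtain c where "q = p + 2 + c"
      using le_Suc_ex by blast
    ultimately have "?F (Atom c)"
      using le by (auto simp: e spells_enc_nat bit_num form_ok_def atom simp del: enc_form.simps)
    then show ?l
      by blast
  qed
  have s2: "spells x p q (enc_form (Neg \<phi>)) \<longleftrightarrow> p + 1 < length x \<and> x ! p \<and> \<not> x ! (p + 1) \<and>
      spells x (p + 2) q (enc_form \<phi>)" for \<phi>
    unfolding e by auto
  have 2: "(\<exists>\<phi>. ?F (Neg \<phi>)) \<longleftrightarrow> p + 2 \<le> q \<and> bit (num x) p \<and> \<not> bit (num x) (p + 1) \<and> neg (p + 2) q"
    (is "?l \<longleftrightarrow> ?r")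
  proof
    assume ?l
    then obtain \<phi> where F: "?F (Neg \<phi>)"
      by blast
    then have *: "p + 1 < length x" "x ! p" "\<not> x ! (p + 1)" "spells x (p + 2) q (enc_form \<phi>)"
      unfolding s2 by blast+
    then have "p + 2 \<le> q"
      using spells_le by blast
    moreover have "neg (p + 2) q"
      using F * unfolding neg by (auto simp: form_ok_def)
    ultimately show ?r
      using * by (simp add: bit_num)
  next
    assume r: ?r
    then obtain \<phi> where "form_ok a n j \<phi>" "spells x (p + 2) q (enc_form \<phi>)" "S (Neg \<phi>)"
      using neg by blast
    moreover have "p + 1 < length x" "x ! p" "\<not> x ! (p + 1)"
      using r le by (simp_all add: bit_num)
    ultimately have "?F (Neg \<phi>)"
      unfolding s2 by (simp add: form_ok_def)
    then show ?l
      by blast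
  qed
  have s3: "spells x p q (enc_form (Or \<phi> \<psi>)) \<longleftrightarrow> p + 2 < length x \<and> x ! p \<and> x ! (p + 1) \<and> \<not> x ! (p + 2) \<and>
      (\<exists>r. spells x (p + 3) r (enc_form \<phi>) \<and> spells x r q (enc_form \<psi>))" for \<phi> \<psi>
    unfolding e by (auto simp: spells_append eval_nat_numeral)
  have s4: "spells x p q (enc_form (Know i \<phi>)) \<longleftrightarrow> p + 3 < length x \<and> x ! p \<and> x ! (p + 1) \<and> x ! (p + 2) \<and>
      \<not> x ! (p + 3) \<and> p + 5 + i \<le> length x \<and> (\<forall>r<i. x ! (p + 4 + r)) \<and> \<not> x ! (p + 4 + i) \<and>
      spells x (p + 5 + i) q (enc_form \<phi>)" for i \<phi>
    unfolding e by (auto simp: spells_append spells_enc_nat eval_nat_numeral)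
  have 3: "(\<exists>\<phi> \<psi>. ?F (Or \<phi> \<psi>)) \<longleftrightarrow> bit (num x) p \<and> bit (num x) (p + 1) \<and> \<not> bit (num x) (p + 2) \<and>
      (\<exists>r<q. p + 3 < r \<and> dj (p + 3) r q)" (is "?l \<longleftrightarrow> ?r")
  proof
    assume ?l
    then obtain \<phi> \<psi> where F: "?F (Or \<phi> \<psi>)"
      by blast
    then obtain r where r: "spells x (p + 3) r (enc_form \<phi>)" "spells x r q (enc_form \<psi>)"
      unfolding s3 by blast
    then have "p + 3 < r" "r < q"
      using enc_form_nonempty[of \<phi>] enc_form_nonempty[of \<psi>] unfolding spells_def by linarith+
    moreover have "form_ok a n j \<phi>" "form_ok a n j \<psi>"
      using F by (simp_all add: form_ok_def)
    then have "dj (p + 3) r q"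
      using F r dj by blast
    moreover have "p + 2 < length x" "x ! p" "x ! (p + 1)" "\<not> x ! (p + 2)"
      using F unfolding s3 by blast+
    ultimately show ?r
      by (auto simp: bit_num)
  next
    assume r: ?r
    then obtain r where r': "r < q" "p + 3 < r" "dj (p + 3) r q"
      by blast
    then obtain \<phi> \<psi> where "form_ok a n j \<phi>" "form_ok a n j \<psi>" "S (Or \<phi> \<psi>)" and
        *: "spells x (p + 3) r (enc_form \<phi>)" "spells x r q (enc_form \<psi>)"
      using dj by blast
    moreover have "p + 2 < length x" "x ! p" "x ! (p + 1)" "\<not> x ! (p + 2)"
      using r r' le by (simp_all add: bit_num)
    ultimately have "?F (Or \<phi> \<psi>)"
      unfolding s3 by (auto simp: form_ok_def)
    then show ?l
      by blast
  qed
  have 4: "(\<exists>i \<phi>. ?F (Know i \<phi>)) \<longleftrightarrow>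
     bit (num x) p \<and> bit (num x) (p + 1) \<and> bit (num x) (p + 2) \<and> \<not> bit (num x) (p + 3) \<and>
       (\<exists>i<a. p + 5 + i \<le> q \<and> (\<forall>r<i. bit (num x) (p + 4 + r)) \<and> \<not> bit (num x) (p + 4 + i) \<and>
          know i (p + 5 + i) q)" (is "?l \<longleftrightarrow> ?r")
  proof
    assume ?l
    then obtain i \<phi> where F: "?F (Know i \<phi>)"
      by blast
    then have *: "p + 3 < length x" "x ! p" "x ! (p + 1)" "x ! (p + 2)" "\<not> x ! (p + 3)" "p + 5 + i \<le> length x"
        "\<forall>r<i. x ! (p + 4 + r)" "\<not> x ! (p + 4 + i)" "spells x (p + 5 + i) q (enc_form \<phi>)"
      unfolding s4 by blast+
    then have "p + 5 + i \<le> q"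
      using spells_le by blast
    moreover have "know i (p + 5 + i) q" "i < a"
      using F * unfolding know by (auto simp: form_ok_def)
    ultimately show ?r
      using * by (auto simp: bit_num)
  next
    assume r: ?r
    then obtain i where i: "i < a" "p + 5 + i \<le> q" "\<forall>r<i. bit (num x) (p + 4 + r)"
        "\<not> bit (num x) (p + 4 + i)" "know i (p + 5 + i) q"
      by blast
    then obtain \<phi> where "in_language a n \<phi>" "Suc (nesting_depth \<phi>) \<le> j"
        "spells x (p + 5 + i) q (enc_form \<phi>)" "S (Know i \<phi>)"
      using know by blast
    moreover have "p + 3 < length x" "x ! p" "x ! (p + 1)" "x ! (p + 2)" "\<not> x ! (p + 3)"
        "p + 5 + i \<le> length x" "\<forall>r<i. x ! (p + 4 + r)" "\<not> x ! (p + 4 + i)"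
      using r i le by (simp_all add: bit_num)
    ultimately have "?F (Know i \<phi>)"
      unfolding s4 using i(1) by (simp add: form_ok_def)
    then show ?l
      by blast
  qed
  have "form_at a n x j S p q \<longleftrightarrow>
      (\<exists>c. ?F (Atom c)) \<or> (\<exists>\<phi>. ?F (Neg \<phi>)) \<or> (\<exists>\<phi> \<psi>. ?F (Or \<phi> \<psi>)) \<or> (\<exists>i \<phi>. ?F (Know i \<phi>))"
    unfolding form_at_def by (rule ex_form)
  also have "\<dots> \<longleftrightarrow> form_rule a (num x) atom neg dj know p q"
    unfolding form_rule_def 1 2 3 4 by (rule refl)
  finally show ?thesis .
qed

section \<open>Relations on positions given by tables\<close>

lemma bit_num_map: "bit (num (map g [0..<l])) i \<longleftrightarrow> i < l \<and> g i"
  by (auto simp: bit_num)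

text \<open>Positions range over \<open>0\<close> to \<open>L\<close>, so a row has
  \<open>Suc L\<close> entries.\<close>

definition entry :: "nat \<Rightarrow> nat \<Rightarrow> nat \<Rightarrow> nat \<Rightarrow> bool" where
  "entry L t p q \<longleftrightarrow> bit t (p * Suc L + q)"

text \<open>A relation on positions that is defined by well-founded recursion on \<open>q - p\<close> is the only one
  whose table satisfies the recursive equation. Tables are numbers below \<open>U\<close>.\<close>

definition by_table ::
  "nat \<Rightarrow> nat \<Rightarrow> ((nat \<Rightarrow> nat \<Rightarrow> bool) \<Rightarrow> nat \<Rightarrow> nat \<Rightarrow> bool) \<Rightarrow> nat \<Rightarrow> nat \<Rightarrow> bool" where
  "by_table U L G p q \<longleftrightarrow> p \<le> L \<and> q \<le> L \<and>
     (\<exists>t<U. (\<forall>p<Suc L. \<forall>q<Suc L. entry L t p q \<longleftrightarrow> G (entry L t) p q) \<and> entry L t p q)"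

definition table_bound :: "nat \<Rightarrow> nat" where
  "table_bound L = 2 ^ (Suc L * Suc L)"

text \<open>The table of \<open>S\<close> itself is a solution below \<open>U\<close>. Any other
  solution agrees with it by induction on \<open>q - p\<close>, because \<open>cong\<close> says
  that \<open>G\<close> consults only shorter intervals; \<open>cong\<close> is an implication and
  is applied in both directions.\<close>

lemma by_table_iff:
  assumes U: "U = table_bound L"
    and fixp: "\<And>p q. p \<le> L \<Longrightarrow> q \<le> L \<Longrightarrow> S p q \<longleftrightarrow> G S p q"
    and cong: "\<And>f g p q. p \<le> L \<Longrightarrow> q \<le> L \<Longrightarrow>
      (\<And>p' q'. p' \<le> L \<Longrightarrow> q' \<le> L \<Longrightarrow> q' - p' < q - p \<Longrightarrow> f p' q' = g p' q') \<Longrightarrow> G f p q \<Longrightarrow> G g p q"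
  shows "by_table U L G p q \<longleftrightarrow> p \<le> L \<and> q \<le> L \<and> S p q"
proof -
  have unique: "entry L t p q \<longleftrightarrow> S p q"
    if t: "\<forall>p<Suc L. \<forall>q<Suc L. entry L t p q \<longleftrightarrow> G (entry L t) p q" and "p \<le> L" "q \<le> L" for t p q
    using that(2,3)
  proof (induction "q - p" arbitrary: p q rule: less_induct)
    case less
    have "G (entry L t) p q \<longleftrightarrow> G S p q"
      using cong[of p q "entry L t" S] cong[of p q S "entry L t"] less by blast
    then show ?case
      using t fixp less.prems by (simp add: less_Suc_eq_le)
  qed
  define t where "t = num (map (\<lambda>i. S (i div Suc L) (i mod Suc L)) [0..<Suc L * Suc L])"
  have "t < U"
    using num_less[of "map (\<lambda>i. S (i div Suc L) (i mod Suc L)) [0..<Suc L * Suc L]"]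
    by (simp add: t_def U table_bound_def)
  have t: "entry L t p q \<longleftrightarrow> S p q" if "p \<le> L" "q \<le> L" for p q
  proof -
    have "p * Suc L \<le> L * Suc L"
      using that by (intro mult_le_mono1)
    then have "p * Suc L + q < Suc L * Suc L"
      using that by simp
    moreover have "(p * Suc L + q) div Suc L = p" "(p * Suc L + q) mod Suc L = q"
      using that by (simp_all del: mult_Suc_right add: div_add1_eq[of "p * Suc L"] mod_add_eq less_Suc_eq_le)
    ultimately show ?thesis
      unfolding entry_def t_def bit_num_map by (simp only: simp_thms)
  qed
  have "G (entry L t) p q \<longleftrightarrow> G S p q" if "p \<le> L" "q \<le> L" for p q
    using cong[OF that, of "entry L t" S] cong[OF that, of S "entry L t"] t by blast
  then have "\<forall>p<Suc L. \<forall>q<Suc L. entry L t p q \<longleftrightarrow> G (entry L t) p q"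
    using t fixp by (simp add: less_Suc_eq_le)
  then show ?thesis
    unfolding by_table_def using \<open>t < U\<close> t unique by blast
qed

lemma form_rule_mono:
  assumes "form_rule a X atom neg dj know p q"
    and "p + 2 \<le> q \<Longrightarrow> neg (p + 2) q \<Longrightarrow> neg' (p + 2) q"
    and "\<And>r. r < q \<Longrightarrow> p + 3 < r \<Longrightarrow> dj (p + 3) r q \<Longrightarrow> dj' (p + 3) r q"
  shows "form_rule a X atom neg' dj' know p q"
  using assms unfolding form_rule_def by blast

text \<open>The knowledge case refers to the completed level below instead of the table, since the
  depth drops there; at level \<open>0\<close> it fails.\<close>

fun is_form :: "nat \<Rightarrow> nat \<Rightarrow> nat \<Rightarrow> nat \<Rightarrow> nat \<Rightarrow> nat \<Rightarrow> nat \<Rightarrow> nat \<Rightarrow> bool" where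
  "is_form a X L U n 0 p q = by_table U L
     (\<lambda>f. form_rule a X (\<lambda>c. c < n) f (\<lambda>p r q. f p r \<and> f r q) (\<lambda>i p q. False)) p q"
| "is_form a X L U n (Suc j) p q = by_table U L
     (\<lambda>f. form_rule a X (\<lambda>c. c < n) f (\<lambda>p r q. f p r \<and> f r q) (\<lambda>i p q. is_form a X L U n j p q)) p q"

declare is_form.simps [simp del]

lemma form_at_le: "form_at a n x j S p q \<Longrightarrow> p \<le> length x \<and> q \<le> length x"
  unfolding form_at_def using spells_le le_trans by blast

lemma is_form_iff:
  assumes U: "U = table_bound (length x)"
  shows "is_form a (num x) (length x) U n j p q \<longleftrightarrow> form_at a n x j (\<lambda>_. True) p q"
proof (induction j arbitrary: p q)
  case 0
  let ?S = "form_at a n x 0 (\<lambda>_. True)"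
  have "is_form a (num x) (length x) U n 0 p q \<longleftrightarrow> p \<le> length x \<and> q \<le> length x \<and> ?S p q"
    unfolding is_form.simps
  proof (rule by_table_iff[OF U])
    show "?S p q \<longleftrightarrow> form_rule a (num x) (\<lambda>c. c < n) ?S (\<lambda>p r q. ?S p r \<and> ?S r q) (\<lambda>i p q. False) p q"
      if "p \<le> length x" "q \<le> length x" for p q
      using that by (intro form_at_iff_rule) (auto simp: form_at_def)
  qed (erule form_rule_mono, auto)
  then show ?case
    using form_at_le by blast
next
  case (Suc j)
  let ?S = "form_at a n x (Suc j) (\<lambda>_. True)"
  have "is_form a (num x) (length x) U n (Suc j) p q \<longleftrightarrow> p \<le> length x \<and> q \<le> length x \<and> ?S p q"
    unfolding is_form.simps Suc
  proof (rule by_table_iff[OF U])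
    show "?S p q \<longleftrightarrow> form_rule a (num x) (\<lambda>c. c < n) ?S (\<lambda>p r q. ?S p r \<and> ?S r q)
        (\<lambda>i. form_at a n x j (\<lambda>_. True)) p q"
      if "p \<le> length x" "q \<le> length x" for p q
      using that by (intro form_at_iff_rule) (auto simp: form_at_def form_ok_def)
  qed (erule form_rule_mono, auto)
  then show ?case
    using form_at_le by blast
qed

text \<open>A type of level \<open>j\<close> is a number below \<open>tower a L j\<close>. Its bits below \<open>L\<close> are the truth values of the
  propositions; at level \<open>j + 1\<close>, bit \<open>L + i * tower a L j + \<sigma>\<close> says whether agent \<open>i\<close> considers a world
  of type \<open>\<sigma>\<close> possible.\<close>

primrec type_sat :: "nat \<Rightarrow> nat \<Rightarrow> form \<Rightarrow> nat \<Rightarrow> nat \<Rightarrow> bool" where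
  "type_sat a L (Atom p) j \<tau> = bit \<tau> p"
| "type_sat a L (Neg \<phi>) j \<tau> = (\<not> type_sat a L \<phi> j \<tau>)"
| "type_sat a L (Or \<phi> \<psi>) j \<tau> = (type_sat a L \<phi> j \<tau> \<or> type_sat a L \<psi> j \<tau>)"
| "type_sat a L (Know i \<phi>) j \<tau> = (case j of 0 \<Rightarrow> False | Suc j \<Rightarrow>
     \<forall>\<sigma><tower a L j. bit \<tau> (L + i * tower a L j + \<sigma>) \<longrightarrow> type_sat a L \<phi> j \<sigma>)"

text \<open>A \<open>False\<close> entry may mean a false formula or no formula at all, hence the
  \<open>is_form\<close> guards for negation and disjunction. In the knowledge case the guard covers
  an empty range of successor types.\<close>

fun type_holds :: "nat \<Rightarrow> nat \<Rightarrow> nat \<Rightarrow> nat \<Rightarrow> nat \<Rightarrow> nat \<Rightarrow> nat \<Rightarrow> nat \<Rightarrow> nat \<Rightarrow> bool" where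
  "type_holds a X L U n 0 \<tau> p q = by_table U L
     (\<lambda>f. form_rule a X (\<lambda>c. c < n \<and> bit \<tau> c)
        (\<lambda>p q. is_form a X L U n 0 p q \<and> \<not> f p q)
        (\<lambda>p r q. is_form a X L U n 0 p r \<and> is_form a X L U n 0 r q \<and> (f p r \<or> f r q))
        (\<lambda>i p q. False)) p q"
| "type_holds a X L U n (Suc j) \<tau> p q = by_table U L
     (\<lambda>f. form_rule a X (\<lambda>c. c < n \<and> bit \<tau> c)
        (\<lambda>p q. is_form a X L U n (Suc j) p q \<and> \<not> f p q)
        (\<lambda>p r q. is_form a X L U n (Suc j) p r \<and> is_form a X L U n (Suc j) r q \<and> (f p r \<or> f r q))
        (\<lambda>i p q. is_form a X L U n j p q \<and> (\<forall>\<sigma><tower a L j. bit \<tau> (L + i * tower a L j + \<sigma>) \<longrightarrow>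
           type_holds a X L U n j \<sigma> p q))) p q"

declare type_holds.simps [simp del]

lemma form_at_neg:
  "form_at a n x j (\<lambda>_. True) p q \<and> \<not> form_at a n x j S p q \<longleftrightarrow>
    (\<exists>\<phi>. form_ok a n j \<phi> \<and> spells x p q (enc_form \<phi>) \<and> \<not> S \<phi>)"
  unfolding form_at_def using spells_form_unique(1) by blast

lemma form_at_disj:
  "form_at a n x j (\<lambda>_. True) p r \<and> form_at a n x j (\<lambda>_. True) r q \<and>
     (form_at a n x j S p r \<or> form_at a n x j S r q) \<longleftrightarrow>
    (\<exists>\<phi> \<psi>. form_ok a n j \<phi> \<and> form_ok a n j \<psi> \<and> spells x p r (enc_form \<phi>) \<and>
       spells x r q (enc_form \<psi>) \<and> (S \<phi> \<or> S \<psi>))"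
  unfolding form_at_def by blast

text \<open>Unique parsing lets the universal quantifier over types move inside the choice of the
  formula; the first conjunct supplies the formula if no type satisfies \<open>b\<close>.\<close>

lemma form_at_all:
  "form_at a n x j (\<lambda>_. True) p q \<and> (\<forall>\<sigma><T. b \<sigma> \<longrightarrow> form_at a n x j (S \<sigma>) p q) \<longleftrightarrow>
    (\<exists>\<phi>. form_ok a n j \<phi> \<and> spells x p q (enc_form \<phi>) \<and> (\<forall>\<sigma><T. b \<sigma> \<longrightarrow> S \<sigma> \<phi>))"
  unfolding form_at_def using spells_form_unique(1) by blast

lemma type_holds_iff:
  assumes U: "U = table_bound (length x)"
  shows "type_holds a (num x) (length x) U n j \<tau> p q \<longleftrightarrow>
    form_at a n x j (\<lambda>\<phi>. type_sat a (length x) \<phi> j \<tau>) p q"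
proof (induction j arbitrary: \<tau> p q)
  case 0
  let ?S = "form_at a n x 0 (\<lambda>\<phi>. type_sat a (length x) \<phi> 0 \<tau>)" and ?I = "form_at a n x 0 (\<lambda>_. True)"
  have "type_holds a (num x) (length x) U n 0 \<tau> p q \<longleftrightarrow> p \<le> length x \<and> q \<le> length x \<and> ?S p q"
    unfolding type_holds.simps is_form_iff[OF U]
  proof (rule by_table_iff[OF U])
    show "?S p q \<longleftrightarrow> form_rule a (num x) (\<lambda>c. c < n \<and> bit \<tau> c) (\<lambda>p q. ?I p q \<and> \<not> ?S p q)
        (\<lambda>p r q. ?I p r \<and> ?I r q \<and> (?S p r \<or> ?S r q)) (\<lambda>i p q. False) p q"
      if "p \<le> length x" "q \<le> length x" for p q
      using that by (intro form_at_iff_rule) (simp_all only: form_at_neg form_at_disj, simp_all)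
  qed (erule form_rule_mono, auto)
  then show ?case
    using form_at_le by blast
next
  case (Suc j)
  let ?S = "form_at a n x (Suc j) (\<lambda>\<phi>. type_sat a (length x) \<phi> (Suc j) \<tau>)"
    and ?I = "form_at a n x (Suc j) (\<lambda>_. True)" and ?T = "tower a (length x) j"
  have "type_holds a (num x) (length x) U n (Suc j) \<tau> p q \<longleftrightarrow> p \<le> length x \<and> q \<le> length x \<and> ?S p q"
    unfolding type_holds.simps is_form_iff[OF U] Suc
  proof (rule by_table_iff[OF U])
    show "?S p q \<longleftrightarrow> form_rule a (num x) (\<lambda>c. c < n \<and> bit \<tau> c) (\<lambda>p q. ?I p q \<and> \<not> ?S p q)
        (\<lambda>p r q. ?I p r \<and> ?I r q \<and> (?S p r \<or> ?S r q))
        (\<lambda>i p q. form_at a n x j (\<lambda>_. True) p q \<and> (\<forall>\<sigma><?T. bit \<tau> (length x + i * ?T + \<sigma>) \<longrightarrow>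
           form_at a n x j (\<lambda>\<phi>. type_sat a (length x) \<phi> j \<sigma>) p q)) p q"
      if "p \<le> length x" "q \<le> length x" for p q
      using that by (intro form_at_iff_rule) (simp_all only: form_at_neg form_at_disj form_at_all, simp_all add: form_ok_def conj_assoc)
  qed (erule form_rule_mono, auto)
  then show ?case
    using form_at_le by blast
qed

section \<open>Reading an encoded instance\<close>

definition nat_at :: "nat \<Rightarrow> nat \<Rightarrow> nat \<Rightarrow> nat" where
  "nat_at X L p = bleast L (\<lambda>j. \<not> bit X (p + j))"

lemma nat_at_eq: "spells x p q (enc_nat c) \<Longrightarrow> nat_at (num x) (length x) p = c"
  unfolding nat_at_def by (rule bleast_eqI) (auto simp: spells_enc_nat bit_num)

text \<open>Bits beyond the word are zero, so reading may also stop at the end of the word; the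
  assumption makes the final zero a genuine letter.\<close>

lemma spells_nat_at:
  assumes "p + nat_at (num x) (length x) p < length x"
  shows "spells x p (p + nat_at (num x) (length x) p + 1) (enc_nat (nat_at (num x) (length x) p))"
  using assms bleast_holds[of "length x" "\<lambda>j. \<not> bit (num x) (p + j)"]
    bleast_min[of _ "length x" "\<lambda>j. \<not> bit (num x) (p + j)"]
  unfolding nat_at_def[symmetric] by (auto simp: spells_enc_nat bit_num)

text \<open>The definitions up to \<open>pos_goal\<close> mirror the order of the blocks in
  \<open>enc_instance\<close>. They are total: on other words they return some number, and
  \<open>valid\<close> sorts these words out.\<close>

definition rd_props :: "nat \<Rightarrow> nat \<Rightarrow> nat" where
  "rd_props X L = nat_at X L 0"

definition rd_worlds :: "nat \<Rightarrow> nat \<Rightarrow> nat" where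
  "rd_worlds X L = nat_at X L (rd_props X L + 1)"

definition pos_rel :: "nat \<Rightarrow> nat \<Rightarrow> nat" where
  "pos_rel X L = rd_props X L + 1 + rd_worlds X L + 1"

definition pos_val :: "nat \<Rightarrow> nat \<Rightarrow> nat \<Rightarrow> nat" where
  "pos_val a X L = pos_rel X L + a * (rd_worlds X L * rd_worlds X L)"

definition pos_point :: "nat \<Rightarrow> nat \<Rightarrow> nat \<Rightarrow> nat" where
  "pos_point a X L = pos_val a X L + rd_props X L * rd_worlds X L"

definition rd_point :: "nat \<Rightarrow> nat \<Rightarrow> nat \<Rightarrow> nat" where
  "rd_point a X L = nat_at X L (pos_point a X L)"

definition pos_events :: "nat \<Rightarrow> nat \<Rightarrow> nat \<Rightarrow> nat" where
  "pos_events a X L = pos_point a X L + rd_point a X L + 1"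

definition rd_events :: "nat \<Rightarrow> nat \<Rightarrow> nat \<Rightarrow> nat" where
  "rd_events a X L = nat_at X L (pos_events a X L)"

definition pos_erel :: "nat \<Rightarrow> nat \<Rightarrow> nat \<Rightarrow> nat" where
  "pos_erel a X L = pos_events a X L + rd_events a X L + 1"

definition pos_forms :: "nat \<Rightarrow> nat \<Rightarrow> nat \<Rightarrow> nat" where
  "pos_forms a X L = pos_erel a X L + a * (rd_events a X L * rd_events a X L)"

text \<open>All pre- and postconditions form one sequence, the precondition of event
  \<open>e\<close> at index \<open>e * (n + 1)\<close> followed by its \<open>n\<close>
  postconditions. The end of a formula is found by search; if there is none the result is
  \<open>Suc L\<close>, a position outside the word.\<close>

definition pos_form :: "nat \<Rightarrow> nat \<Rightarrow> nat \<Rightarrow> nat \<Rightarrow> nat \<Rightarrow> nat" where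
  "pos_form a X L U c = rec_nat (pos_forms a X L)
     (\<lambda>_ p. bleast (Suc L) (\<lambda>q. is_form a X L U (rd_props X L) 0 p q)) c"

definition pos_allowed :: "nat \<Rightarrow> nat \<Rightarrow> nat \<Rightarrow> nat \<Rightarrow> nat" where
  "pos_allowed a X L U = pos_form a X L U (rd_events a X L * (rd_props X L + 1))"

definition pos_goal :: "nat \<Rightarrow> nat \<Rightarrow> nat \<Rightarrow> nat \<Rightarrow> nat" where
  "pos_goal a X L U = pos_allowed a X L U + rd_events a X L"

text \<open>Any bits are legal in the blocks for relations, valuations and allowed events, so only
  the point and the formulas are checked. The goal has to end with the word, which forces all
  earlier blocks to fit in. Depth exactly \<open>k\<close> means parsing at level \<open>k\<close>
  but not at level \<open>k - 1\<close>.\<close>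

definition valid :: "nat \<Rightarrow> nat \<Rightarrow> nat \<Rightarrow> nat \<Rightarrow> nat \<Rightarrow> bool" where
  "valid a k X L U \<longleftrightarrow> rd_point a X L < rd_worlds X L \<and>
     (\<forall>c<rd_events a X L * (rd_props X L + 1).
        is_form a X L U (rd_props X L) 0 (pos_form a X L U c) (pos_form a X L U (Suc c))) \<and>
     is_form a X L U (rd_props X L) k (pos_goal a X L U) L \<and>
     (k = 0 \<or> \<not> is_form a X L U (rd_props X L) (k - 1) (pos_goal a X L U) L)"

section \<open>Blocks of an encoding and their positions\<close>

lemma concat_blocks:
  assumes "\<And>i. i < a \<Longrightarrow> F i = map (g i) [0..<l]"
  shows "concat (map F [0..<a]) = map (\<lambda>r. g (r div l) (r mod l)) [0..<a * l]"
  using assms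
proof (induction a)
  case (Suc a)
  have "[0..<Suc a * l] = [0..<a * l] @ map (\<lambda>r. a * l + r) [0..<l]"
    using upt_add_eq_append[of 0 "a * l" l] by (simp add: map_add_upt add.commute)
  then have "map (\<lambda>r. g (r div l) (r mod l)) [0..<Suc a * l] =
      map (\<lambda>r. g (r div l) (r mod l)) [0..<a * l] @ map (g a) [0..<l]"
    by (simp del: mult_Suc)
  then show ?case
    using Suc by simp
qed simp

lemma enc_rel_eq_map: "enc_rel N f R = map (\<lambda>r. (f (r div N), f (r mod N)) \<in> R) [0..<N * N]"
proof -
  have "enc_rel N f R = concat (map (\<lambda>v. map (\<lambda>w. (f v, f w) \<in> R) [0..<N]) [0..<N])"
    by (simp add: enc_rel_def product_concat_map map_concat comp_def)
  also have "\<dots> = map (\<lambda>r. (f (r div N), f (r mod N)) \<in> R) [0..<N * N]"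
    by (rule concat_blocks) simp
  finally show ?thesis .
qed

lemma concat_enc_rel:
  "concat (map (\<lambda>i. enc_rel N f (R i)) [0..<a]) =
    map (\<lambda>r. (f (r mod (N * N) div N), f (r mod (N * N) mod N)) \<in> R (r div (N * N))) [0..<a * (N * N)]"
  by (rule concat_blocks) (simp add: enc_rel_eq_map)

lemma concat_enc_set:
  "concat (map (\<lambda>p. enc_set N f (V p)) [0..<n]) = map (\<lambda>r. f (r mod N) \<in> V (r div N)) [0..<n * N]"
  by (rule concat_blocks) (simp add: enc_set_def)

lemma concat_enc_forms:
  "concat (map (\<lambda>e. G (e * (n + 1)) @ concat (map (\<lambda>p. G (e * (n + 1) + 1 + p)) [0..<n])) [0..<m]) =
    concat (map G [0..<m * (n + 1)])"
proof (induction m)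
  case (Suc m)
  have "[0..<Suc m * (n + 1)] = [0..<m * (n + 1)] @ [m * (n + 1)..<m * (n + 1) + (n + 1)]"
    using upt_add_eq_append[of 0 "m * (n + 1)" "n + 1"] by (simp only: mult_Suc add.commute zero_le simp_thms)
  also have "[s..<s + (n + 1)] = s # map (\<lambda>p. s + 1 + p) [0..<n]" for s
    by (induction n) auto
  finally have "concat (map G [0..<Suc m * (n + 1)]) = concat (map G [0..<m * (n + 1)]) @
      G (m * (n + 1)) @ concat (map (\<lambda>p. G (m * (n + 1) + 1 + p)) [0..<n])"
    by (simp add: comp_def del: mult_Suc)
  then show ?case
    using Suc by simp
qed simp

lemma pair_index:
  fixes v w N :: nat
  assumes "v < N" "w < N"
  shows "v * N + w < N * N" "(v * N + w) div N = v" "(v * N + w) mod N = w"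
proof -
  have "v * N + w < v * N + N"
    using assms by simp
  also have "\<dots> = Suc v * N"
    by simp
  also have "\<dots> \<le> N * N"
    using assms by (intro mult_le_mono1) simp
  finally show "v * N + w < N * N" .
qed (use assms in auto)

lemma block_index:
  fixes i r l a :: nat
  assumes "i < a" "r < l"
  shows "i * l + r < a * l" "(i * l + r) div l = i" "(i * l + r) mod l = r"
proof -
  have "i * l + r < Suc i * l"
    using assms by simp
  also have "\<dots> \<le> a * l"
    using assms by (intro mult_le_mono1) simp
  finally show "i * l + r < a * l" .
qed (use assms in auto)

lemma bleast_is_form:
  assumes U: "U = table_bound (length x)"
    and "form_ok a n 0 \<phi>" "spells x p q (enc_form \<phi>)"
  shows "bleast (Suc (length x)) (\<lambda>q. is_form a (num x) (length x) U n 0 p q) = q"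
proof (rule bleast_eqI)
  show "q < Suc (length x)"
    using assms(3) spells_le by (auto simp: less_Suc_eq_le)
  show "is_form a (num x) (length x) U n 0 p q"
    using assms unfolding is_form_iff[OF U] form_at_def by blast
  show "\<not> is_form a (num x) (length x) U n 0 p j" if "j < q" for j
    using that assms(3) spells_form_unique(2) unfolding is_form_iff[OF U] form_at_def by blast
qed

lemma pos_form_Suc: "pos_form a X L U (Suc c) =
    bleast (Suc L) (\<lambda>q. is_form a X L U (rd_props X L) 0 (pos_form a X L U c) q)"
  by (simp add: pos_form_def)

lemma pos_form_spells:
  assumes U: "U = table_bound (length x)"
    and "\<And>c. c < C \<Longrightarrow> form_ok a (rd_props (num x) (length x)) 0 (fl c)"
    and "spells x (pos_forms a (num x) (length x)) q (concat (map (\<lambda>c. enc_form (fl c)) [0..<C]))"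
  shows "pos_form a (num x) (length x) U C = q \<and> (\<forall>c<C. spells x (pos_form a (num x) (length x) U c)
    (pos_form a (num x) (length x) U (Suc c)) (enc_form (fl c)))"
  using assms(2,3)
proof (induction C arbitrary: q)
  case 0
  then show ?case
    by (simp add: pos_form_def)
next
  case (Suc C)
  let ?P = "pos_form a (num x) (length x) U"
  obtain r where r: "spells x (pos_forms a (num x) (length x)) r (concat (map (\<lambda>c. enc_form (fl c)) [0..<C]))"
    "spells x r q (enc_form (fl C))"
    using Suc.prems(2) by (auto simp: spells_append)
  have IH: "?P C = r \<and> (\<forall>c<C. spells x (?P c) (?P (Suc c)) (enc_form (fl c)))"
    by (rule Suc.IH[OF Suc.prems(1) r(1)]) simp
  have "?P (Suc C) = q"
    unfolding pos_form_Suc using IH r(2) bleast_is_form[OF U Suc.prems(1)[of C]] by simp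
  then show ?case
    using IH r(2) by (auto simp: less_Suc_eq)
qed

locale encoded_instance =
  fixes a :: nat and I :: planning_instance and x :: "bool list"
  assumes wf: "wf_instance a I" and enc: "x = enc_instance a I"
begin

abbreviation "X \<equiv> num x"
abbreviation "L \<equiv> length x"
abbreviation "U \<equiv> table_bound L"
abbreviation "M \<equiv> init_model I"
abbreviation "E \<equiv> ev_model I"
abbreviation "n \<equiv> props I"
definition "N = card (worlds M)"
definition "m = card (events E)"

lemma worlds_eq: "worlds M = Base ` {..<N}"
  using wf by (auto simp: wf_instance_def wf_model_def N_def card_image inj_on_def)

lemma events_eq: "events E = {..<m}"
  using wf by (auto simp: wf_instance_def wf_prop_event_model_def m_def)

lemma propositional_iff: "propositional \<phi> \<longleftrightarrow> nesting_depth \<phi> = 0"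
  by (induction \<phi>) auto

lemma pre_ok: "e < m \<Longrightarrow> form_ok a n 0 (pre E e)"
  and post_ok: "e < m \<Longrightarrow> p < n \<Longrightarrow> form_ok a n 0 (post E e p)"
  and goal_ok: "form_ok a n (nesting_depth (goal_form I)) (goal_form I)"
  using wf events_eq
  by (auto simp: wf_instance_def wf_prop_event_model_def form_ok_def propositional_iff)

definition event_form :: "nat \<Rightarrow> form" where
  "event_form c = (if c mod (n + 1) = 0 then pre E (c div (n + 1))
     else post E (c div (n + 1)) (c mod (n + 1) - 1))"

lemma event_form_pre: "event_form (e * (n + 1)) = pre E e"
  by (simp add: event_form_def del: mult_Suc_right add_Suc_right add_0_right)

lemma event_form_post: "p < n \<Longrightarrow> event_form (e * (n + 1) + 1 + p) = post E e p"
proof -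
  assume "p < n"
  then have "(e * (n + 1) + (1 + p)) div (n + 1) = e" "(e * (n + 1) + (1 + p)) mod (n + 1) = 1 + p"
    using block_index[of e "Suc e" "1 + p" "n + 1"] by auto
  then show ?thesis
    by (simp only: event_form_def add.assoc) simp
qed

lemma event_form_ok: "c < m * (n + 1) \<Longrightarrow> form_ok a n 0 (event_form c)"
proof -
  assume "c < m * (n + 1)"
  then have "c div (n + 1) < m"
    by (simp add: less_mult_imp_div_less)
  moreover have "c mod (n + 1) - 1 < n" if "c mod (n + 1) \<noteq> 0"
    using that mod_less_divisor[of "n + 1" c] by linarith
  ultimately show ?thesis
    by (auto simp: event_form_def intro: pre_ok post_ok)
qed

lemma enc_event_forms:
  "concat (map (\<lambda>e. enc_form (pre E e) @ concat (map (\<lambda>p. enc_form (post E e p)) [0..<n])) [0..<m]) =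
    concat (map (\<lambda>c. enc_form (event_form c)) [0..<m * (n + 1)])"
proof -
  have "map (\<lambda>p. enc_form (post E e p)) [0..<n] = map (\<lambda>p. enc_form (event_form (e * (n + 1) + 1 + p))) [0..<n]" for e
    using event_form_post by (intro map_cong) auto
  then show ?thesis
    unfolding concat_enc_forms[of "\<lambda>c. enc_form (event_form c)", symmetric] event_form_pre by presburger
qed

lemma layout:
  shows rd_props_eq: "rd_props X L = n"
    and rd_worlds_eq: "rd_worlds X L = N"
    and rd_point_eq: "rd_point a X L = point I"
    and rd_events_eq: "rd_events a X L = m"
    and spells_rel: "spells x (pos_rel X L) (pos_val a X L) (concat (map (\<lambda>i. enc_rel N Base (rel M i)) [0..<a]))"
    and spells_val: "spells x (pos_val a X L) (pos_point a X L) (concat (map (\<lambda>p. enc_set N Base (val M p)) [0..<n]))"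
    and spells_erel: "spells x (pos_erel a X L) (pos_forms a X L) (concat (map (\<lambda>i. enc_rel m id (erel E i)) [0..<a]))"
    and spells_forms: "\<And>c. c < m * (n + 1) \<Longrightarrow>
      spells x (pos_form a X L U c) (pos_form a X L U (Suc c)) (enc_form (event_form c))"
    and spells_allowed: "spells x (pos_allowed a X L U) (pos_goal a X L U) (enc_set m id (allowed I))"
    and spells_goal: "spells x (pos_goal a X L U) L (enc_form (goal_form I))"
proof -
  have "spells x 0 L (enc_instance a I)"
    by (simp add: spells_all enc)
  then obtain q1 q2 q3 q4 q5 q6 q7 q8 q9 where
    1: "spells x 0 q1 (enc_nat n)" and
    2: "spells x q1 q2 (enc_nat N)" and
    3: "spells x q2 q3 (concat (map (\<lambda>i. enc_rel N Base (rel M i)) [0..<a]))" and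
    4: "spells x q3 q4 (concat (map (\<lambda>p. enc_set N Base (val M p)) [0..<n]))" and
    5: "spells x q4 q5 (enc_nat (point I))" and
    6: "spells x q5 q6 (enc_nat m)" and
    7: "spells x q6 q7 (concat (map (\<lambda>i. enc_rel m id (erel E i)) [0..<a]))" and
    8: "spells x q7 q8 (concat (map (\<lambda>c. enc_form (event_form c)) [0..<m * (n + 1)]))" and
    9: "spells x q8 q9 (enc_set m id (allowed I))" and
    10: "spells x q9 L (enc_form (goal_form I))"
    unfolding enc_instance_def enc_model_def enc_event_model_def Let_def N_def[symmetric] m_def[symmetric]
      enc_event_forms spells_append append_assoc by blast
  show n: "rd_props X L = n"
    unfolding rd_props_def by (rule nat_at_eq[OF 1])
  have q1: "q1 = n + 1"
    using 1 by (simp add: spells_def)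
  show N: "rd_worlds X L = N"
    unfolding rd_worlds_def n q1[symmetric] by (rule nat_at_eq[OF 2])
  have q2: "q2 = pos_rel X L"
    using 2 by (simp add: spells_def pos_rel_def n N q1)
  have q3: "q3 = pos_val a X L"
    using 3 by (simp add: spells_def pos_val_def N q2 concat_enc_rel)
  have q4: "q4 = pos_point a X L"
    using 4 by (simp add: spells_def pos_point_def N n q3 concat_enc_set)
  show pt: "rd_point a X L = point I"
    unfolding rd_point_def q4[symmetric] by (rule nat_at_eq[OF 5])
  have q5: "q5 = pos_events a X L"
    using 5 by (simp add: spells_def pos_events_def pt q4)
  show m: "rd_events a X L = m"
    unfolding rd_events_def q5[symmetric] by (rule nat_at_eq[OF 6])
  have q6: "q6 = pos_erel a X L"
    using 6 by (simp add: spells_def pos_erel_def m q5)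
  have q7: "q7 = pos_forms a X L"
    using 7 by (simp add: spells_def pos_forms_def m q6 concat_enc_rel)
  have forms: "pos_form a X L U (m * (n + 1)) = q8 \<and>
      (\<forall>c<m * (n + 1). spells x (pos_form a X L U c) (pos_form a X L U (Suc c)) (enc_form (event_form c)))"
    by (rule pos_form_spells[OF refl _ 8[unfolded q7]]) (simp add: n event_form_ok[simplified])
  then have q8: "q8 = pos_allowed a X L U"
    by (simp add: pos_allowed_def m n)
  have q9: "q9 = pos_goal a X L U"
    using 9 by (simp add: spells_def pos_goal_def enc_set_def m q8)
  show "spells x (pos_rel X L) (pos_val a X L) (concat (map (\<lambda>i. enc_rel N Base (rel M i)) [0..<a]))"
    using 3 by (simp only: q2 q3)
  show "spells x (pos_val a X L) (pos_point a X L) (concat (map (\<lambda>p. enc_set N Base (val M p)) [0..<n]))"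
    using 4 by (simp only: q3 q4)
  show "spells x (pos_erel a X L) (pos_forms a X L) (concat (map (\<lambda>i. enc_rel m id (erel E i)) [0..<a]))"
    using 7 by (simp only: q6 q7)
  show "spells x (pos_form a X L U c) (pos_form a X L U (Suc c)) (enc_form (event_form c))"
    if "c < m * (n + 1)" for c
    using forms that by blast
  show "spells x (pos_allowed a X L U) (pos_goal a X L U) (enc_set m id (allowed I))"
    using 9 by (simp only: q8 q9)
  show "spells x (pos_goal a X L U) L (enc_form (goal_form I))"
    using 10 by (simp only: q9)
qed

lemma spells_map_bit: "spells x p q (map g [0..<c]) \<Longrightarrow> r < c \<Longrightarrow> bit X (p + r) \<longleftrightarrow> g r"
  by (auto simp: spells_map bit_num)

lemma bit_rel:
  assumes "i < a" "v < N" "w < N"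
  shows "bit X (pos_rel X L + i * (N * N) + v * N + w) \<longleftrightarrow> (Base v, Base w) \<in> rel M i"
  using spells_map_bit[OF spells_rel[unfolded concat_enc_rel], of "i * (N * N) + (v * N + w)"]
    block_index[OF assms(1) pair_index(1)[OF assms(2,3)]] pair_index[OF assms(2,3)]
  by (simp add: add.assoc)

lemma bit_val:
  assumes "p < n" "v < N"
  shows "bit X (pos_val a X L + p * N + v) \<longleftrightarrow> Base v \<in> val M p"
  using spells_map_bit[OF spells_val[unfolded concat_enc_set], of "p * N + v"] block_index[OF assms]
  by (simp add: add.assoc)

lemma bit_erel:
  assumes "i < a" "e < m" "e' < m"
  shows "bit X (pos_erel a X L + i * (m * m) + e * m + e') \<longleftrightarrow> (e, e') \<in> erel E i"
  using spells_map_bit[OF spells_erel[unfolded concat_enc_rel], of "i * (m * m) + (e * m + e')"]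
    block_index[OF assms(1) pair_index(1)[OF assms(2,3)]] pair_index[OF assms(2,3)]
  by (simp add: add.assoc)

lemma bit_allowed: "e < m \<Longrightarrow> bit X (pos_allowed a X L U + e) \<longleftrightarrow> e \<in> allowed I"
  using spells_map_bit[OF spells_allowed[unfolded enc_set_def]] by simp

lemma form_at_goal: "form_at a n x j S (pos_goal a X L U) L \<longleftrightarrow>
    nesting_depth (goal_form I) \<le> j \<and> S (goal_form I)"
  unfolding form_at_def form_ok_def
  using spells_goal spells_form_unique(1)[OF spells_goal] goal_ok unfolding form_ok_def by blast

lemma valid_encoded:
  assumes "nesting_depth (goal_form I) = k"
  shows "valid a k X L U"
proof -
  have "Base (point I) \<in> worlds M"
    using wf by (simp add: wf_instance_def)
  then have "point I < N"
    by (auto simp: worlds_eq)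
  moreover have "is_form a X L U n 0 (pos_form a X L U c) (pos_form a X L U (Suc c))"
    if "c < m * (n + 1)" for c
    unfolding is_form_iff[OF refl] form_at_def using spells_forms[OF that] event_form_ok[OF that] by blast
  ultimately show ?thesis
    unfolding valid_def rd_props_eq rd_worlds_eq rd_point_eq rd_events_eq is_form_iff[OF refl] form_at_goal
    using assms by auto
qed

end

text \<open>Rejection of malformed words rests on this: a word that passes \<open>valid\<close> is
  the encoding of the instance that is read back from it bit by bit, with the formulas taken from
  the parses.\<close>

lemma encoded_instance_of_valid:
  assumes "valid a k (num x) (length x) (table_bound (length x))"
  obtains I where "wf_instance a I" "nesting_depth (goal_form I) = k" "x = enc_instance a I"
proof -
  define X where "X = num x"
  define L where "L = length x"
  define U where "U = table_bound L"
  define n where "n = rd_props X L"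
  define N where "N = rd_worlds X L"
  define m where "m = rd_events a X L"
  define pt where "pt = rd_point a X L"
  let ?P = "pos_form a X L U"
  have is_form: "is_form a X L U n j p q \<longleftrightarrow> form_at a n x j (\<lambda>_. True) p q" for j p q
    unfolding X_def L_def by (rule is_form_iff[OF U_def[unfolded L_def]])
  have v: "pt < N" "\<And>c. c < m * (n + 1) \<Longrightarrow> form_at a n x 0 (\<lambda>_. True) (?P c) (?P (Suc c))"
    "form_at a n x k (\<lambda>_. True) (pos_goal a X L U) L" 
    "k = 0 \<or> \<not> form_at a n x (k - 1) (\<lambda>_. True) (pos_goal a X L U) L"
    using assms unfolding valid_def X_def[symmetric] L_def[symmetric] U_def[symmetric] n_def[symmetric]
      N_def[symmetric] m_def[symmetric] pt_def[symmetric] is_form by auto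
  have "\<forall>c. \<exists>\<phi>. c < m * (n + 1) \<longrightarrow> form_ok a n 0 \<phi> \<and> spells x (?P c) (?P (Suc c)) (enc_form \<phi>)"
    using v(2) unfolding form_at_def by blast
  then obtain fl where fl: "\<And>c. c < m * (n + 1) \<Longrightarrow> form_ok a n 0 (fl c)"
    "\<And>c. c < m * (n + 1) \<Longrightarrow> spells x (?P c) (?P (Suc c)) (enc_form (fl c))"
    by metis
  obtain \<phi> where \<phi>: "form_ok a n k \<phi>" "spells x (pos_goal a X L U) L (enc_form \<phi>)"
    using v(3) unfolding form_at_def by blast
  have depth: "nesting_depth \<phi> = k"
  proof (rule ccontr)
    assume "nesting_depth \<phi> \<noteq> k"
    then have "form_ok a n (k - 1) \<phi>" "k \<noteq> 0"
      using \<phi>(1) by (auto simp: form_ok_def)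
    then show False
      using v(4) \<phi>(2) unfolding form_at_def by blast
  qed
  have goal_le: "pos_goal a X L U < L"
    using \<phi>(2) enc_form_nonempty[of \<phi>] unfolding spells_def by linarith
  \<comment> \<open>That the positions lie inside the word is known only later, from the goal, so
    here it is a premise.\<close>
  have forms: "?P 0 \<le> ?P c \<and> (?P c \<le> L \<longrightarrow> spells x (?P 0) (?P c) (concat (map (\<lambda>c. enc_form (fl c)) [0..<c])))"
    if "c \<le> m * (n + 1)" for c
    using that
  proof (induction c)
    case 0
    show ?case
      by (simp add: L_def)
  next
    case (Suc c)
    have "spells x (?P c) (?P (Suc c)) (enc_form (fl c))"
      using Suc.prems by (intro fl) simp
    then show ?case
      using Suc spells_le[of x "?P c"] by (fastforce simp: spells_append L_def)
  qed
  have P0: "?P 0 = pos_forms a X L"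
    by (simp add: pos_form_def)
  have allowed_eq: "pos_allowed a X L U = ?P (m * (n + 1))"
    by (simp add: pos_allowed_def m_def n_def)
  have pos: "pos_rel X L = n + 1 + N + 1" "pos_val a X L = pos_rel X L + a * (N * N)"
    "pos_point a X L = pos_val a X L + n * N" "pos_events a X L = pos_point a X L + pt + 1"
    "pos_erel a X L = pos_events a X L + m + 1" "pos_forms a X L = pos_erel a X L + a * (m * m)"
    "pos_goal a X L U = pos_allowed a X L U + m"
    by (simp_all add: pos_rel_def pos_val_def pos_point_def pos_events_def pos_erel_def pos_forms_def
        pos_goal_def n_def N_def m_def pt_def)
  have "pos_forms a X L \<le> pos_allowed a X L U"
    using forms[of "m * (n + 1)"] by (simp add: P0 allowed_eq)
  \<comment> \<open>Positions only grow from block to block and the goal starts before the end of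
    the word, so every earlier block fits.\<close>
  then have le: "pos_allowed a X L U < L" "pos_forms a X L < L" "pos_erel a X L < L" "pos_events a X L + m < L"
    "pos_point a X L + pt < L" "pos_val a X L < L" "pos_rel X L < L" "n + 1 + N < L" "n < L" "pos_point a X L < L"
    "pos_events a X L < L"
    using goal_le pos by linarith+
  define I where "I = \<lparr> props = n,
     init_model = \<lparr> worlds = Base ` {..<N},
       rel = (\<lambda>i. {(Base v, Base w) | v w. v < N \<and> w < N \<and> x ! (pos_rel X L + (i * (N * N) + (v * N + w)))}),
       val = (\<lambda>p. {Base v | v. v < N \<and> x ! (pos_val a X L + (p * N + v))}) \<rparr>,
     point = pt,
     ev_model = \<lparr> events = {..<m},
       erel = (\<lambda>i. {(e, e'). e < m \<and> e' < m \<and> x ! (pos_erel a X L + (i * (m * m) + (e * m + e')))}),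
       pre = (\<lambda>e. fl (e * (n + 1))),
       post = (\<lambda>e p. fl (e * (n + 1) + 1 + p)) \<rparr>,
     allowed = {e. e < m \<and> x ! (pos_allowed a X L U + e)},
     goal_form = \<phi> \<rparr>"
  have card: "card (worlds (init_model I)) = N" "card (events (ev_model I)) = m"
    by (auto simp: I_def card_image inj_on_def)
  have "wf_instance a I"
  proof -
    have "form_ok a n 0 (fl (e * (n + 1)))" if "e < m" for e
      using fl(1)[of "e * (n + 1) + 0"] block_index(1)[of e m 0 "n + 1"] that by simp
    moreover have "form_ok a n 0 (fl (e * (n + 1) + 1 + p))" if "e < m" "p < n" for e p
      using fl(1)[of "e * (n + 1) + (1 + p)"] block_index(1)[of e m "1 + p" "n + 1"] that by (simp add: add.assoc)
    moreover have "propositional \<psi> \<longleftrightarrow> nesting_depth \<psi> = 0" for \<psi>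
      by (induction \<psi>) auto
    ultimately show ?thesis
      using v(1) \<phi>(1)
      by (auto simp: wf_instance_def wf_model_def wf_prop_event_model_def I_def form_ok_def)
  qed
  moreover have "x = enc_instance a I"
  proof -
    have rel_block: "spells x (pos_rel X L) (pos_val a X L) (concat (map (\<lambda>i. enc_rel N Base (rel (init_model I) i)) [0..<a]))"
    proof -
      have "x ! (pos_rel X L + r) \<longleftrightarrow>
          (Base (r mod (N * N) div N), Base (r mod (N * N) mod N)) \<in> rel (init_model I) (r div (N * N))"
        if "r < a * (N * N)" for r
      proof -
        have "0 < N"
          using v(1) by simp
        then have "r mod (N * N) div N < N" "r mod (N * N) mod N < N"
          by (simp_all add: less_mult_imp_div_less)
        moreover have "r div (N * N) * (N * N) + (r mod (N * N) div N * N + r mod (N * N) mod N) = r"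
          by (simp only: div_mult_mod_eq)
        ultimately show ?thesis
          by (simp only: I_def planning_instance.simps model.simps event_model.simps) auto
      qed
      then show ?thesis
        unfolding concat_enc_rel spells_map using le pos(2) by (simp add: L_def)
    qed
    have val_block: "spells x (pos_val a X L) (pos_point a X L) (concat (map (\<lambda>p. enc_set N Base (val (init_model I) p)) [0..<n]))"
    proof -
      have "x ! (pos_val a X L + r) \<longleftrightarrow> Base (r mod N) \<in> val (init_model I) (r div N)" for r
        using v(1) by (simp add: I_def)
      then show ?thesis
        unfolding concat_enc_set spells_map using le pos(3) by (simp add: L_def)
    qed
    have erel_block: "spells x (pos_erel a X L) (pos_forms a X L) (concat (map (\<lambda>i. enc_rel m id (erel (ev_model I) i)) [0..<a]))"
    proof -
      have "x ! (pos_erel a X L + r) \<longleftrightarrow>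
          (id (r mod (m * m) div m), id (r mod (m * m) mod m)) \<in> erel (ev_model I) (r div (m * m))"
        if "r < a * (m * m)" for r
      proof -
        have "0 < m"
          using that by (cases m) auto
        then have "r mod (m * m) div m < m" "r mod (m * m) mod m < m"
          by (simp_all add: less_mult_imp_div_less)
        moreover have "r div (m * m) * (m * m) + (r mod (m * m) div m * m + r mod (m * m) mod m) = r"
          by (simp only: div_mult_mod_eq)
        ultimately show ?thesis
          by (simp only: I_def planning_instance.simps model.simps event_model.simps) auto
      qed
      then show ?thesis
        unfolding concat_enc_rel spells_map using le pos(6) by (simp add: L_def)
    qed
    have allowed_block: "spells x (pos_allowed a X L U) (pos_goal a X L U) (enc_set m id (allowed I))"
      unfolding enc_set_def spells_map using goal_le pos(7) by (auto simp: I_def L_def)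
    have form_block: "spells x (pos_forms a X L) (pos_allowed a X L U)
       (concat (map (\<lambda>e. enc_form (pre (ev_model I) e) @ concat (map (\<lambda>p. enc_form (post (ev_model I) e p)) [0..<n])) [0..<m]))"
    proof -
      have "concat (map (\<lambda>e. enc_form (pre (ev_model I) e) @ concat (map (\<lambda>p. enc_form (post (ev_model I) e p)) [0..<n])) [0..<m]) =
          concat (map (\<lambda>c. enc_form (fl c)) [0..<m * (n + 1)])"
        unfolding concat_enc_forms[of "\<lambda>c. enc_form (fl c)", symmetric] by (simp add: I_def)
      then show ?thesis
        using forms[of "m * (n + 1)"] le by (simp add: P0 allowed_eq)
    qed
    have nat_block: "spells x 0 (n + 1) (enc_nat n)" "spells x (n + 1) (pos_rel X L) (enc_nat N)"
      "spells x (pos_point a X L) (pos_events a X L) (enc_nat pt)"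
      "spells x (pos_events a X L) (pos_erel a X L) (enc_nat m)"
    proof -
      have nat_at: "nat_at X L 0 = n" "nat_at X L (n + 1) = N" "nat_at X L (pos_point a X L) = pt"
        "nat_at X L (pos_events a X L) = m"
        by (simp_all only: n_def N_def pt_def m_def rd_props_def rd_worlds_def rd_point_def rd_events_def)
      have sp: "spells x p (p + c + 1) (enc_nat c)" if "nat_at X L p = c" "p + c < L" for p c
        using spells_nat_at[of p x] that unfolding X_def L_def by blast
      show "spells x 0 (n + 1) (enc_nat n)"
        using sp[OF nat_at(1)] le by simp
      show "spells x (n + 1) (pos_rel X L) (enc_nat N)"
        using sp[OF nat_at(2)] le by (simp only: pos(1))
      show "spells x (pos_point a X L) (pos_events a X L) (enc_nat pt)"
        using sp[OF nat_at(3)] le by (simp only: pos(4))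
      show "spells x (pos_events a X L) (pos_erel a X L) (enc_nat m)"
        using sp[OF nat_at(4)] le by (simp only: pos(5))
    qed
    have sel: "props I = n" "point I = pt" "goal_form I = \<phi>"
      by (simp_all add: I_def)
    have "spells x 0 L (enc_instance a I)"
      unfolding enc_instance_def enc_model_def enc_event_model_def Let_def card spells_append append_assoc sel
      by (intro exI conjI)
        (rule nat_block rel_block val_block erel_block form_block allowed_block \<phi>(2))+
    then show ?thesis
      by (simp add: L_def spells_all)
  qed
  moreover have "nesting_depth (goal_form I) = k"
    using depth by (simp add: I_def)
  ultimately show thesis
    by (intro that)
qed

section \<open>Types of worlds and the automaton of solution plans\<close>

lemma nat_eq_by_bits:
  fixes x y :: nat
  assumes "x < 2 ^ l" "y < 2 ^ l" "\<And>b. b < l \<Longrightarrow> bit x b \<longleftrightarrow> bit y b"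
  shows "x = y"
proof (rule bit_eqI)
  fix b
  show "bit x b \<longleftrightarrow> bit y b"
  proof (cases "b < l")
    case False
    then have "(2 :: nat) ^ l \<le> 2 ^ b"
      by (intro power_increasing) auto
    then have "x < 2 ^ b" "y < 2 ^ b"
      using assms(1,2) by linarith+
    then show ?thesis
      by (simp add: bit_iff_odd)
  qed (rule assms(3))
qed

text \<open>Bits from \<open>n\<close> to \<open>L - 1\<close> are zero and no bit lies outside the
  layout, so equality of types is equality of numbers.\<close>

fun world_type :: "nat \<Rightarrow> nat \<Rightarrow> nat \<Rightarrow> nat \<Rightarrow> model \<Rightarrow> world \<Rightarrow> nat" where
  "world_type a n L 0 M w = num (map (\<lambda>p. p < n \<and> w \<in> val M p) [0..<L])"
| "world_type a n L (Suc j) M w = num (map (\<lambda>b. if b < L then b < n \<and> w \<in> val M b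
     else \<exists>v. (w, v) \<in> rel M ((b - L) div tower a L j) \<and> world_type a n L j M v = (b - L) mod tower a L j)
     [0..<L + a * tower a L j])"

declare world_type.simps [simp del]

lemma tower_pos: "0 < tower a L j"
  by (cases j) simp_all

lemma world_type_less: "world_type a n L j M w < tower a L j"
proof (cases j)
  case 0
  show ?thesis
    using num_less[of "map (\<lambda>p. p < n \<and> w \<in> val M p) [0..<L]"] by (simp add: 0 world_type.simps)
next
  case (Suc j')
  show ?thesis
    unfolding Suc world_type.simps tower.simps
    by (rule order_less_le_trans[OF num_less]) simp
qed

lemma bit_world_type_prop: "p < L \<Longrightarrow> bit (world_type a n L j M w) p \<longleftrightarrow> p < n \<and> w \<in> val M p"
  by (cases j) (auto simp: bit_num_map world_type.simps)

lemma bit_world_type_succ: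
  assumes "i < a" "\<sigma> < tower a L j"
  shows "bit (world_type a n L (Suc j) M w) (L + i * tower a L j + \<sigma>) \<longleftrightarrow>
    (\<exists>v. (w, v) \<in> rel M i \<and> world_type a n L j M v = \<sigma>)"
  using block_index[OF assms] unfolding world_type.simps bit_num_map by (simp add: add.assoc)

lemma eq_world_type_0:
  assumes "\<tau> < tower a L 0"
  shows "\<tau> = world_type a n L 0 M w \<longleftrightarrow> (\<forall>p<L. bit \<tau> p \<longleftrightarrow> p < n \<and> w \<in> val M p)"
proof
  assume *: "\<forall>p<L. bit \<tau> p \<longleftrightarrow> p < n \<and> w \<in> val M p"
  show "\<tau> = world_type a n L 0 M w"
    using assms world_type_less[of a n L 0 M w] * 
    by (intro nat_eq_by_bits[of _ L]) (auto simp: bit_world_type_prop)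
qed (simp add: bit_world_type_prop)

text \<open>A number in range is determined by its bits. The right-hand side has the form of the bit
  conditions in \<open>type_step\<close> and \<open>type_init\<close>, which recognise a type
  instead of computing it.\<close>

lemma eq_world_type_Suc:
  assumes "\<tau> < tower a L (Suc j)"
  shows "\<tau> = world_type a n L (Suc j) M w \<longleftrightarrow> (\<forall>p<L. bit \<tau> p \<longleftrightarrow> p < n \<and> w \<in> val M p) \<and>
    (\<forall>i<a. \<forall>\<sigma><tower a L j. bit \<tau> (L + i * tower a L j + \<sigma>) \<longleftrightarrow>
       (\<exists>v. (w, v) \<in> rel M i \<and> world_type a n L j M v = \<sigma>))" (is "?l \<longleftrightarrow> ?r")
proof
  assume r: ?r
  let ?T = "tower a L j"
  show ?l
  proof (rule nat_eq_by_bits[of _ "L + a * ?T"])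
    show "\<tau> < 2 ^ (L + a * ?T)"
      using assms by simp
    show "world_type a n L (Suc j) M w < 2 ^ (L + a * ?T)"
      using world_type_less[of a n L "Suc j" M w] by (simp)
    fix b
    assume b: "b < L + a * ?T"
    show "bit \<tau> b \<longleftrightarrow> bit (world_type a n L (Suc j) M w) b"
    proof (cases "b < L")
      case True
      then show ?thesis
        using r[THEN conjunct1, rule_format, OF True] bit_world_type_prop[OF True] by simp
    next
      case False
      then have "b - L < a * ?T"
        using b by linarith
      then have *: "(b - L) div ?T < a" "(b - L) mod ?T < ?T"
        by (simp_all add: less_mult_imp_div_less tower_pos)
      have "L + (b - L) div ?T * ?T + (b - L) mod ?T = L + ((b - L) div ?T * ?T + (b - L) mod ?T)"
        by (rule add.assoc)
      also have "\<dots> = b"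
        using False div_mult_mod_eq[of "b - L" ?T] by linarith
      finally have b_eq: "L + (b - L) div ?T * ?T + (b - L) mod ?T = b" .
      show ?thesis
        using r[THEN conjunct2, rule_format, OF *] bit_world_type_succ[OF *, of n M w] unfolding b_eq by simp
    qed
  qed
next
  assume l: ?l
  show ?r
    unfolding l using bit_world_type_prop bit_world_type_succ by (intro conjI allI impI)
qed

text \<open>Quantifying over the listed successor types amounts to quantifying over successors, as
  each listed type is realised by one. The depth bound keeps evaluation away from the default
  \<open>False\<close> for knowledge at level \<open>0\<close>.\<close>

lemma type_sat_world_type:
  assumes "in_language a n \<phi>" "nesting_depth \<phi> \<le> j" "n \<le> L"
  shows "type_sat a L \<phi> j (world_type a n L j M w) \<longleftrightarrow> sat M w \<phi>"
  using assms(1,2)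
proof (induction \<phi> arbitrary: j w)
  case (Atom p)
  then show ?case
    using assms(3) by (simp add: bit_world_type_prop)
next
  case (Know i \<phi>)
  then obtain j' where j: "j = Suc j'" "nesting_depth \<phi> \<le> j'"
    by (cases j) auto
  have "type_sat a L (Know i \<phi>) j (world_type a n L j M w) \<longleftrightarrow>
      (\<forall>\<sigma><tower a L j'. (\<exists>v. (w, v) \<in> rel M i \<and> world_type a n L j' M v = \<sigma>) \<longrightarrow> type_sat a L \<phi> j' \<sigma>)"
    using Know.prems(1) bit_world_type_succ[of i a _ L j' n M w] by (simp add: j)
  also have "\<dots> \<longleftrightarrow> (\<forall>v. (w, v) \<in> rel M i \<longrightarrow> type_sat a L \<phi> j' (world_type a n L j' M v))"
    using world_type_less by blast
  also have "\<dots> \<longleftrightarrow> sat M w (Know i \<phi>)"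
    using Know.IH[OF _ j(2)] Know.prems(1) by simp
  finally show ?case .
qed auto

text \<open>Every level keeps the propositions in the same low bits, so formulas without knowledge
  can be evaluated at level \<open>0\<close> on a type of any level. This is where the event model
  being propositional enters.\<close>

lemma type_sat_0_world_type:
  assumes "form_ok a n 0 \<phi>" "n \<le> L"
  shows "type_sat a L \<phi> 0 (world_type a n L j M w) \<longleftrightarrow> sat M w \<phi>"
  using assms(1)
  by (induction \<phi>) (use assms(2) in \<open>auto simp: form_ok_def bit_world_type_prop\<close>)

section \<open>The automaton as bounded formulas on types\<close>

definition event_holds :: "nat \<Rightarrow> nat \<Rightarrow> nat \<Rightarrow> nat \<Rightarrow> nat \<Rightarrow> nat \<Rightarrow> bool" where
  "event_holds a X L U \<tau> c \<longleftrightarrow>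
     type_holds a X L U (rd_props X L) 0 \<tau> (pos_form a X L U c) (pos_form a X L U (Suc c))"

text \<open>Going to a successor lowers the level by one. This makes recursion on \<open>j\<close>
  possible although a transition of a type involves the transitions of its neighbours.\<close>

fun type_step :: "nat \<Rightarrow> nat \<Rightarrow> nat \<Rightarrow> nat \<Rightarrow> nat \<Rightarrow> nat \<Rightarrow> nat \<Rightarrow> nat \<Rightarrow> bool" where
  "type_step a X L U 0 \<tau> e \<tau>' \<longleftrightarrow>
     (\<forall>p<L. bit \<tau>' p \<longleftrightarrow> p < rd_props X L \<and> event_holds a X L U \<tau> (e * (rd_props X L + 1) + 1 + p))"
| "type_step a X L U (Suc j) \<tau> e \<tau>' \<longleftrightarrow>
     (\<forall>p<L. bit \<tau>' p \<longleftrightarrow> p < rd_props X L \<and> event_holds a X L U \<tau> (e * (rd_props X L + 1) + 1 + p)) \<and>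
     (\<forall>i<a. \<forall>\<sigma>'<tower a L j. bit \<tau>' (L + i * tower a L j + \<sigma>') \<longleftrightarrow>
        (\<exists>\<sigma><tower a L j. bit \<tau> (L + i * tower a L j + \<sigma>) \<and>
           (\<exists>e'<rd_events a X L.
              bit X (pos_erel a X L + i * (rd_events a X L * rd_events a X L) + e * rd_events a X L + e') \<and>
              event_holds a X L U \<sigma> (e' * (rd_props X L + 1)) \<and> type_step a X L U j \<sigma> e' \<sigma>')))"

fun type_init :: "nat \<Rightarrow> nat \<Rightarrow> nat \<Rightarrow> nat \<Rightarrow> nat \<Rightarrow> nat \<Rightarrow> bool" where
  "type_init a X L 0 \<tau> v \<longleftrightarrow>
     (\<forall>p<L. bit \<tau> p \<longleftrightarrow> p < rd_props X L \<and> bit X (pos_val a X L + p * rd_worlds X L + v))"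
| "type_init a X L (Suc j) \<tau> v \<longleftrightarrow>
     (\<forall>p<L. bit \<tau> p \<longleftrightarrow> p < rd_props X L \<and> bit X (pos_val a X L + p * rd_worlds X L + v)) \<and>
     (\<forall>i<a. \<forall>\<sigma><tower a L j. bit \<tau> (L + i * tower a L j + \<sigma>) \<longleftrightarrow>
        (\<exists>w<rd_worlds X L.
           bit X (pos_rel X L + i * (rd_worlds X L * rd_worlds X L) + v * rd_worlds X L + w) \<and>
           type_init a X L j \<sigma> w))"

declare type_step.simps [simp del] type_init.simps [simp del]

definition plan_step :: "nat \<Rightarrow> nat \<Rightarrow> nat \<Rightarrow> nat \<Rightarrow> nat \<Rightarrow> nat \<Rightarrow> nat \<Rightarrow> nat \<Rightarrow> bool" where
  "plan_step a k X L U \<tau> e \<tau>' \<longleftrightarrow> bit X (pos_allowed a X L U + e) \<and>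
     event_holds a X L U \<tau> (e * (rd_props X L + 1)) \<and> type_step a X L U k \<tau> e \<tau>'"

definition plan_final :: "nat \<Rightarrow> nat \<Rightarrow> nat \<Rightarrow> nat \<Rightarrow> nat \<Rightarrow> nat \<Rightarrow> bool" where
  "plan_final a k X L U \<tau> \<longleftrightarrow> type_holds a X L U (rd_props X L) k \<tau> (pos_goal a X L U) L"

text \<open>All numbers in range are states, including those that are the type of no world; in an
  encoded instance no run from the initial type meets the latter. The lists are built by loops and
  filters so that a program can write them in this order.\<close>

definition plan_nfa :: "nat \<Rightarrow> nat \<Rightarrow> nat \<Rightarrow> nat \<Rightarrow> nat \<Rightarrow> nfa" where
  "plan_nfa a k X L U = (let Q = tower a L k in
     \<lparr> nfa_states = Q,
       nfa_init = filter (\<lambda>\<tau>. type_init a X L k \<tau> (rd_point a X L)) [0..<Q],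
       nfa_final = filter (plan_final a k X L U) [0..<Q],
       nfa_trans = concat (map (\<lambda>\<tau>. concat (map (\<lambda>e. concat (map (\<lambda>\<tau>'.
         if plan_step a k X L U \<tau> e \<tau>' then [(\<tau>, e, \<tau>')] else []) [0..<Q])) [0..<rd_events a X L])) [0..<Q]) \<rparr>)"

lemma set_plan_trans:
  "(\<tau>, e, \<tau>') \<in> set (nfa_trans (plan_nfa a k X L U)) \<longleftrightarrow>
    \<tau> < tower a L k \<and> e < rd_events a X L \<and> \<tau>' < tower a L k \<and> plan_step a k X L U \<tau> e \<tau>'"
  by (auto simp: plan_nfa_def Let_def split: if_splits)

context encoded_instance
begin

lemma n_le: "n \<le> L"
  using spells_enc_nat[of x 0 "n + 1" n] spells_nat_at[of 0 x] rd_props_eq spells_le[OF spells_goal]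
    spells_le[OF spells_rel] unfolding rd_props_def pos_rel_def by linarith

lemma form_at_event:
  assumes "c < m * (n + 1)"
  shows "form_at a n x 0 S (pos_form a X L U c) (pos_form a X L U (Suc c)) \<longleftrightarrow> S (event_form c)"
  unfolding form_at_def
  using spells_forms[OF assms] spells_form_unique(1)[OF spells_forms[OF assms]] event_form_ok[OF assms]
  by blast

lemma event_holds_iff:
  assumes "c < m * (n + 1)"
  shows "event_holds a X L U (world_type a n L j M' w) c \<longleftrightarrow> sat M' w (event_form c)"
  unfolding event_holds_def rd_props_eq type_holds_iff[OF refl] form_at_event[OF assms]
  using event_form_ok[OF assms] n_le by (rule type_sat_0_world_type)

lemma pre_holds_iff:
  assumes "e < m"
  shows "event_holds a X L U (world_type a n L j M' w) (e * (n + 1)) \<longleftrightarrow> sat M' w (pre E e)"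
  using event_holds_iff[of "e * (n + 1)"] block_index(1)[of e m 0 "n + 1"] assms
  by (simp add: event_form_pre[simplified])

lemma post_holds_iff:
  assumes "e < m" "p < n"
  shows "event_holds a X L U (world_type a n L j M' w) (e * (n + 1) + 1 + p) \<longleftrightarrow> sat M' w (post E e p)"
proof -
  have "e * (n + 1) + 1 + p < m * (n + 1)"
    using block_index(1)[of e m "1 + p" "n + 1"] assms by linarith
  from event_holds_iff[OF this] show ?thesis
    unfolding event_form_post[OF assms(2)] .
qed

text \<open>\<open>sat\<close> follows \<open>rel\<close> without regard to \<open>worlds\<close>,
  whereas a product keeps only pairs over \<open>worlds\<close>. If relations stay inside
  \<open>worlds\<close>, no successor is lost; the initial model has this property and every product
  gets it by construction.\<close>

definition good :: "model \<Rightarrow> bool" where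
  "good M' \<longleftrightarrow> (\<forall>i<a. rel M' i \<subseteq> worlds M' \<times> worlds M')"

lemma good_init: "good M"
  using wf by (simp add: good_def wf_instance_def wf_model_def)

lemma good_update: "good (update_product M' E)"
  by (auto simp: good_def update_product_def)

lemma val_update:
  assumes "w \<in> worlds M'" "e < m" "sat M' w (pre E e)"
  shows "Upd w e \<in> val (update_product M' E) p \<longleftrightarrow> sat M' w (post E e p)"
  using assms by (auto simp: update_product_def product_worlds_def events_eq)

lemma rel_update:
  assumes "w \<in> worlds M'" "e < m" "sat M' w (pre E e)" "i < a" "good M'"
  shows "(Upd w e, u) \<in> rel (update_product M' E) i \<longleftrightarrow>
    (\<exists>w' e'. u = Upd w' e' \<and> (w, w') \<in> rel M' i \<and> (e, e') \<in> erel E i \<and> e' < m \<and>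
       w' \<in> worlds M' \<and> sat M' w' (pre E e'))"
  using assms by (auto simp: update_product_def product_worlds_def events_eq)

text \<open>The type of \<open>(w, e)\<close> depends on \<open>w\<close> only through its type: in
  the successor clause, all worlds of one type lead to the same new type by the induction
  hypothesis.\<close>

lemma type_step_iff:
  assumes "good M'" "w \<in> worlds M'" "e < m" "sat M' w (pre E e)" "\<tau>' < tower a L j"
  shows "type_step a X L U j (world_type a n L j M' w) e \<tau>' \<longleftrightarrow>
    \<tau>' = world_type a n L j (update_product M' E) (Upd w e)"
  using assms(2-)
proof (induction j arbitrary: w e \<tau>')
  case 0
  show ?case
    unfolding eq_world_type_0[OF 0(4)] type_step.simps rd_props_eq
    by (simp only: post_holds_iff[OF 0(2)] val_update[OF 0(1,2,3)] cong: conj_cong)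
next
  case (Suc j)
  let ?T = "tower a L j"
  have props: "(\<forall>p<L. bit \<tau>' p \<longleftrightarrow> p < n \<and> event_holds a X L U (world_type a n L (Suc j) M' w) (e * (n + 1) + 1 + p)) \<longleftrightarrow>
      (\<forall>p<L. bit \<tau>' p \<longleftrightarrow> p < n \<and> Upd w e \<in> val (update_product M' E) p)"
    by (simp only: post_holds_iff[OF Suc.prems(2)] val_update[OF Suc.prems(1,2,3)] cong: conj_cong)
  have succ: "(\<exists>\<sigma><?T. bit (world_type a n L (Suc j) M' w) (L + i * ?T + \<sigma>) \<and>
           (\<exists>e'<m. bit X (pos_erel a X L + i * (m * m) + e * m + e') \<and>
              event_holds a X L U \<sigma> (e' * (n + 1)) \<and> type_step a X L U j \<sigma> e' \<sigma>')) \<longleftrightarrow>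
      (\<exists>u. (Upd w e, u) \<in> rel (update_product M' E) i \<and> world_type a n L j (update_product M' E) u = \<sigma>')"
    (is "?l \<longleftrightarrow> ?r") if i: "i < a" and \<sigma>': "\<sigma>' < ?T" for i \<sigma>'
  proof
    assume ?l
    then obtain \<sigma> e' where *: "\<sigma> < ?T" "bit (world_type a n L (Suc j) M' w) (L + i * ?T + \<sigma>)" "e' < m"
      "bit X (pos_erel a X L + i * (m * m) + e * m + e')"
      "event_holds a X L U \<sigma> (e' * (n + 1))" "type_step a X L U j \<sigma> e' \<sigma>'"
      by blast
    \<comment> \<open>A successor type listed in the bits is realised by an actual successor
      \<open>v\<close>, to which the induction hypothesis applies.\<close>
    from *(2) obtain v where v: "(w, v) \<in> rel M' i" "world_type a n L j M' v = \<sigma>"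
      unfolding bit_world_type_succ[OF i *(1)] by blast
    then have vw: "v \<in> worlds M'"
      using assms(1) i by (auto simp: good_def)
    have sat: "sat M' v (pre E e')"
      using *(5) unfolding v(2)[symmetric] pre_holds_iff[OF *(3)] .
    have "\<sigma>' = world_type a n L j (update_product M' E) (Upd v e')"
      using *(6) unfolding v(2)[symmetric] Suc.IH[OF vw *(3) sat \<sigma>'] .
    moreover have "(e, e') \<in> erel E i"
      using *(4) unfolding bit_erel[OF i Suc.prems(2) *(3)] .
    then have "(Upd w e, Upd v e') \<in> rel (update_product M' E) i"
      unfolding rel_update[OF Suc.prems(1-3) i assms(1)] using v(1) vw sat *(3) by blast
    ultimately show ?r
      by blast
  next
    assume ?r
    then obtain u where u: "(Upd w e, u) \<in> rel (update_product M' E) i"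
      "world_type a n L j (update_product M' E) u = \<sigma>'"
      by blast
    from u(1) obtain v e' where *: "(w, v) \<in> rel M' i" "(e, e') \<in> erel E i" "e' < m" "v \<in> worlds M'"
      "sat M' v (pre E e')" and uv: "u = Upd v e'"
      unfolding rel_update[OF Suc.prems(1-3) i assms(1)] by blast
    let ?\<sigma> = "world_type a n L j M' v"
    have "?\<sigma> < ?T"
      by (rule world_type_less)
    moreover have "bit (world_type a n L (Suc j) M' w) (L + i * ?T + ?\<sigma>)"
      unfolding bit_world_type_succ[OF i world_type_less] using *(1) by blast
    moreover have "bit X (pos_erel a X L + i * (m * m) + e * m + e')"
      unfolding bit_erel[OF i Suc.prems(2) *(3)] by (rule *(2))
    moreover have "event_holds a X L U ?\<sigma> (e' * (n + 1))"
      unfolding pre_holds_iff[OF *(3)] by (rule *(5))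
    moreover have "type_step a X L U j ?\<sigma> e' \<sigma>'"
      unfolding Suc.IH[OF *(4,3,5) \<sigma>'] using u(2) uv by simp
    ultimately show ?l
      using *(3) by blast
  qed
  show ?case
    unfolding eq_world_type_Suc[OF Suc.prems(4)] type_step.simps rd_props_eq rd_events_eq props
    by (intro conj_cong refl all_cong1 imp_cong) (simp only: succ)
qed

lemma type_init_iff:
  assumes "v < N" "\<tau> < tower a L j"
  shows "type_init a X L j \<tau> v \<longleftrightarrow> \<tau> = world_type a n L j M (Base v)"
  using assms
proof (induction j arbitrary: v \<tau>)
  case 0
  show ?case
    unfolding eq_world_type_0[OF 0(2)] type_init.simps rd_props_eq rd_worlds_eq
    by (simp only: bit_val[OF _ 0(1)] cong: conj_cong)
next
  case (Suc j)
  have props: "(\<forall>p<L. bit \<tau> p \<longleftrightarrow> p < n \<and> bit X (pos_val a X L + p * N + v)) \<longleftrightarrow>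
      (\<forall>p<L. bit \<tau> p \<longleftrightarrow> p < n \<and> Base v \<in> val M p)"
    by (simp only: bit_val[OF _ Suc.prems(1)] cong: conj_cong)
  have succ: "(\<exists>w<N. bit X (pos_rel X L + i * (N * N) + v * N + w) \<and> type_init a X L j \<sigma> w) \<longleftrightarrow>
      (\<exists>u. (Base v, u) \<in> rel M i \<and> world_type a n L j M u = \<sigma>)" if i: "i < a" and \<sigma>: "\<sigma> < tower a L j" for i \<sigma>
  proof -
    have "\<exists>w<N. u = Base w" if "(Base v, u) \<in> rel M i" for u
      using good_init i that worlds_eq by (auto simp: good_def)
    then have "(\<exists>u. (Base v, u) \<in> rel M i \<and> world_type a n L j M u = \<sigma>) \<longleftrightarrow>
        (\<exists>w<N. (Base v, Base w) \<in> rel M i \<and> \<sigma> = world_type a n L j M (Base w))"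
      by blast
    also have "\<dots> \<longleftrightarrow> (\<exists>w<N. bit X (pos_rel X L + i * (N * N) + v * N + w) \<and> type_init a X L j \<sigma> w)"
      by (simp only: bit_rel[OF i Suc.prems(1)] Suc.IH[OF _ \<sigma>] cong: conj_cong)
    finally show ?thesis ..
  qed
  show ?case
    unfolding eq_world_type_Suc[OF Suc.prems(2)] type_init.simps rd_props_eq rd_worlds_eq props
    by (intro conj_cong refl all_cong1 imp_cong) (simp only: succ)
qed

abbreviation "k \<equiv> nesting_depth (goal_form I)"
abbreviation "plans \<equiv> plan_nfa a k X L U"

lemma plan_final_iff: "plan_final a k X L U (world_type a n L k M' w) \<longleftrightarrow> sat M' w (goal_form I)"
  unfolding plan_final_def rd_props_eq type_holds_iff[OF refl] form_at_goal
  using type_sat_world_type[of a n "goal_form I" k L M' w] goal_ok n_le by (simp add: form_ok_def)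

lemma allowed_less: "e \<in> allowed I \<Longrightarrow> e < m"
  using wf events_eq by (auto simp: wf_instance_def)

lemma plan_step_iff:
  assumes "good M'" "w \<in> worlds M'" "e < m" "\<tau>' < tower a L k"
  shows "plan_step a k X L U (world_type a n L k M' w) e \<tau>' \<longleftrightarrow> e \<in> allowed I \<and> sat M' w (pre E e) \<and>
    \<tau>' = world_type a n L k (update_product M' E) (Upd w e)"
  unfolding plan_step_def rd_props_eq bit_allowed[OF assms(3)] pre_holds_iff[OF assms(3)]
  using type_step_iff[OF assms(1-3) _ assms(4)] by blast

text \<open>The model is arbitrary since each letter replaces it by its product with the event
  model; the state remembers only the type of the current world.\<close>

lemma nfa_path_iff:
  assumes "good M'" "w \<in> worlds M'"
  shows "(\<exists>q\<in>set (nfa_final plans). nfa_path plans (world_type a n L k M' w) es q) \<longleftrightarrow>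
    set es \<subseteq> allowed I \<and> (\<exists>M'' w'. pointed_updates (M', w) E es = Some (M'', w') \<and> sat M'' w' (goal_form I))"
  using assms
proof (induction es arbitrary: M' w)
  case Nil
  have "nfa_path plans q [] q' \<longleftrightarrow> q' = q" for q q'
    by (auto intro: nfa_path.intros elim: nfa_path.cases)
  then show ?case
    using plan_final_iff[of M' w] world_type_less[of a n L k M' w] by (auto simp: plan_nfa_def Let_def)
next
  case (Cons e es)
  let ?M = "update_product M' E"
  have path: "nfa_path plans q (e # es) q'' \<longleftrightarrow>
      (\<exists>q'. (q, e, q') \<in> set (nfa_trans plans) \<and> nfa_path plans q' es q'')" for q q''
    by (auto intro: nfa_path.intros elim: nfa_path.cases)
  have trans: "(world_type a n L k M' w, e, q) \<in> set (nfa_trans plans) \<longleftrightarrow>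
      e \<in> allowed I \<and> sat M' w (pre E e) \<and> q = world_type a n L k ?M (Upd w e)" for q
    unfolding set_plan_trans rd_events_eq
    using plan_step_iff[OF Cons.prems, of e q] world_type_less allowed_less by blast
  have "(\<exists>q\<in>set (nfa_final plans). nfa_path plans (world_type a n L k M' w) (e # es) q) \<longleftrightarrow>
      e \<in> allowed I \<and> sat M' w (pre E e) \<and>
      (\<exists>q\<in>set (nfa_final plans). nfa_path plans (world_type a n L k ?M (Upd w e)) es q)"
    unfolding path trans by blast
  also have "\<dots> \<longleftrightarrow> e \<in> allowed I \<and> sat M' w (pre E e) \<and> set es \<subseteq> allowed I \<and>
      (\<exists>M'' w'. pointed_updates (?M, Upd w e) E es = Some (M'', w') \<and> sat M'' w' (goal_form I))"
  proof (intro conj_cong refl Cons.IH good_update)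
    assume "e \<in> allowed I" "sat M' w (pre E e)"
    then show "Upd w e \<in> worlds ?M"
      using Cons.prems(2) allowed_less by (simp add: update_product_def product_worlds_def events_eq)
  qed
  also have "\<dots> \<longleftrightarrow> set (e # es) \<subseteq> allowed I \<and>
      (\<exists>M'' w'. pointed_updates (M', w) E (e # es) = Some (M'', w') \<and> sat M'' w' (goal_form I))"
    by auto
  finally show ?case .
qed

lemma set_plan_init: "set (nfa_init plans) = {world_type a n L k M (Base (point I))}"
proof -
  have "Base (point I) \<in> worlds M"
    using wf by (simp add: wf_instance_def)
  then have "point I < N"
    by (auto simp: worlds_eq)
  then show ?thesis
    using type_init_iff[of "point I" _ k] world_type_less[of a n L k M "Base (point I)"]
    by (auto simp: plan_nfa_def Let_def rd_point_eq)
qed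

lemma language_plans: "nfa_language plans = solution_plans I"
proof -
  have "Base (point I) \<in> worlds M"
    using wf by (simp add: wf_instance_def)
  from nfa_path_iff[OF good_init this] show ?thesis
    unfolding nfa_language_def solution_plans_def set_plan_init by auto
qed

lemma wf_plans: "wf_nfa (allowed I) plans"
proof -
  have "set (nfa_trans plans) \<subseteq> {..<tower a L k} \<times> allowed I \<times> {..<tower a L k}"
  proof
    fix t
    assume t: "t \<in> set (nfa_trans plans)"
    obtain q e q' where [simp]: "t = (q, e, q')"
      by (cases t)
    show "t \<in> {..<tower a L k} \<times> allowed I \<times> {..<tower a L k}"
      using t bit_allowed[of e] by (auto simp: set_plan_trans plan_step_def rd_events_eq)
  qed
  then show ?thesis
    unfolding wf_nfa_def by (auto simp: plan_nfa_def Let_def)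
qed

end

section \<open>The automaton is computable\<close>

text \<open>In the proofs with these rules \<open>poly_weaken\<close> is tried last, so a goal is
  first taken apart, and only what remains is moved out of a binder.\<close>

lemmas poly_rules = poly_const poly_bound_var poly_bit poly_conj poly_disj poly_not poly_imp poly_iff
  poly_eq poly_le poly_less poly_ex poly_all poly_add poly_mult poly_diff poly_Suc poly_bleast

lemma poly_nat_at:
  assumes "poly_fun vs X" "poly_fun vs L" "poly_fun vs p"
  shows "poly_fun vs (\<lambda>s. nat_at (X s) (L s) (p s))"
  unfolding nat_at_def by (insert assms, (assumption | rule poly_rules | rule poly_weaken)+)

text \<open>The environment is generalised because the level below is used under the binders of the
  table and its rules.\<close>

lemma poly_is_form:
  "poly_fun vs X \<Longrightarrow> poly_fun vs L \<Longrightarrow> poly_fun vs U \<Longrightarrow> poly_fun vs n \<Longrightarrow> poly_fun vs p \<Longrightarrow> poly_fun vs q \<Longrightarrow>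
    poly_pred vs (\<lambda>s. is_form a (X s) (L s) (U s) (n s) j (p s) (q s))"
proof (induction j arbitrary: vs X L U n p q)
  case 0
  show ?case
    unfolding is_form.simps by_table_def form_rule_def entry_def
    by (insert 0, (assumption | rule poly_rules | rule poly_weaken)+)
next
  case (Suc j)
  show ?case
    unfolding is_form.simps by_table_def form_rule_def entry_def
    by (insert Suc.prems, (assumption | rule Suc.IH | rule poly_rules | rule poly_weaken)+)
qed

text \<open>Towers are exponential in \<open>L\<close>, hence no polynomial functions of it; that
  the environment provides them at all levels is an assumption, which \<open>params\<close> will
  meet.\<close>

definition towers :: "nat \<Rightarrow> valuation list \<Rightarrow> valuation \<Rightarrow> nat \<Rightarrow> bool" where
  "towers a vs L k \<longleftrightarrow> (\<forall>j\<le>k. poly_fun vs (\<lambda>s. tower a (L s) j))"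

lemma towers_weaken: "towers a vs L k \<Longrightarrow> towers a (under vs) (\<lambda>p. L (tl p)) k"
  unfolding towers_def by (auto intro: poly_weaken)

lemma towers_Suc: "towers a vs L (Suc k) \<Longrightarrow> towers a vs L k"
  unfolding towers_def by auto

lemma poly_tower: "towers a vs L k \<Longrightarrow> poly_fun vs (\<lambda>s. tower a (L s) k)"
  unfolding towers_def by auto

lemma poly_type_holds:
  "poly_fun vs X \<Longrightarrow> poly_fun vs L \<Longrightarrow> poly_fun vs U \<Longrightarrow> poly_fun vs n \<Longrightarrow> poly_fun vs \<tau> \<Longrightarrow>
    poly_fun vs p \<Longrightarrow> poly_fun vs q \<Longrightarrow> towers a vs L j \<Longrightarrow>
    poly_pred vs (\<lambda>s. type_holds a (X s) (L s) (U s) (n s) j (\<tau> s) (p s) (q s))"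
proof (induction j arbitrary: vs X L U n \<tau> p q)
  case 0
  show ?case
    unfolding type_holds.simps by_table_def form_rule_def entry_def
    by (insert 0, (assumption | rule poly_is_form | rule poly_rules | rule poly_weaken)+)
next
  case (Suc j)
  show ?case
    unfolding type_holds.simps by_table_def form_rule_def entry_def
    by (insert Suc.prems towers_Suc[OF Suc.prems(8)],
        (assumption | rule Suc.IH poly_is_form poly_tower towers_weaken | rule poly_rules | rule poly_weaken)+)
qed

context
  fixes vs :: "valuation list" and X L :: valuation
  assumes X: "poly_fun vs X" and L: "poly_fun vs L"
begin

lemma poly_rd_props: "poly_fun vs (\<lambda>s. rd_props (X s) (L s))"
  unfolding rd_props_def by (rule X L poly_nat_at poly_const)+

lemma poly_rd_worlds: "poly_fun vs (\<lambda>s. rd_worlds (X s) (L s))"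
  unfolding rd_worlds_def by (rule X L poly_nat_at poly_const poly_add poly_rd_props)+

lemma poly_pos_rel: "poly_fun vs (\<lambda>s. pos_rel (X s) (L s))"
  unfolding pos_rel_def by (rule poly_const poly_add poly_rd_props poly_rd_worlds)+

lemma poly_pos_val: "poly_fun vs (\<lambda>s. pos_val a (X s) (L s))"
  unfolding pos_val_def by (rule poly_const poly_add poly_mult poly_pos_rel poly_rd_worlds)+

lemma poly_pos_point: "poly_fun vs (\<lambda>s. pos_point a (X s) (L s))"
  unfolding pos_point_def by (rule poly_add poly_mult poly_pos_val poly_rd_props poly_rd_worlds)+

lemma poly_rd_point: "poly_fun vs (\<lambda>s. rd_point a (X s) (L s))"
  unfolding rd_point_def by (rule X L poly_nat_at poly_pos_point)+

lemma poly_pos_events: "poly_fun vs (\<lambda>s. pos_events a (X s) (L s))"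
  unfolding pos_events_def by (rule poly_const poly_add poly_pos_point poly_rd_point)+

lemma poly_rd_events: "poly_fun vs (\<lambda>s. rd_events a (X s) (L s))"
  unfolding rd_events_def by (rule X L poly_nat_at poly_pos_events)+

lemma poly_pos_erel: "poly_fun vs (\<lambda>s. pos_erel a (X s) (L s))"
  unfolding pos_erel_def by (rule poly_const poly_add poly_pos_events poly_rd_events)+

lemma poly_pos_forms: "poly_fun vs (\<lambda>s. pos_forms a (X s) (L s))"
  unfolding pos_forms_def by (rule poly_const poly_add poly_mult poly_pos_erel poly_rd_events)+

end

lemma poly_pos_form:
  assumes "poly_fun vs X" "poly_fun vs L" "poly_fun vs U" "poly_fun vs c"
  shows "poly_fun vs (\<lambda>s. pos_form a (X s) (L s) (U s) (c s))"
  unfolding pos_form_def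
\<comment> \<open>On a malformed word the first position may exceed \<open>Suc L\<close>, so it
  enters the bound.\<close>
proof (rule poly_rec_bounded[where b = "\<lambda>s. pos_forms a (X s) (L s) + Suc (L s)"])
  show "poly_fun (under (under vs)) (\<lambda>p. bleast (Suc (L (tl (tl p))))
      (is_form a (X (tl (tl p))) (L (tl (tl p))) (U (tl (tl p))) (rd_props (X (tl (tl p))) (L (tl (tl p)))) 0 (hd p)))"
    by (insert assms, (assumption | rule poly_is_form poly_rd_props | rule poly_rules | rule poly_weaken)+)
  show "rec_nat (pos_forms a (X s) (L s)) (\<lambda>_ p. bleast (Suc (L s)) (is_form a (X s) (L s) (U s) (rd_props (X s) (L s)) 0 p)) i
      \<le> pos_forms a (X s) (L s) + Suc (L s)" for s i
    by (cases i) (auto intro!: order_trans[OF bleast_le])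
qed (insert assms, (assumption | rule poly_pos_forms | rule poly_rules)+)

lemma poly_pos_allowed:
  assumes "poly_fun vs X" "poly_fun vs L" "poly_fun vs U"
  shows "poly_fun vs (\<lambda>s. pos_allowed a (X s) (L s) (U s))"
  unfolding pos_allowed_def
  by (insert assms, (assumption | rule poly_pos_form poly_rd_events poly_rd_props | rule poly_rules)+)

lemma poly_pos_goal:
  assumes "poly_fun vs X" "poly_fun vs L" "poly_fun vs U"
  shows "poly_fun vs (\<lambda>s. pos_goal a (X s) (L s) (U s))"
  unfolding pos_goal_def
  by (insert assms, (assumption | rule poly_pos_allowed poly_rd_events | rule poly_rules)+)

lemmas poly_parse_rules = poly_is_form poly_type_holds poly_rd_props poly_rd_worlds poly_pos_rel poly_pos_val
  poly_rd_point poly_rd_events poly_pos_erel poly_pos_form poly_pos_allowed poly_pos_goal poly_tower towers_weaken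

lemma poly_valid:
  assumes "poly_fun vs X" "poly_fun vs L" "poly_fun vs U"
  shows "poly_pred vs (\<lambda>s. valid a k (X s) (L s) (U s))"
  unfolding valid_def
  by (insert assms, (assumption | rule poly_parse_rules | rule poly_rules | rule poly_weaken)+)

lemma poly_event_holds:
  assumes "poly_fun vs X" "poly_fun vs L" "poly_fun vs U" "poly_fun vs \<tau>" "poly_fun vs c" "towers a vs L 0"
  shows "poly_pred vs (\<lambda>s. event_holds a (X s) (L s) (U s) (\<tau> s) (c s))"
  unfolding event_holds_def
  by (insert assms, (assumption | rule poly_parse_rules | rule poly_rules)+)

lemma towers_0: "towers a vs L k \<Longrightarrow> towers a vs L 0"
  unfolding towers_def by auto

lemma poly_type_step:
  "poly_fun vs X \<Longrightarrow> poly_fun vs L \<Longrightarrow> poly_fun vs U \<Longrightarrow> poly_fun vs \<tau> \<Longrightarrow> poly_fun vs e \<Longrightarrow>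
    poly_fun vs \<tau>' \<Longrightarrow> towers a vs L j \<Longrightarrow>
    poly_pred vs (\<lambda>s. type_step a (X s) (L s) (U s) j (\<tau> s) (e s) (\<tau>' s))"
proof (induction j arbitrary: vs X L U \<tau> e \<tau>')
  case 0
  show ?case
    unfolding type_step.simps
    by (insert 0, (assumption | rule poly_event_holds poly_parse_rules | rule poly_rules | rule poly_weaken)+)
next
  case (Suc j)
  show ?case
    unfolding type_step.simps
    by (insert Suc.prems towers_Suc[OF Suc.prems(7)] towers_0[OF Suc.prems(7)],
        (assumption | rule Suc.IH poly_event_holds poly_parse_rules | rule poly_rules | rule poly_weaken)+)
qed

lemma poly_type_init:
  "poly_fun vs X \<Longrightarrow> poly_fun vs L \<Longrightarrow> poly_fun vs \<tau> \<Longrightarrow> poly_fun vs v \<Longrightarrow> towers a vs L j \<Longrightarrow>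
    poly_pred vs (\<lambda>s. type_init a (X s) (L s) j (\<tau> s) (v s))"
proof (induction j arbitrary: vs X L \<tau> v)
  case 0
  show ?case
    unfolding type_init.simps
    by (insert 0, (assumption | rule poly_parse_rules | rule poly_rules | rule poly_weaken)+)
next
  case (Suc j)
  show ?case
    unfolding type_init.simps
    by (insert Suc.prems towers_Suc[OF Suc.prems(5)],
        (assumption | rule Suc.IH poly_parse_rules | rule poly_rules | rule poly_weaken)+)
qed

lemma poly_plan_step:
  assumes "poly_fun vs X" "poly_fun vs L" "poly_fun vs U" "poly_fun vs \<tau>" "poly_fun vs e"
    "poly_fun vs \<tau>'" "towers a vs L k"
  shows "poly_pred vs (\<lambda>s. plan_step a k (X s) (L s) (U s) (\<tau> s) (e s) (\<tau>' s))"
  unfolding plan_step_def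
  by (insert assms towers_0[OF assms(7)],
      (assumption | rule poly_type_step poly_event_holds poly_parse_rules | rule poly_rules)+)

lemma poly_plan_final:
  assumes "poly_fun vs X" "poly_fun vs L" "poly_fun vs U" "poly_fun vs \<tau>" "towers a vs L k"
  shows "poly_pred vs (\<lambda>s. plan_final a k (X s) (L s) (U s) (\<tau> s))"
  unfolding plan_final_def
  by (insert assms, (assumption | rule poly_parse_rules | rule poly_rules)+)

lemmas poly_plan_rules = poly_plan_step poly_plan_final poly_type_init poly_valid

section \<open>Writing the code of the automaton\<close>

definition poly_emit :: "valuation list \<Rightarrow> (nat list \<Rightarrow> bool list) \<Rightarrow> bool" where
  "poly_emit vs S \<longleftrightarrow> poly_act vs (\<lambda>s z. (fst z, snd z @ S s))"

lemma emit_nil: "poly_emit vs (\<lambda>s. [])"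
  using act_skip by (simp add: poly_emit_def)

lemma emit_bit: "poly_emit vs (\<lambda>s. [b])"
  using act_emit by (simp add: poly_emit_def)

lemma emit_append: "poly_emit vs S \<Longrightarrow> poly_emit vs S' \<Longrightarrow> poly_emit vs (\<lambda>s. S s @ S' s)"
  unfolding poly_emit_def by (drule (1) act_seq) simp

lemma emit_if:
  assumes "poly_pred vs P" "poly_emit vs S" "poly_emit vs S'"
  shows "poly_emit vs (\<lambda>s. if P s then S s else S' s)"
proof -
  have "(\<lambda>s z. (fst z :: nat set, snd z @ (if P s then S s else S' s))) =
      (\<lambda>s z. if P s then (fst z, snd z @ S s) else (fst z, snd z @ S' s))"
    by (simp add: fun_eq_iff)
  then show ?thesis
    using act_if[OF assms(1) assms(2,3)[unfolded poly_emit_def]] by (simp only: poly_emit_def)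
qed

lemma emit_concat:
  assumes "poly_fun vs n" "poly_emit (under vs) (\<lambda>p. S (tl p) (hd p))"
  shows "poly_emit vs (\<lambda>s. concat (map (S s) [0..<n s]))"
proof -
  have "fold (\<lambda>i z. (fst z, snd z @ S s i)) [0..<m] z = (fst z, snd z @ concat (map (S s) [0..<m]))"
    for s m and z :: "nat set \<times> bool list"
    by (induction m) simp_all
  then have "(\<lambda>s. fold (\<lambda>i z. (fst z :: nat set, snd z @ S s i)) [0..<n s]) =
      (\<lambda>s z. (fst z, snd z @ concat (map (S s) [0..<n s])))"
    by (intro ext)
  then show ?thesis
    using act_for[OF assms(1), of "\<lambda>s i z. (fst z, snd z @ S s i)"] assms(2) by (simp only: poly_emit_def)
qed

lemma concat_map_singleton: "concat (map (\<lambda>_. [b]) xs) = replicate (length xs) b"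
  by (induction xs) auto

lemma enc_nat_eq_concat: "enc_nat n = concat (map (\<lambda>_. [True]) [0..<n]) @ [False]"
  unfolding concat_map_singleton by (simp add: enc_nat_def)

lemma emit_enc_nat:
  assumes "poly_fun vs n"
  shows "poly_emit vs (\<lambda>s. enc_nat (n s))"
  unfolding enc_nat_eq_concat by (rule emit_append emit_concat assms emit_bit)+

text \<open>The length prefix is one \<open>True\<close> per element, so the loops that write the
  elements can also write the prefix, without counting.\<close>

lemma enc_list_eq_concat:
  "enc_list f xs = concat (map (\<lambda>_. [True]) xs) @ [False] @ concat (map f xs)"
  unfolding concat_map_singleton by (simp add: enc_list_def enc_nat_def)

lemma concat_map_concat:
  "concat (map g (concat (map F ys))) = concat (map (\<lambda>y. concat (map g (F y))) ys)"
  by (induction ys) auto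

lemma concat_map_filter:
  "concat (map g (filter P ys)) = concat (map (\<lambda>y. if P y then g y else []) ys)"
  by (induction ys) auto

lemma concat_map_if: "concat (map g (if c then [t] else [])) = (if c then g t else [])"
  by simp

lemma emit_plan_nfa:
  assumes "poly_fun vs X" "poly_fun vs L" "poly_fun vs U" "towers a vs L k"
  shows "poly_emit vs (\<lambda>s. enc_nfa (plan_nfa a k (X s) (L s) (U s)))"
  unfolding enc_nfa_def plan_nfa_def Let_def nfa.simps enc_list_eq_concat concat_map_concat
    concat_map_filter concat_map_if prod.case
  by (insert assms, (assumption | rule emit_append emit_concat emit_if emit_bit emit_nil emit_enc_nat
        poly_plan_rules poly_parse_rules | rule poly_rules | rule poly_weaken)+)

section \<open>Deciding the existence of a solution plan\<close>

text \<open>Element \<open>Suc \<tau>\<close> of the set records that type \<open>\<tau>\<close> has been reached, element \<open>0\<close> that a final type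
  has.\<close>

definition mark_if :: "bool \<Rightarrow> nat \<Rightarrow> nat set \<times> bool list \<Rightarrow> nat set \<times> bool list" where
  "mark_if b y z = (if b then (insert y (fst z), snd z) else z)"

definition search_init :: "nat \<Rightarrow> (nat \<Rightarrow> bool) \<Rightarrow> nat set \<times> bool list \<Rightarrow> nat set \<times> bool list" where
  "search_init Q start = fold (\<lambda>\<tau>. mark_if (start \<tau>) (Suc \<tau>)) [0..<Q]"

text \<open>The set is updated in place, so a type marked early in a round may be expanded in the
  same round. This is harmless: soundness only asks for reachability, completeness only for progress
  by at least one edge per round.\<close>

definition search_round ::
  "nat \<Rightarrow> nat \<Rightarrow> (nat \<Rightarrow> nat \<Rightarrow> nat \<Rightarrow> bool) \<Rightarrow> nat set \<times> bool list \<Rightarrow> nat set \<times> bool list" where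
  "search_round Q m step = fold (\<lambda>u. fold (\<lambda>e. fold (\<lambda>v z. 
     if Suc u \<in> fst z then mark_if (step u e v) (Suc v) z else z) [0..<Q]) [0..<m]) [0..<Q]"

definition search_final :: "nat \<Rightarrow> (nat \<Rightarrow> bool) \<Rightarrow> nat set \<times> bool list \<Rightarrow> nat set \<times> bool list" where
  "search_final Q final = fold (\<lambda>u z. if Suc u \<in> fst z then mark_if (final u) 0 z else z) [0..<Q]"

text \<open>A path need not be longer than the number of edges, and as a relation on
  \<open>Q\<close> types the edge relation has at most \<open>Q * Q\<close> pairs; hence the number
  of rounds.\<close>

definition search ::
  "nat \<Rightarrow> nat \<Rightarrow> (nat \<Rightarrow> bool) \<Rightarrow> (nat \<Rightarrow> nat \<Rightarrow> nat \<Rightarrow> bool) \<Rightarrow> (nat \<Rightarrow> bool) \<Rightarrow>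
    nat set \<times> bool list \<Rightarrow> nat set \<times> bool list" where
  "search Q m start step final z = search_final Q final
     (fold (\<lambda>_. search_round Q m step) [0..<Q * Q] (search_init Q start z))"

lemma fold_fst_mono:
  assumes "\<And>i z. fst z \<subseteq> fst (F i z)"
  shows "fst z \<subseteq> (fst (fold F xs z) :: 'a set)"
proof (induction xs arbitrary: z)
  case (Cons i xs)
  show ?case
    using assms[of z i] Cons[of "F i z"] by auto
qed simp

lemma fold_invariant_fst:
  assumes "\<And>i z. i \<in> set xs \<Longrightarrow> Inv (fst z) \<Longrightarrow> Inv (fst (F i z))" "Inv (fst z)"
  shows "Inv (fst (fold F xs z))"
  using assms by (induction xs arbitrary: z) auto

text \<open>What one iteration inserts survives the later ones, so it suffices to exhibit an
  iteration that yields \<open>y\<close> whatever the earlier ones have added.\<close>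

lemma fold_reaches:
  assumes mono: "\<And>i z. fst z \<subseteq> fst (F i z)" and "i \<in> set xs"
    and "\<And>z'. fst z \<subseteq> fst z' \<Longrightarrow> y \<in> fst (F i z')"
  shows "y \<in> (fst (fold F xs z) :: 'a set)"
proof -
  obtain as bs where xs: "xs = as @ i # bs"
    using assms(2) split_list by metis
  have "y \<in> fst (F i (fold F as z))"
    by (rule assms(3)[OF fold_fst_mono[OF mono]])
  then show ?thesis
    using fold_fst_mono[where F = F, OF mono, where z = "F i (fold F as z)" and xs = bs] by (auto simp: xs)
qed

lemma mark_if_mono: "fst z \<subseteq> fst (mark_if b y z)"
  by (auto simp: mark_if_def)

lemma search_init_eq: "fst (search_init Q start ({}, w)) = Suc ` {\<tau>. \<tau> < Q \<and> start \<tau>}"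
proof -
  have "fst (fold (\<lambda>\<tau>. mark_if (start \<tau>) (Suc \<tau>)) [0..<Q] z) = fst z \<union> Suc ` {\<tau>. \<tau> < Q \<and> start \<tau>}" for z
    by (induction Q) (auto simp: mark_if_def less_Suc_eq)
  then show ?thesis
    by (simp add: search_init_def)
qed

lemma search_round_mono: "fst z \<subseteq> fst (search_round Q m step z)"
  unfolding search_round_def by (intro fold_fst_mono) (simp add: mark_if_mono)

lemma search_round_step:
  assumes "Suc u \<in> fst z" "u < Q" "e < m" "v < Q" "step u e v"
  shows "Suc v \<in> fst (search_round Q m step z)"
  unfolding search_round_def
proof (rule fold_reaches[where i = u])
  fix z' :: "nat set \<times> bool list" assume z': "fst z \<subseteq> fst z'"
  show "Suc v \<in> fst (fold (\<lambda>e. fold (\<lambda>v z. if Suc u \<in> fst z then mark_if (step u e v) (Suc v) z else z) [0..<Q]) [0..<m] z')"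
  proof (rule fold_reaches[where i = e])
    fix z'' :: "nat set \<times> bool list" assume z'': "fst z' \<subseteq> fst z''"
    show "Suc v \<in> fst (fold (\<lambda>v z. if Suc u \<in> fst z then mark_if (step u e v) (Suc v) z else z) [0..<Q] z'')"
    proof (rule fold_reaches[where i = v])
      fix z''' :: "nat set \<times> bool list" assume "fst z'' \<subseteq> fst z'''"
      then show "Suc v \<in> fst (if Suc u \<in> fst z''' then mark_if (step u e v) (Suc v) z''' else z''')"
        using assms z' z'' by (auto simp: mark_if_def)
    qed (use assms in \<open>auto simp: mark_if_mono subsetD\<close>)
  qed (use assms in \<open>auto intro: subsetD[OF fold_fst_mono] simp: mark_if_def\<close>)
qed (use assms in \<open>auto intro!: subsetD[OF fold_fst_mono] simp: mark_if_def\<close>)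

lemma search_round_invariant:
  assumes "\<And>A u e v. Inv A \<Longrightarrow> Suc u \<in> A \<Longrightarrow> u < Q \<Longrightarrow> e < m \<Longrightarrow> v < Q \<Longrightarrow> step u e v \<Longrightarrow> Inv (insert (Suc v) A)"
    and "Inv (fst z)"
  shows "Inv (fst (search_round Q m step z))"
  unfolding search_round_def
  by (rule fold_invariant_fst[OF fold_invariant_fst[OF fold_invariant_fst]])
    (use assms in \<open>auto simp: mark_if_def\<close>)

lemma search_final_iff:
  assumes "0 \<notin> fst z"
  shows "0 \<in> fst (search_final Q final z) \<longleftrightarrow> (\<exists>u<Q. Suc u \<in> fst z \<and> final u)"
proof -
  have "fst (search_final Q final z) = fst z \<union> (if \<exists>u<Q. Suc u \<in> fst z \<and> final u then {0} else {})"
    unfolding search_final_def by (induction Q) (auto simp: mark_if_def less_Suc_eq)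
  then show ?thesis
    using assms by auto
qed

lemma search_iff:
  "0 \<in> fst (search Q m start step final ({}, w)) \<longleftrightarrow>
    (\<exists>u v. u < Q \<and> start u \<and> (u, v) \<in> {(u, v). u < Q \<and> v < Q \<and> (\<exists>e<m. step u e v)}\<^sup>* \<and> final v)"
proof -
  define R where "R = {(u, v). u < Q \<and> v < Q \<and> (\<exists>e<m. step u e v)}"
  define z where "z t = fold (\<lambda>_. search_round Q m step) [0..<t] (search_init Q start ({}, w))" for t
  define reach where "reach = {v. \<exists>u. u < Q \<and> start u \<and> (u, v) \<in> R\<^sup>*}"
  have z_Suc: "z (Suc t) = search_round Q m step (z t)" for t
    by (simp add: z_def)
  have z_0: "fst (z 0) = Suc ` {\<tau>. \<tau> < Q \<and> start \<tau>}"
    by (simp add: z_def search_init_eq)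
  have sound: "fst (z t) \<subseteq> Suc ` reach" for t
  proof (induction t)
    case 0
    then show ?case
      by (auto simp: z_0 reach_def)
  next
    case (Suc t)
    show ?case
      unfolding z_Suc
    proof (rule search_round_invariant[where Inv = "\<lambda>A. A \<subseteq> Suc ` reach"])
      fix A u e v
      assume "A \<subseteq> Suc ` reach" "Suc u \<in> A" "u < Q" "e < m" "v < Q" "step u e v"
      moreover from this have "(u, v) \<in> R" "u \<in> reach"
        by (auto simp: R_def)
      then have "v \<in> reach"
        by (auto simp: reach_def intro: rtrancl_into_rtrancl)
      ultimately show "insert (Suc v) A \<subseteq> Suc ` reach"
        by auto
    qed (rule Suc)
  qed
  have mono: "fst (z t) \<subseteq> fst (z t')" if "t \<le> t'" for t t'
    using that
  proof (induction rule: dec_induct)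
    case (step t')
    show ?case
      unfolding z_Suc by (rule order_trans[OF step.IH search_round_mono])
  qed simp
  have steps: "Suc v \<in> fst (z t)" if "u < Q" "start u" "(u, v) \<in> R ^^ t" for u v t
    using that(3)
  proof (induction t arbitrary: v)
    case 0
    then show ?case
      using that by (auto simp: z_0)
  next
    case (Suc t)
    then obtain y where y: "(u, y) \<in> R ^^ t" "(y, v) \<in> R"
      by auto
    then obtain e where "y < Q" "v < Q" "e < m" "step y e v"
      by (auto simp: R_def)
    then show ?case
      unfolding z_Suc using search_round_step[OF Suc.IH[OF y(1)]] by blast
  qed
  have fin: "finite R"
    by (rule finite_subset[of _ "{..<Q} \<times> {..<Q}"]) (auto simp: R_def)
  have "card R \<le> card ({..<Q} \<times> {..<Q})"
    by (rule card_mono) (auto simp: R_def)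
  then have card: "card R \<le> Q * Q"
    by (simp add: card_cartesian_product)
  have complete: "Suc v \<in> fst (z (Q * Q))" if v: "v \<in> reach" for v
  proof -
    obtain u where u: "u < Q" "start u" "(u, v) \<in> R\<^sup>*"
      using v by (auto simp: reach_def)
    then obtain t where "t \<le> card R" "(u, v) \<in> R ^^ t"
      using rtrancl_finite_eq_relpow[OF fin] by auto
    then show ?thesis
      using steps[OF u(1,2)] mono[of t "Q * Q"] card by auto
  qed
  have "0 \<notin> fst (z (Q * Q))"
    using sound by blast
  from search_final_iff[OF this] have "0 \<in> fst (search Q m start step final ({}, w)) \<longleftrightarrow>
      (\<exists>v<Q. Suc v \<in> fst (z (Q * Q)) \<and> final v)"
    by (simp add: search_def z_def)
  also have "\<dots> \<longleftrightarrow> (\<exists>v\<in>reach. final v)"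
  proof -
    have "v < Q" if "(u, v) \<in> R\<^sup>*" "u < Q" for u v
      using that by (induction rule: rtrancl_induct) (auto simp: R_def)
    then have "v < Q" if "v \<in> reach" for v
      using that unfolding reach_def by blast
    moreover have "v \<in> reach" if "Suc v \<in> fst (z (Q * Q))" for v
      using sound that by blast
    ultimately show ?thesis
      using complete by blast
  qed
  finally show ?thesis
    unfolding reach_def R_def by blast
qed

lemma act_mark_if: "poly_pred vs P \<Longrightarrow> poly_fun vs f \<Longrightarrow> poly_act vs (\<lambda>s. mark_if (P s) (f s))"
  unfolding mark_if_def using act_if[OF _ act_insert act_skip] .

text \<open>Validity of the word is part of the start condition: on a malformed word no type is ever
  marked, and the machine rejects.\<close>

lemma act_search:
  assumes "poly_fun vs X" "poly_fun vs L" "poly_fun vs U" "towers a vs L k"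
  shows "poly_act vs (\<lambda>s. search (tower a (L s) k) (rd_events a (X s) (L s))
    (\<lambda>\<tau>. valid a k (X s) (L s) (U s) \<and> type_init a (X s) (L s) k \<tau> (rd_point a (X s) (L s)))
    (plan_step a k (X s) (L s) (U s)) (plan_final a k (X s) (L s) (U s)))"
proof -
  let ?start = "\<lambda>s \<tau>. valid a k (X s) (L s) (U s) \<and> type_init a (X s) (L s) k \<tau> (rd_point a (X s) (L s))"
  let ?Q = "\<lambda>s. tower a (L s) k" and ?m = "\<lambda>s. rd_events a (X s) (L s)"
  let ?step = "\<lambda>s. plan_step a k (X s) (L s) (U s)" and ?final = "\<lambda>s. plan_final a k (X s) (L s) (U s)"
  have "poly_act vs (\<lambda>s. search_init (?Q s) (?start s))"
    unfolding search_init_def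
    by (insert assms, (assumption | rule act_for act_mark_if poly_plan_rules poly_parse_rules
          | rule poly_rules | rule poly_weaken)+)
  moreover have "poly_act vs (\<lambda>s. fold (\<lambda>_. search_round (?Q s) (?m s) (?step s)) [0..<?Q s * ?Q s])"
    unfolding search_round_def
    by (insert assms, (assumption | rule act_for act_if_mem act_skip act_mark_if poly_plan_rules poly_parse_rules
          | rule poly_rules | rule poly_weaken)+)
  moreover have "poly_act vs (\<lambda>s. search_final (?Q s) (?final s))"
    unfolding search_final_def
    by (insert assms, (assumption | rule act_for act_if_mem act_skip act_mark_if poly_plan_rules poly_parse_rules
          | rule poly_rules | rule poly_weaken)+)
  ultimately have "poly_act vs (\<lambda>s z. search_final (?Q s) (?final s)
      (fold (\<lambda>_. search_round (?Q s) (?m s) (?step s)) [0..<?Q s * ?Q s] (search_init (?Q s) (?start s) z)))"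
    using act_seq by blast
  then show ?thesis
    by (simp only: search_def[abs_def])
qed

section \<open>Iterated exponential bounds\<close>

lemma iter_exp_strict_mono: "p < q \<Longrightarrow> iter_exp j p < iter_exp j q"
  by (induction j) auto

lemma iter_exp_mono: "p \<le> q \<Longrightarrow> iter_exp j p \<le> iter_exp j q"
  using iter_exp_strict_mono[of p q j] by (cases "p = q") auto

lemma iter_exp_ge: "p \<le> iter_exp j p"
proof (induction j)
  case (Suc j)
  show ?case
    unfolding iter_exp.simps by (rule order_trans[OF Suc less_imp_le[OF less_exp]])
qed simp

text \<open>The summand \<open>1\<close> makes the argument strictly larger than \<open>p\<close>
  and \<open>q\<close>, which gains a factor of two above level \<open>0\<close>.\<close>

lemma iter_exp_add: "iter_exp j p + iter_exp j q \<le> iter_exp j (p + q + 1)"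
proof (cases j)
  case (Suc i)
  have lt: "iter_exp i p < iter_exp i (p + q + 1)" "iter_exp i q < iter_exp i (p + q + 1)"
    by (simp_all add: iter_exp_strict_mono)
  have "2 * 2 ^ iter_exp i r \<le> (2 :: nat) ^ iter_exp i (p + q + 1)" if "iter_exp i r < iter_exp i (p + q + 1)" for r
    using power_increasing[of "Suc (iter_exp i r)" "iter_exp i (p + q + 1)" "2 :: nat"] that by simp
  from this[OF lt(1)] this[OF lt(2)] show ?thesis
    unfolding Suc iter_exp.simps by linarith
qed simp

definition iter_exp_bounded :: "nat \<Rightarrow> (nat \<Rightarrow> nat) \<Rightarrow> bool" where
  "iter_exp_bounded j g \<longleftrightarrow> (\<exists>P :: nat poly. \<forall>L. g L \<le> iter_exp j (poly P L))"

lemma iter_exp_bounded_poly: "iter_exp_bounded j (poly P)"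
  unfolding iter_exp_bounded_def using iter_exp_ge by blast

lemma iter_exp_bounded_mono: "iter_exp_bounded j g \<Longrightarrow> (\<And>L. f L \<le> g L) \<Longrightarrow> iter_exp_bounded j f"
  unfolding iter_exp_bounded_def by (meson order_trans)

lemma iter_exp_bounded_const: "iter_exp_bounded j (\<lambda>L. c)"
  by (rule iter_exp_bounded_mono[OF iter_exp_bounded_poly[of j "[:c:]"]]) simp

lemma iter_exp_bounded_id: "iter_exp_bounded j (\<lambda>L. L)"
  by (rule iter_exp_bounded_mono[OF iter_exp_bounded_poly[of j "[:0, 1:]"]]) simp

lemma iter_exp_bounded_Suc: "iter_exp_bounded j g \<Longrightarrow> iter_exp_bounded (Suc j) g"
  unfolding iter_exp_bounded_def iter_exp.simps by (meson less_exp less_imp_le order_trans)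

lemma iter_exp_bounded_le: "iter_exp_bounded j g \<Longrightarrow> j \<le> j' \<Longrightarrow> iter_exp_bounded j' g"
proof -
  assume g: "iter_exp_bounded j g" and "j \<le> j'"
  from this(2) show ?thesis
    by (induction rule: dec_induct) (rule g iter_exp_bounded_Suc, assumption?)+
qed

lemma iter_exp_bounded_add:
  assumes "iter_exp_bounded j f" "iter_exp_bounded j g"
  shows "iter_exp_bounded j (\<lambda>L. f L + g L)"
proof -
  obtain P Q where PQ: "\<And>L. f L \<le> iter_exp j (poly P L)" "\<And>L. g L \<le> iter_exp j (poly Q L)"
    using assms unfolding iter_exp_bounded_def by blast
  have "f L + g L \<le> iter_exp j (poly (P + Q + [:1:]) L)" for L
    using add_mono[OF PQ(1)[of L] PQ(2)[of L]] iter_exp_add[of j "poly P L" "poly Q L"] by simp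
  then show ?thesis
    unfolding iter_exp_bounded_def by blast
qed

lemma iter_exp_bounded_pow2: "iter_exp_bounded j g \<Longrightarrow> iter_exp_bounded (Suc j) (\<lambda>L. 2 ^ g L)"
  unfolding iter_exp_bounded_def iter_exp.simps by (meson one_le_numeral power_increasing)

text \<open>A product is a sum in the exponents one level below, hence the level
  \<open>Suc j\<close>.\<close>

lemma iter_exp_bounded_mult:
  assumes "iter_exp_bounded (Suc j) f" "iter_exp_bounded (Suc j) g"
  shows "iter_exp_bounded (Suc j) (\<lambda>L. f L * g L)"
proof -
  obtain P Q where PQ: "\<And>L. f L \<le> 2 ^ iter_exp j (poly P L)" "\<And>L. g L \<le> 2 ^ iter_exp j (poly Q L)"
    using assms unfolding iter_exp_bounded_def iter_exp.simps by blast
  have "iter_exp_bounded j (\<lambda>L. iter_exp j (poly P L))" "iter_exp_bounded j (\<lambda>L. iter_exp j (poly Q L))"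
    unfolding iter_exp_bounded_def by blast+
  from iter_exp_bounded_pow2[OF iter_exp_bounded_add[OF this]] show ?thesis
    by (rule iter_exp_bounded_mono) (simp add: power_add PQ mult_le_mono)
qed

lemma iter_exp_bounded_power:
  "iter_exp_bounded (Suc j) g \<Longrightarrow> iter_exp_bounded (Suc j) (\<lambda>L. g L ^ e)"
  by (induction e) (simp_all add: iter_exp_bounded_const iter_exp_bounded_mult)

text \<open>Each level spends one exponential; the factor \<open>a\<close> and the summand
  \<open>L\<close> are absorbed before it is taken.\<close>

lemma iter_exp_bounded_tower: "iter_exp_bounded (Suc j) (\<lambda>L. tower a L j)"
proof (induction j)
  case 0
  show ?case
    using iter_exp_bounded_pow2[OF iter_exp_bounded_id[of 0]] by simp
next
  case (Suc j)
  have "iter_exp_bounded (Suc j) (\<lambda>L. L + a * tower a L j)"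
    by (intro iter_exp_bounded_add iter_exp_bounded_mult iter_exp_bounded_id iter_exp_bounded_const Suc)
  from iter_exp_bounded_pow2[OF this] show ?case
    by simp
qed

text \<open>The summand \<open>2 ^ L\<close> accounts for the input word as a number.\<close>

definition magnitude_bound :: "nat \<Rightarrow> nat \<Rightarrow> nat \<Rightarrow> nat" where
  "magnitude_bound a k L = 2 + 2 ^ L + L + (\<Sum>j<Suc k. tower a L j) + table_bound L"

lemma magnitude_params_le: "magnitude (params a k) (input_env x) \<le> magnitude_bound a k (length x)"
proof -
  have "(\<Sum>j\<leftarrow>[0..<Suc k]. tower a (length x) j) = (\<Sum>j<Suc k. tower a (length x) j)"
    by (simp only: interv_sum_list_conv_sum_set_nat atLeast0LessThan set_upt)
  then show ?thesis
    using num_less[of x]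
    by (simp add: magnitude_bound_def magnitude_def params_def tower_params_def input_env_def table_bound_def comp_def)
qed

lemma iter_exp_bounded_magnitude: "iter_exp_bounded (Suc k) (magnitude_bound a k)"
proof -
  have "iter_exp_bounded (Suc k) (\<lambda>L. \<Sum>j<i. tower a L j)" if "i \<le> Suc k" for i
    using that
  proof (induction i)
    case (Suc i)
    have "iter_exp_bounded (Suc k) (\<lambda>L. tower a L i)"
      by (rule iter_exp_bounded_le[OF iter_exp_bounded_tower]) (use Suc.prems in simp)
    then show ?case
      using Suc by (simp add: iter_exp_bounded_add)
  qed (simp add: iter_exp_bounded_const)
  moreover have "iter_exp_bounded (Suc k) (\<lambda>L. 2 ^ L)"
    by (rule iter_exp_bounded_le[OF iter_exp_bounded_pow2[OF iter_exp_bounded_id[of 0]]]) simp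
  moreover have "iter_exp_bounded (Suc k) table_bound"
  proof -
    have "iter_exp_bounded 0 (\<lambda>L. Suc L * Suc L)"
      by (rule iter_exp_bounded_mono[OF iter_exp_bounded_poly[of 0 "[:1, 2, 1:]"]]) simp
    from iter_exp_bounded_le[OF iter_exp_bounded_pow2[OF this], of "Suc k"] show ?thesis
      by (simp add: table_bound_def[abs_def])
  qed
  ultimately show ?thesis
    unfolding magnitude_bound_def[abs_def]
    by (intro iter_exp_bounded_add iter_exp_bounded_const iter_exp_bounded_id) (simp_all del: sum.lessThan_Suc)
qed

section \<open>Machines with iterated exponential time bounds\<close>

lemma turing_machine_of_act_iter_exp:
  assumes "poly_act (params a k) F"
  obtains M and P :: "nat poly" where "wf_tm M"
    "\<And>x. \<exists>t \<le> iter_exp (k + 1) (poly P (length x)).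
       fst (tm_run M x t) = (if 0 \<in> fst (F (input_env x) ({}, [])) then tm_accept M else tm_reject M) \<and>
       has_output (tm_run M x t) (snd (F (input_env x) ({}, [])))"
proof -
  obtain M e where M: "wf_tm M" "\<And>x. \<exists>t \<le> magnitude (params a k) (input_env x) ^ e.
     fst (tm_run M x t) = (if 0 \<in> fst (F (input_env x) ({}, [])) then tm_accept M else tm_reject M) \<and>
     has_output (tm_run M x t) (snd (F (input_env x) ({}, [])))"
    using turing_machine_of_act[OF assms] by blast
  obtain P where P: "\<And>L. magnitude_bound a k L ^ e \<le> iter_exp (Suc k) (poly P L)"
    using iter_exp_bounded_power[OF iter_exp_bounded_magnitude, of k a e] unfolding iter_exp_bounded_def by blast
  have "magnitude (params a k) (input_env x) ^ e \<le> iter_exp (k + 1) (poly P (length x))" for x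
    using power_mono[OF magnitude_params_le[of a k x], of e] P[of "length x"] by simp
  then show thesis
    using M by (intro that[of M P]) (meson order_trans)+
qed

lemma poly_mono_nat: "x \<le> y \<Longrightarrow> poly P x \<le> poly (P :: nat poly) y"
  by (induction P) (auto intro!: add_mono mult_le_mono)

lemma poly_params:
  shows "poly_fun (params a k) (\<lambda>s. s ! 0)" "poly_fun (params a k) (\<lambda>s. s ! 1)"
    "poly_fun (params a k) (\<lambda>s. table_bound (s ! 1))" "towers a (params a k) (\<lambda>s. s ! 1) k"
proof -
  show "poly_fun (params a k) (\<lambda>s. s ! 0)" "poly_fun (params a k) (\<lambda>s. s ! 1)"
    by (rule poly_var, simp add: params_def tower_params_def)+
  show "poly_fun (params a k) (\<lambda>s. table_bound (s ! 1))"
    by (rule poly_var) (simp add: params_def table_bound_def)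
  show "towers a (params a k) (\<lambda>s. s ! 1) k"
    unfolding towers_def
  proof (intro allI impI poly_var)
    fix j
    assume "j \<le> k"
    then have "(\<lambda>s. tower a (s ! 1) j) \<in> (\<lambda>j s. tower a (s ! 1) j) ` set [0..<Suc k]"
      by (intro imageI) auto
    then show "(\<lambda>s. tower a (s ! 1) j) \<in> set (params a k)"
      unfolding params_def tower_params_def set_append set_map by blast
  qed
qed

text \<open>The right-hand side is the reachability condition that \<open>search_iff\<close> proves
  the search to decide.\<close>

lemma plan_nfa_nonempty_iff:
  "nfa_language (plan_nfa a k X L U) \<noteq> {} \<longleftrightarrow>
    (\<exists>u v. u < tower a L k \<and> type_init a X L k u (rd_point a X L) \<and>
      (u, v) \<in> {(u, v). u < tower a L k \<and> v < tower a L k \<and>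
         (\<exists>e<rd_events a X L. plan_step a k X L U u e v)}\<^sup>* \<and> plan_final a k X L U v)"
proof -
  let ?A = "plan_nfa a k X L U" and ?Q = "tower a L k"
  let ?R = "{(u, v). u < ?Q \<and> v < ?Q \<and> (\<exists>e<rd_events a X L. plan_step a k X L U u e v)}"
  have "(u, v) \<in> ?R\<^sup>*" if "nfa_path ?A u es v" for u es v
    using that
  proof (induction rule: nfa_path.induct)
    case (2 q e q' es q'')
    then have "(q, q') \<in> ?R"
      by (auto simp: set_plan_trans)
    then show ?case
      using 2 by (meson converse_rtrancl_into_rtrancl)
  qed simp
  moreover have "\<exists>es. nfa_path ?A u es v" if "(u, v) \<in> ?R\<^sup>*" for u v
    using that
  proof (induction rule: converse_rtrancl_induct)
    case base
    show ?case
      using nfa_path.intros(1) by blast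
  next
    case (step u u')
    then obtain e es where "(u, e, u') \<in> set (nfa_trans ?A)" "nfa_path ?A u' es v"
      by (auto simp: set_plan_trans)
    then show ?case
      using nfa_path.intros(2) by blast
  qed
  ultimately have path: "(\<exists>es. nfa_path ?A u es v) \<longleftrightarrow> (u, v) \<in> ?R\<^sup>*" for u v
    by blast
  have bound: "v < ?Q" if "(u, v) \<in> ?R\<^sup>*" "u < ?Q" for u v
    using that by (induction rule: rtrancl_induct) auto
  have "nfa_language ?A \<noteq> {} \<longleftrightarrow> (\<exists>u\<in>set (nfa_init ?A). \<exists>v\<in>set (nfa_final ?A). (u, v) \<in> ?R\<^sup>*)"
    unfolding path[symmetric] nfa_language_def by blast
  also have "\<dots> \<longleftrightarrow> (\<exists>u v. u < ?Q \<and> type_init a X L k u (rd_point a X L) \<and> (u, v) \<in> ?R\<^sup>* \<and>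
      plan_final a k X L U v)"
  proof -
    have "set (nfa_init ?A) = {u. u < ?Q \<and> type_init a X L k u (rd_point a X L)}"
      "set (nfa_final ?A) = {v. v < ?Q \<and> plan_final a k X L U v}"
      by (auto simp: plan_nfa_def Let_def)
    then show ?thesis
      using bound by blast
  qed
  finally show ?thesis .
qed

lemma planning_language_iff:
  "x \<in> planning_language a k \<longleftrightarrow> valid a k (num x) (length x) (table_bound (length x)) \<and>
    nfa_language (plan_nfa a k (num x) (length x) (table_bound (length x))) \<noteq> {}"
proof
  assume "x \<in> planning_language a k"
  then obtain I where I: "wf_instance a I" "x = enc_instance a I" "nesting_depth (goal_form I) = k"
    "solution_plans I \<noteq> {}"
    by (auto simp: planning_language_def)
  interpret encoded_instance a I x
    using I by unfold_locales
  show "valid a k (num x) (length x) (table_bound (length x)) \<and>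
      nfa_language (plan_nfa a k (num x) (length x) (table_bound (length x))) \<noteq> {}"
    using valid_encoded language_plans I(3,4) by simp
next
  assume *: "valid a k (num x) (length x) (table_bound (length x)) \<and>
      nfa_language (plan_nfa a k (num x) (length x) (table_bound (length x))) \<noteq> {}"
  then obtain I where I: "wf_instance a I" "nesting_depth (goal_form I) = k" "x = enc_instance a I"
    using encoded_instance_of_valid by blast
  interpret encoded_instance a I x
    using I by unfold_locales
  show "x \<in> planning_language a k"
    using language_plans I * by (auto simp: planning_language_def)
qed

lemma planning_in_k_EXPTIME: "planning_language a k \<in> k_EXPTIME (k + 1)"
proof -
  define F where "F s = search (tower a (s ! 1) k) (rd_events a (s ! 0) (s ! 1))
    (\<lambda>\<tau>. valid a k (s ! 0) (s ! 1) (table_bound (s ! 1)) \<and>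
       type_init a (s ! 0) (s ! 1) k \<tau> (rd_point a (s ! 0) (s ! 1)))
    (plan_step a k (s ! 0) (s ! 1) (table_bound (s ! 1)))
    (plan_final a k (s ! 0) (s ! 1) (table_bound (s ! 1)))" for s
  have "poly_act (params a k) F"
    unfolding F_def using poly_params by (rule act_search)
  then obtain M and P :: "nat poly" where M: "wf_tm M"
    "\<And>x. \<exists>t \<le> iter_exp (k + 1) (poly P (length x)).
       fst (tm_run M x t) = (if 0 \<in> fst (F (input_env x) ({}, [])) then tm_accept M else tm_reject M)"
    by (rule turing_machine_of_act_iter_exp) blast
  have "0 \<in> fst (F (input_env x) ({}, [])) \<longleftrightarrow> x \<in> planning_language a k" for x
    unfolding F_def search_iff planning_language_iff plan_nfa_nonempty_iff
    by (auto simp: input_env_def)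
  then have "(x \<in> planning_language a k \<longrightarrow> accepts_within M x (iter_exp (k + 1) (poly P (length x)))) \<and>
      (x \<notin> planning_language a k \<longrightarrow> rejects_within M x (iter_exp (k + 1) (poly P (length x))))" for x
    using M(2)[of x] by (auto simp: accepts_within_def rejects_within_def)
  then show ?thesis
    unfolding k_EXPTIME_def using M(1) by blast
qed

lemma plan_automaton_computable:
  "\<exists>(M :: tm) (P :: nat poly). wf_tm M \<and>
    (\<forall>I. wf_instance a I \<longrightarrow> nesting_depth (goal_form I) = k \<longrightarrow>
      (\<exists>A. wf_nfa (allowed I) A \<and> nfa_language A = solution_plans I \<and>
           outputs_within M (enc_instance a I) (enc_nfa A)
             (iter_exp (k + 1) (poly P (instance_size a I + card (idle_worlds a I))))))"
proof -
  define A where "A s = plan_nfa a k (s ! 0) (s ! 1) (table_bound (s ! 1))" for s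
  \<comment> \<open>Inserting \<open>0\<close> makes the machine halt in its accepting state on
    every word, as \<open>outputs_within\<close> demands.\<close>
  define F where "F s z = (insert 0 (fst z), snd z @ enc_nfa (A s))" for s and z :: "nat set \<times> bool list"
  have "poly_act (params a k) (\<lambda>s z. (fst z, snd z @ enc_nfa (A s)))"
    using emit_plan_nfa[OF poly_params] unfolding poly_emit_def A_def .
  from act_seq[OF this act_insert[OF poly_const[of _ 0]]] have "poly_act (params a k) F"
    by (simp add: F_def[abs_def])
  then obtain M and P :: "nat poly" where wf_M: "wf_tm M" and
    "\<And>x. \<exists>t \<le> iter_exp (k + 1) (poly P (length x)).
       fst (tm_run M x t) = (if 0 \<in> fst (F (input_env x) ({}, [])) then tm_accept M else tm_reject M) \<and>
       has_output (tm_run M x t) (snd (F (input_env x) ({}, [])))"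
    by (rule turing_machine_of_act_iter_exp) blast
  then have M: "\<exists>t \<le> iter_exp (k + 1) (poly P (length x)). fst (tm_run M x t) = tm_accept M \<and>
       has_output (tm_run M x t) (enc_nfa (A (input_env x)))" for x
    by (simp add: F_def)
  \<comment> \<open>The polynomial \<open>(6 * a + 20) * (S + 1) ^ 2\<close> is the bound on the
    code length from \<open>length_enc_instance\<close>.\<close>
  define P' where "P' = pcompose P (smult (6 * a + 20) ([:1, 1:] ^ 2))"
  have "wf_nfa (allowed I) (A (input_env (enc_instance a I))) \<and>
      nfa_language (A (input_env (enc_instance a I))) = solution_plans I \<and>
      outputs_within M (enc_instance a I) (enc_nfa (A (input_env (enc_instance a I))))
        (iter_exp (k + 1) (poly P' (instance_size a I + card (idle_worlds a I))))"
    if I: "wf_instance a I" "nesting_depth (goal_form I) = k" for I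
  proof -
    define x where "x = enc_instance a I"
    define S where "S = instance_size a I + card (idle_worlds a I)"
    interpret encoded_instance a I x
      using I(1) x_def by unfold_locales
    have A: "A (input_env x) = plan_nfa a k (num x) (length x) (table_bound (length x))"
      by (simp add: A_def input_env_def)
    have "poly P (length x) \<le> poly P ((6 * a + 20) * (S + 1)\<^sup>2)"
      unfolding x_def S_def by (intro poly_mono_nat length_enc_instance I(1))
    also have "\<dots> = poly P' S"
      by (simp add: P'_def poly_pcompose add.commute)
    finally have "iter_exp (k + 1) (poly P (length x)) \<le> iter_exp (k + 1) (poly P' S)"
      by (rule iter_exp_mono)
    then have "outputs_within M x (enc_nfa (A (input_env x))) (iter_exp (k + 1) (poly P' S))"
      unfolding outputs_within_def using M[of x] by (meson order_trans)
    then show ?thesis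
      using wf_plans language_plans I(2) unfolding x_def[symmetric] S_def[symmetric] A by simp
  qed
  then show ?thesis
    using wf_M by blast
qed

theorem theorem2:
  fixes a k :: nat
  shows "planning_language a k \<in> k_EXPTIME (k + 1) \<and>
    (\<exists>(M :: tm) (P :: nat poly). wf_tm M \<and>
      (\<forall>I. wf_instance a I \<longrightarrow> nesting_depth (goal_form I) = k \<longrightarrow>
        (\<exists>A. wf_nfa (allowed I) A \<and> nfa_language A = solution_plans I \<and>
             outputs_within M (enc_instance a I) (enc_nfa A)
               (iter_exp (k + 1) (poly P (instance_size a I + card (idle_worlds a I)))))))"
  using planning_in_k_EXPTIME plan_automaton_computable by (rule conjI)

end
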